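(* Let $[x:y:z]$ be homogeneous coordinates on $\mathbb{P}^2$ and let $$f_2:=\left(y+\tfrac{x}{3}\right)z-\tfrac{y^2}{6},\qquad f_4:=x^2z^2-\left(xy^2+\tfrac{9x^2y}{2}+\tfrac{3x^3}{2}\right)z+\tfrac{y^4}{4}+\tfrac{3x^2y^2}{4}.$$ Let $\mathcal{C}_2=\{f_2=0\}$, $\mathcal{C}_4=\{f_4=0\}$, let $\mathcal{C}_6=\mathcal{C}_2\cup\mathcal{C}_4$, and let $S,R$ be the two points of $\mathcal{C}_2\cap\mathcal{C}_4$, where $S$ is the point at which $\mathcal{C}_4$ has an $\mathbb{A}_4$ singularity. Then there exist a conic $\mathcal{Q}=\{q=0\}$ passing through $S$ and $R$, with tangent line $L=\{\ell=0\}$ at $S$, such that $\mathcal{C}_2+2L$, $\mathcal{C}_4$ and $2\mathcal{Q}$ are members of a pencil of quartics. Consequently, for suitably normalized equations $\ell$ and $q$, the map $$\mathbb{P}^2\setminus\mathcal{C}_6\to\mathbb{P}^1_{(2,[0:1]),(2,[1:0]),(\infty,[1:1])},\qquad [x:y:z]\mapsto[f_2\ell^2:q^2],$$ is a marked global quotient orbifold pencil from $(\mathbb{P}^2\setminus\mathcal{C}_6,\chi)$ to $(\mathbb{P}^1_{(2,[0:1]),(2,[1:0]),(\infty,[1:1])},\rho)$, where $\chi$ is the character equal to $-1$ on meridians of $\mathcal{C}_2$ and to $1$ on meridians of $\mathcal{C}_4$, and $\rho$ is the character equal to $-1$ on meridians of $[0:1]$ and of $[1:0]$ and to $1$ on meridians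 of $[1:1]$.
   Context: $\mathbb{P}^1_{(2,[0:1]),(2,[1:0]),(\infty,[1:1])}$ denotes the orbicurve whose underlying Riemann surface is $\mathbb{P}^1\setminus\{[1:1]\}$, with two orbifold points $[0:1]$ and $[1:0]$ of label $2$; its orbifold fundamental group (the fundamental group of the complement of the orbifold points modulo the relations $\mu^2=1$ for meridians $\mu$ of the orbifold points) is $\mathbb{Z}_2*\mathbb{Z}_2$. It is the global quotient of $C:=\mathbb{P}^1\setminus\{[1:1],[1:-1]\}$ by $G=\mathbb{Z}_2$ acting by $[u:v]\mapsto[-u:v]$, with quotient map $[u:v]\mapsto[u^2:v^2]$. A global quotient orbifold pencil $\phi:\mathcal{X}\to\mathcal{C}$, where $\mathcal{C}$ is an orbicurve which is the quotient of a curve $C$ by a finite group $G$, is a map for which there are a quasi-projective manifold $X_G$ with an action of $G$ and quotient $\mathcal{X}$, and a map $\Phi:X_G\to C$ commuting with the quotient maps $X_G\to\mathcal{X}$, $C\to\mathcal{C}$ and with $\phi$. A marking on a quasi-projective variety or orbicurve is a non-trivial character of its (orbifold) fundamental group of positive depth, where the depth is the dimension of the first cohomology with coefficients in the rank one complex local system given by the character (group cohomology of $\pi_1^{\mathrm{orb}}$ for orbicurves). The pencil is marked, $(\mathcal{X},\chi)\to(\mathcal{C},\rho)$, if $\chi$ and $\rho$ are markings and $\chi=\phi^*(\rho)$. A meridian of a curve component (or of a point of $\mathbb{P}^1$) is a loop bounding a small disk transversal to the component at a smooth point (or centered at the point). For a plane curve $D$ and an integer $m$, $mD$ denotes the curve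 counted with multiplicity $m$. *)

theory Defs
  imports
    "HOL-Complex_Analysis.Complex_Analysis"
    "HOL-Homology.Homology"
    "HOL-Algebra.Elementary_Groups"
    "HOL-Algebra.Group_Action"
    "HOL-Library.Extended_Nat"
begin

section \<open>Projective space\<close>

text \<open>
  All projective spaces live in one type, so that the dimension can be quantified: \<open>proj\<close> is the
  set of lines of the space of sequences \<open>nat \<Rightarrow> complex\<close>, and \<open>PS N\<close> is the \<open>N\<close>-dimensional
  projective space of the lines spanned by vectors supported on the coordinates \<open>0, ..., N\<close>.
  The topology is the quotient topology (the product topology on sequences induces the
  Euclidean one on vectors supported on \<open>0, ..., N\<close>, and the projection is open).
\<close>

definition nonzero_vec :: "(nat \<Rightarrow> complex) \<Rightarrow> bool" where
  "nonzero_vec v \<longleftrightarrow> (\<exists>i. v i \<noteq> 0)"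

definition proportional :: "(nat \<Rightarrow> complex) \<Rightarrow> (nat \<Rightarrow> complex) \<Rightarrow> bool" where
  "proportional v w \<longleftrightarrow> nonzero_vec v \<and> nonzero_vec w \<and> (\<exists>c. w = (\<lambda>i. c * v i))"

lemma part_equivp_proportional: "part_equivp proportional"
proof (rule part_equivpI)
  show "\<exists>v. proportional v v"
    by (rule exI[of _ "\<lambda>_. 1"]) (auto simp: proportional_def nonzero_vec_def intro!: exI[of _ 1])
  show "symp proportional"
  proof (rule sympI)
    fix v w assume "proportional v w"
    then obtain c where c: "nonzero_vec v" "nonzero_vec w" "w = (\<lambda>i. c * v i)"
      by (auto simp: proportional_def)
    then have "c \<noteq> 0" by (auto simp: nonzero_vec_def)
    then have "v = (\<lambda>i. inverse c * w i)" using c by (auto simp: field_simps)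
    then show "proportional w v" using c unfolding proportional_def by blast
  qed
  show "transp proportional"
  proof (rule transpI)
    fix u v w assume "proportional u v" "proportional v w"
    then obtain c d where "nonzero_vec u" "nonzero_vec w" "v = (\<lambda>i. c * u i)" "w = (\<lambda>i. d * v i)"
      by (auto simp: proportional_def)
    then have "nonzero_vec u \<and> nonzero_vec w \<and> w = (\<lambda>i. (d * c) * u i)"
      by (auto simp: mult.assoc)
    then show "proportional u w" unfolding proportional_def by blast
  qed
qed

quotient_type proj = "nat \<Rightarrow> complex" / partial: proportional
  by (rule part_equivp_proportional)

abbreviation pt :: "(nat \<Rightarrow> complex) \<Rightarrow> proj" where "pt \<equiv> abs_proj"

text \<open>A vector of homogeneous coordinates of a point.\<close>
abbreviation hcoord :: "proj \<Rightarrow> nat \<Rightarrow> complex" where "hcoord \<equiv> rep_proj"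

definition vec_of :: "complex list \<Rightarrow> nat \<Rightarrow> complex" where
  "vec_of xs = (\<lambda>i. if i < length xs then xs ! i else 0)"

instantiation proj :: topological_space
begin

definition open_proj :: "proj set \<Rightarrow> bool" where
  "open_proj U \<longleftrightarrow> open {v. nonzero_vec v \<and> pt v \<in> U}"

instance
proof
  have "{v. nonzero_vec v \<and> pt v \<in> UNIV} = (\<Union>i. (\<lambda>v. v i) -` (- {0}))"
    by (auto simp: nonzero_vec_def)
  moreover have "open (\<Union>i. (\<lambda>v::nat \<Rightarrow> complex. v i) -` (- {0}))"
    by (intro open_UN ballI open_vimage continuous_intros) auto
  ultimately show "open (UNIV :: proj set)" by (simp add: open_proj_def)
next
  fix U V :: "proj set" assume "open U" "open V"
  then have "open ({v. nonzero_vec v \<and> pt v \<in> U} \<inter> {v. nonzero_vec v \<and> pt v \<in> V})"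
    by (auto simp: open_proj_def)
  moreover have "{v. nonzero_vec v \<and> pt v \<in> U} \<inter> {v. nonzero_vec v \<and> pt v \<in> V}
      = {v. nonzero_vec v \<and> pt v \<in> U \<inter> V}" by auto
  ultimately show "open (U \<inter> V)" by (simp add: open_proj_def)
next
  fix K :: "proj set set" assume "\<forall>U\<in>K. open U"
  then have "open (\<Union>U\<in>K. {v. nonzero_vec v \<and> pt v \<in> U})"
    by (auto simp: open_proj_def)
  moreover have "(\<Union>U\<in>K. {v. nonzero_vec v \<and> pt v \<in> U}) = {v. nonzero_vec v \<and> pt v \<in> \<Union>K}"
    by auto
  ultimately show "open (\<Union>K)" by (simp add: open_proj_def)
qed

end

definition hvec :: "nat \<Rightarrow> (nat \<Rightarrow> complex) set" where
  "hvec N = {v. nonzero_vec v \<and> (\<forall>i>N. v i = 0)}"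

definition PS :: "nat \<Rightarrow> proj set" where
  "PS N = pt ` hvec N"


section \<open>Forms, curves, quasi-projective manifolds\<close>

type_synonym form = "(nat \<Rightarrow> complex) \<Rightarrow> complex"

text \<open>\<open>hpoly N d F\<close>: \<open>F\<close> is (the polynomial function of) a homogeneous polynomial of degree \<open>d\<close>
  in the coordinates \<open>0, ..., N\<close>; the zero form has every degree.\<close>
inductive hpoly :: "nat \<Rightarrow> nat \<Rightarrow> form \<Rightarrow> bool" for N where
  const: "hpoly N 0 (\<lambda>_. c)"
| mult_var: "hpoly N d F \<Longrightarrow> i \<le> N \<Longrightarrow> hpoly N (Suc d) (\<lambda>v. v i * F v)"
| add: "hpoly N d F \<Longrightarrow> hpoly N d G \<Longrightarrow> hpoly N d (\<lambda>v. F v + G v)"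

definition zeros :: "nat \<Rightarrow> form \<Rightarrow> proj set" where
  "zeros N F = pt ` {v \<in> hvec N. F v = 0}"

definition dirderiv :: "form \<Rightarrow> (nat \<Rightarrow> complex) \<Rightarrow> (nat \<Rightarrow> complex) \<Rightarrow> complex" where
  "dirderiv F v w = deriv (\<lambda>t. F (\<lambda>i. v i + t * w i)) 0"

definition smooth_at :: "nat \<Rightarrow> form \<Rightarrow> proj \<Rightarrow> bool" where
  "smooth_at N F p \<longleftrightarrow> p \<in> zeros N F \<and> (\<exists>w\<in>hvec N. dirderiv F (hcoord p) w \<noteq> 0)"

definition tangent_hyperplane :: "nat \<Rightarrow> form \<Rightarrow> proj \<Rightarrow> proj set" where
  "tangent_hyperplane N F p = pt ` {w \<in> hvec N. dirderiv F (hcoord p) w = 0}"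

definition plane_curve_eq :: "nat \<Rightarrow> form \<Rightarrow> bool" where
  "plane_curve_eq d F \<longleftrightarrow> hpoly 2 d F \<and> (\<exists>v. F v \<noteq> 0)"

text \<open>A pencil is given by the forms (up to scalars) of its members, which are divisors:
  the curve \<open>D1 + 2 D2\<close>, for example, is the divisor of \<open>F1 * F2^2\<close>.\<close>
definition pencil :: "nat \<Rightarrow> form set \<Rightarrow> bool" where
  "pencil d V \<longleftrightarrow> (\<exists>F G. hpoly 2 d F \<and> hpoly 2 d G \<and>
     (\<forall>a b. (\<forall>v. a * F v + b * G v = 0) \<longrightarrow> a = 0 \<and> b = 0) \<and>
     V = {\<lambda>v. a * F v + b * G v | a b. (a, b) \<noteq> (0, 0)})"

text \<open>\<open>(s, t)\<close> are analytic coordinates of the plane at \<open>p\<close> in which the curve has equation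
  \<open>s^2 + t^(k+1) = 0\<close>. The map \<open>\<Psi>\<close> is a lift of the chart to homogeneous coordinates; a
  unit factor in the local equation is absorbed into the choice of the lift.\<close>
definition A_singularity :: "nat \<Rightarrow> form \<Rightarrow> proj \<Rightarrow> bool" where
  "A_singularity k F p \<longleftrightarrow> (\<exists>U (\<Psi> :: complex \<times> complex \<Rightarrow> nat \<Rightarrow> complex) A B.
     open U \<and> (0, 0) \<in> U \<and>
     (\<forall>z\<in>U. \<Psi> z \<in> hvec 2) \<and>
     (\<forall>z\<in>U. \<forall>i. \<exists>a b. ((\<lambda>z. \<Psi> z i) has_derivative (\<lambda>(h, h'). a * h + b * h')) (at z)) \<and>
     (\<forall>i. ((\<lambda>z. \<Psi> z i) has_derivative (\<lambda>(h, h'). A i * h + B i * h')) (at (0, 0))) \<and>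
     (\<forall>\<alpha> \<beta> \<gamma>. (\<forall>i. \<alpha> * \<Psi> (0, 0) i + \<beta> * A i + \<gamma> * B i = 0) \<longrightarrow> \<alpha> = 0 \<and> \<beta> = 0 \<and> \<gamma> = 0) \<and>
     pt (\<Psi> (0, 0)) = p \<and>
     (\<forall>(s, t)\<in>U. F (\<Psi> (s, t)) = s ^ 2 + t ^ (k + 1)))"

definition zariski_closed :: "nat \<Rightarrow> proj set \<Rightarrow> bool" where
  "zariski_closed N Z \<longleftrightarrow> (\<exists>Fs. finite Fs \<and> (\<forall>F\<in>Fs. \<exists>d. hpoly N d F) \<and>
     Z = {p \<in> PS N. \<forall>F\<in>Fs. F (hcoord p) = 0})"

definition quasi_projective :: "nat \<Rightarrow> proj set \<Rightarrow> bool" where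
  "quasi_projective N X \<longleftrightarrow> (\<exists>Z W. zariski_closed N Z \<and> zariski_closed N W \<and> X = Z - W)"

text \<open>Smoothness, of pure dimension \<open>n\<close>, by the Jacobian criterion.\<close>
definition quasi_projective_manifold :: "nat \<Rightarrow> nat \<Rightarrow> proj set \<Rightarrow> bool" where
  "quasi_projective_manifold N n X \<longleftrightarrow> n \<le> N \<and> quasi_projective N X \<and>
     (\<forall>p\<in>X. \<exists>(F :: nat \<Rightarrow> form) Z.
        (\<forall>j < N - n. \<exists>d. hpoly N d (F j)) \<and>
        zariski_closed N Z \<and> p \<notin> Z \<and>
        X - Z = {q \<in> PS N. \<forall>j < N - n. F j (hcoord q) = 0} - Z \<and>
        (\<forall>a :: nat \<Rightarrow> complex.
           (\<forall>w\<in>hvec N. (\<Sum>j < N - n. a j * dirderiv (F j) (hcoord p) w) = 0)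
             \<longrightarrow> (\<forall>j < N - n. a j = 0)))"

definition regular_map :: "nat \<Rightarrow> nat \<Rightarrow> proj set \<Rightarrow> proj set \<Rightarrow> (proj \<Rightarrow> proj) \<Rightarrow> bool" where
  "regular_map N M X Y f \<longleftrightarrow> f ` X \<subseteq> Y \<and>
     (\<forall>p\<in>X. \<exists>d (F :: nat \<Rightarrow> form).
        (\<forall>i. hpoly N d (F i)) \<and> (\<forall>i>M. F i = (\<lambda>_. 0)) \<and>
        nonzero_vec (\<lambda>i. F i (hcoord p)) \<and>
        (\<forall>q\<in>X. nonzero_vec (\<lambda>i. F i (hcoord q)) \<longrightarrow> f q = pt (\<lambda>i. F i (hcoord q))))"


section \<open>Fundamental groups and characters\<close>

definition loops :: "'a::topological_space set \<Rightarrow> 'a \<Rightarrow> (real \<Rightarrow> 'a) set" where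
  "loops X b = {\<gamma>. path \<gamma> \<and> path_image \<gamma> \<subseteq> X \<and> pathstart \<gamma> = b \<and> pathfinish \<gamma> = b}"

definition path_class :: "'a::topological_space set \<Rightarrow> (real \<Rightarrow> 'a) \<Rightarrow> (real \<Rightarrow> 'a) set" where
  "path_class X \<gamma> = {\<delta>. homotopic_paths X \<gamma> \<delta>}"

definition pi1 :: "'a::topological_space set \<Rightarrow> 'a \<Rightarrow> (real \<Rightarrow> 'a) set monoid" where
  "pi1 X b = \<lparr>carrier = path_class X ` loops X b,
              monoid.mult = (\<lambda>A B. {\<delta>. \<exists>\<alpha>\<in>A. \<exists>\<beta>\<in>B. homotopic_paths X (\<alpha> +++ \<beta>) \<delta>}),
              one = path_class X (\<lambda>_. b)\<rparr>"

definition complex_units :: "complex monoid" where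
  "complex_units = \<lparr>carrier = - {0}, monoid.mult = (*), one = 1\<rparr>"

definition nontrivial_character :: "('g, 'm) monoid_scheme \<Rightarrow> ('g \<Rightarrow> complex) \<Rightarrow> bool" where
  "nontrivial_character G chi \<longleftrightarrow> chi \<in> hom G complex_units \<and> (\<exists>g\<in>carrier G. chi g \<noteq> 1)"


section \<open>Meridians\<close>

text \<open>An embedded closed holomorphic disk in \<open>PS N\<close> meeting \<open>D\<close> exactly at its centre;
  \<open>\<Delta>\<close> is a lift to homogeneous coordinates of the embedding of the unit disk.\<close>
definition disk_at :: "nat \<Rightarrow> proj set \<Rightarrow> (complex \<Rightarrow> nat \<Rightarrow> complex) \<Rightarrow> bool" where
  "disk_at N D \<Delta> \<longleftrightarrow> (\<exists>U. open U \<and> cball 0 1 \<subseteq> U \<and>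
      (\<forall>i. (\<lambda>w. \<Delta> w i) holomorphic_on U) \<and> (\<forall>w\<in>U. \<Delta> w \<in> hvec N)) \<and>
    inj_on (\<lambda>w. pt (\<Delta> w)) (cball 0 1) \<and>
    (\<forall>w\<in>cball 0 1. pt (\<Delta> w) \<in> D \<longleftrightarrow> w = 0)"

text \<open>The loops based at \<open>b\<close> that go to the boundary of the disk in the complement of \<open>D\<close>, run
  once along it counterclockwise and come back the same way.\<close>
definition disk_loops :: "nat \<Rightarrow> proj set \<Rightarrow> proj \<Rightarrow> (complex \<Rightarrow> nat \<Rightarrow> complex) \<Rightarrow> (real \<Rightarrow> proj) set" where
  "disk_loops N D b \<Delta> =
     {\<delta> +++ ((\<lambda>t. pt (\<Delta> (cis (2 * pi * t)))) +++ reversepath \<delta>) | \<delta>.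
        path \<delta> \<and> path_image \<delta> \<subseteq> PS N - D \<and> pathstart \<delta> = b \<and> pathfinish \<delta> = pt (\<Delta> 1)}"

text \<open>Meridians of the curve \<open>F = 0\<close> in the complement of the plane curve with reduced equation
  \<open>T\<close>, of which it is a part. That \<open>T\<close> has a simple zero along the disk says that its centre is
  a smooth point of \<open>T = 0\<close> and that the disk is transversal to the curve there.\<close>
definition curve_meridians :: "form \<Rightarrow> form \<Rightarrow> proj \<Rightarrow> (real \<Rightarrow> proj) set" where
  "curve_meridians T F b = \<Union> (disk_loops 2 (zeros 2 T) b `
     {\<Delta>. disk_at 2 (zeros 2 T) \<Delta> \<and> pt (\<Delta> 0) \<in> zeros 2 F \<and> deriv (\<lambda>w. T (\<Delta> w)) 0 \<noteq> 0})"

text \<open>Meridians of the point \<open>p\<close> of the finite subset \<open>D\<close> of the projective line.\<close>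
definition point_meridians :: "proj set \<Rightarrow> proj \<Rightarrow> proj \<Rightarrow> (real \<Rightarrow> proj) set" where
  "point_meridians D p b = \<Union> (disk_loops 1 D b ` {\<Delta>. disk_at 1 D \<Delta> \<and> pt (\<Delta> 0) = p})"


section \<open>Rational orbicurves\<close>

text \<open>An orbicurve on the projective line is given by its labels: \<open>1\<close> at ordinary points,
  \<open>\<infinity>\<close> at the points that are removed.\<close>
type_synonym labels = "proj \<Rightarrow> enat"

definition underlying_curve :: "labels \<Rightarrow> proj set" where
  "underlying_curve \<nu> = {p \<in> PS 1. \<nu> p \<noteq> \<infinity>}"

definition regular_part :: "labels \<Rightarrow> proj set" where
  "regular_part \<nu> = {p \<in> PS 1. \<nu> p = 1}"

definition normal_closure :: "('g, 'm) monoid_scheme \<Rightarrow> 'g set \<Rightarrow> 'g set" where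
  "normal_closure G S = \<Inter> {H. H \<lhd> G \<and> S \<subseteq> H}"

definition orb_relations :: "labels \<Rightarrow> proj \<Rightarrow> (real \<Rightarrow> proj) set set" where
  "orb_relations \<nu> b = normal_closure (pi1 (regular_part \<nu>) b)
     {path_class (regular_part \<nu>) \<mu> [^]\<^bsub>pi1 (regular_part \<nu>) b\<^esub> m | \<mu> m p.
        p \<in> PS 1 \<and> \<nu> p = enat m \<and> m > 1 \<and> \<mu> \<in> point_meridians (PS 1 - regular_part \<nu>) p b}"

definition orb_pi1 :: "labels \<Rightarrow> proj \<Rightarrow> (real \<Rightarrow> proj) set set monoid" where
  "orb_pi1 \<nu> b = pi1 (regular_part \<nu>) b Mod orb_relations \<nu> b"

definition orb_class :: "labels \<Rightarrow> proj \<Rightarrow> (real \<Rightarrow> proj) \<Rightarrow> (real \<Rightarrow> proj) set set" where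
  "orb_class \<nu> b \<gamma> = orb_relations \<nu> b #>\<^bsub>pi1 (regular_part \<nu>) b\<^esub> path_class (regular_part \<nu>) \<gamma>"


section \<open>Depth and markings\<close>

text \<open>Dimension of the quotient of a space \<open>V\<close> of complex functions by a subspace \<open>W\<close>.\<close>
definition quotient_dim :: "('a \<Rightarrow> complex) set \<Rightarrow> ('a \<Rightarrow> complex) set \<Rightarrow> enat" where
  "quotient_dim V W = (SUP B \<in> {B. finite B \<and> B \<subseteq> V \<and>
      (\<forall>a. (\<lambda>x. \<Sum>f\<in>B. a f * f x) \<in> W \<longrightarrow> (\<forall>f\<in>B. a f = 0))}. enat (card B))"

text \<open>First group cohomology with coefficients in \<open>complex\<close>, on which \<open>G\<close> acts by \<open>rho\<close>:
  crossed homomorphisms modulo principal ones.\<close>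
definition group_depth :: "('g, 'm) monoid_scheme \<Rightarrow> ('g \<Rightarrow> complex) \<Rightarrow> enat" where
  "group_depth G rho = quotient_dim
     {c. (\<forall>g. g \<notin> carrier G \<longrightarrow> c g = 0) \<and>
         (\<forall>g\<in>carrier G. \<forall>h\<in>carrier G. c (g \<otimes>\<^bsub>G\<^esub> h) = c g + rho g * c h)}
     {c. \<exists>a. \<forall>g. c g = (if g \<in> carrier G then rho g * a - a else 0)}"

text \<open>A rank one local system on \<open>X\<close>, all of whose stalks are identified with \<open>complex\<close>, is given
  by the transport \<open>L \<sigma>\<close> along every singular 1-simplex \<open>\<sigma>\<close>, from the stalk at its end to the
  stalk at its origin. The faces \<open>2\<close>, \<open>0\<close>, \<open>1\<close> of a 2-simplex are its edges \<open>01\<close>, \<open>12\<close>, \<open>02\<close>.\<close>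
definition local_system :: "'a topology \<Rightarrow> (((nat \<Rightarrow> real) \<Rightarrow> 'a) \<Rightarrow> complex) \<Rightarrow> bool" where
  "local_system X L \<longleftrightarrow> (\<forall>\<sigma>. singular_simplex 1 X \<sigma> \<longrightarrow> L \<sigma> \<noteq> 0) \<and>
     (\<forall>\<tau>. singular_simplex 2 X \<tau> \<longrightarrow>
        L (singular_face 2 2 \<tau>) * L (singular_face 2 0 \<tau>) = L (singular_face 2 1 \<tau>))"

definition path_simplex :: "(real \<Rightarrow> 'a) \<Rightarrow> (nat \<Rightarrow> real) \<Rightarrow> 'a" where
  "path_simplex \<gamma> = restrict (\<lambda>x. \<gamma> (x 1)) (standard_simplex 1)"

definition vertex :: "nat \<Rightarrow> nat \<Rightarrow> real" where
  "vertex k = (\<lambda>i. if i = k then 1 else 0)"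

text \<open>First singular cohomology with coefficients in the local system \<open>L\<close>; the value of a
  cochain at a simplex lies in the stalk at its vertex \<open>0\<close>.\<close>
definition twisted_cocycles ::
    "'a topology \<Rightarrow> (((nat \<Rightarrow> real) \<Rightarrow> 'a) \<Rightarrow> complex) \<Rightarrow> (((nat \<Rightarrow> real) \<Rightarrow> 'a) \<Rightarrow> complex) set" where
  "twisted_cocycles X L = {c. (\<forall>\<sigma>. \<not> singular_simplex 1 X \<sigma> \<longrightarrow> c \<sigma> = 0) \<and>
     (\<forall>\<tau>. singular_simplex 2 X \<tau> \<longrightarrow>
        L (singular_face 2 2 \<tau>) * c (singular_face 2 0 \<tau>)
          - c (singular_face 2 1 \<tau>) + c (singular_face 2 2 \<tau>) = 0)}"

definition twisted_coboundaries ::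
    "'a topology \<Rightarrow> (((nat \<Rightarrow> real) \<Rightarrow> 'a) \<Rightarrow> complex) \<Rightarrow> (((nat \<Rightarrow> real) \<Rightarrow> 'a) \<Rightarrow> complex) set" where
  "twisted_coboundaries X L = {c. \<exists>u :: 'a \<Rightarrow> complex. \<forall>\<sigma>.
     c \<sigma> = (if singular_simplex 1 X \<sigma> then L \<sigma> * u (\<sigma> (vertex 1)) - u (\<sigma> (vertex 0)) else 0)}"

text \<open>On a path connected space the local system with monodromy \<open>chi\<close> is unique up to
  isomorphism, so the choice is immaterial.\<close>
definition depth :: "'a::topological_space set \<Rightarrow> 'a \<Rightarrow> ((real \<Rightarrow> 'a) set \<Rightarrow> complex) \<Rightarrow> enat" where
  "depth X b chi =
     (let L = (SOME L. local_system (top_of_set X) L \<and>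
                (\<forall>\<gamma>\<in>loops X b. L (path_simplex \<gamma>) = chi (path_class X \<gamma>)))
      in quotient_dim (twisted_cocycles (top_of_set X) L) (twisted_coboundaries (top_of_set X) L))"

definition marking :: "proj set \<Rightarrow> proj \<Rightarrow> ((real \<Rightarrow> proj) set \<Rightarrow> complex) \<Rightarrow> bool" where
  "marking X b chi \<longleftrightarrow> nontrivial_character (pi1 X b) chi \<and> depth X b chi > 0"

definition orb_marking :: "labels \<Rightarrow> proj \<Rightarrow> ((real \<Rightarrow> proj) set set \<Rightarrow> complex) \<Rightarrow> bool" where
  "orb_marking \<nu> b rho \<longleftrightarrow> nontrivial_character (orb_pi1 \<nu> b) rho \<and> group_depth (orb_pi1 \<nu> b) rho > 0"

text \<open>\<open>chi = \<phi>\<^sup>*(rho)\<close>. The homomorphism induced by an orbifold map is determined by sending the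
  class of a loop that avoids the preimages of the orbifold points, as every loop does up to
  homotopy, to the class of its image.\<close>
definition is_pullback :: "proj set \<Rightarrow> labels \<Rightarrow> (proj \<Rightarrow> proj) \<Rightarrow> proj \<Rightarrow>
    ((real \<Rightarrow> proj) set \<Rightarrow> complex) \<Rightarrow> ((real \<Rightarrow> proj) set set \<Rightarrow> complex) \<Rightarrow> bool" where
  "is_pullback X \<nu> \<phi> b chi rho \<longleftrightarrow>
     (\<forall>\<gamma>\<in>loops {p \<in> X. \<phi> p \<in> regular_part \<nu>} b.
        chi (path_class X \<gamma>) = rho (orb_class \<nu> (\<phi> b) (\<phi> \<circ> \<gamma>)))"


section \<open>Global quotient orbifold pencils\<close>

text \<open>The orbifold on \<open>Y\<close> with labels \<open>\<nu>\<close> is the quotient of \<open>E\<close> by the finite group \<open>G\<close>. For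
  smooth \<open>Y\<close>, a surjective morphism whose fibres are the orbits is the quotient morphism; the
  labels are the orders of the stabilizers. With all labels \<open>1\<close>, \<open>Y\<close> has no orbifold structure.\<close>
definition orbifold_quotient :: "nat \<Rightarrow> proj set \<Rightarrow> ('g, 'm) monoid_scheme \<Rightarrow> ('g \<Rightarrow> proj \<Rightarrow> proj) \<Rightarrow>
    nat \<Rightarrow> proj set \<Rightarrow> labels \<Rightarrow> (proj \<Rightarrow> proj) \<Rightarrow> bool" where
  "orbifold_quotient N E G act M Y \<nu> \<pi> \<longleftrightarrow>
     finite (carrier G) \<and> group_action G E act \<and>
     (\<forall>g\<in>carrier G. regular_map N N E E (act g)) \<and>
     regular_map N M E Y \<pi> \<and> \<pi> ` E = Y \<and>
     (\<forall>p\<in>E. \<forall>q\<in>E. \<pi> p = \<pi> q \<longleftrightarrow> q \<in> orbit G act p) \<and>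
     (\<forall>p\<in>E. \<nu> (\<pi> p) = enat (card (stabilizer G act p)))"

text \<open>Here \<open>X\<close> is a manifold in \<open>PS M\<close>, and the target is the orbicurve with labels \<open>\<nu>\<close>, the
  quotient by \<open>G\<close> of the curve \<open>C\<close> in \<open>PS K\<close> under \<open>\<kappa>\<close>.\<close>
definition global_quotient_orbifold_pencil :: "('g, 'm) monoid_scheme \<Rightarrow>
    nat \<Rightarrow> proj set \<Rightarrow> ('g \<Rightarrow> proj \<Rightarrow> proj) \<Rightarrow> (proj \<Rightarrow> proj) \<Rightarrow> labels \<Rightarrow>
    nat \<Rightarrow> proj set \<Rightarrow> (proj \<Rightarrow> proj) \<Rightarrow> bool" where
  "global_quotient_orbifold_pencil G K C actC \<kappa> \<nu> M X \<phi> \<longleftrightarrow>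
     quasi_projective_manifold K 1 C \<and>
     orbifold_quotient K C G actC 1 (underlying_curve \<nu>) \<nu> \<kappa> \<and>
     regular_map M 1 X (underlying_curve \<nu>) \<phi> \<and>
     (\<exists>N n XG act \<pi> \<Phi>.
        quasi_projective_manifold M n X \<and>
        quasi_projective_manifold N n XG \<and>
        orbifold_quotient N XG G act M X (\<lambda>_. 1) \<pi> \<and>
        regular_map N K XG C \<Phi> \<and>
        (\<forall>p\<in>XG. \<phi> (\<pi> p) = \<kappa> (\<Phi> p)))"

text \<open>\<open>(X, chi) \<rightarrow> (\<nu>, rho)\<close> with base points \<open>b\<close> and \<open>\<phi> b\<close>.\<close>
definition marked_pencil :: "proj set \<Rightarrow> labels \<Rightarrow> (proj \<Rightarrow> proj) \<Rightarrow> proj \<Rightarrow>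
    ((real \<Rightarrow> proj) set \<Rightarrow> complex) \<Rightarrow> ((real \<Rightarrow> proj) set set \<Rightarrow> complex) \<Rightarrow> bool" where
  "marked_pencil X \<nu> \<phi> b chi rho \<longleftrightarrow>
     marking X b chi \<and> orb_marking \<nu> (\<phi> b) rho \<and> is_pullback X \<nu> \<phi> b chi rho"


section \<open>The curves and the orbicurve at hand\<close>

definition f2 :: form where
  "f2 v = (let x = v 0; y = v 1; z = v 2 in (y + x / 3) * z - y ^ 2 / 6)"

definition f4 :: form where
  "f4 v = (let x = v 0; y = v 1; z = v 2 in
     x ^ 2 * z ^ 2 - (x * y ^ 2 + 9 * x ^ 2 * y / 2 + 3 * x ^ 3 / 2) * z
       + y ^ 4 / 4 + 3 * x ^ 2 * y ^ 2 / 4)"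

definition C2 :: "proj set" where "C2 = zeros 2 f2"

definition C4 :: "proj set" where "C4 = zeros 2 f4"

definition C6 :: "proj set" where "C6 = C2 \<union> C4"

definition f6 :: form where "f6 v = f2 v * f4 v"

definition orb_labels :: labels where
  "orb_labels p =
     (if p = pt (vec_of [0, 1]) \<or> p = pt (vec_of [1, 0]) then 2
      else if p = pt (vec_of [1, 1]) then \<infinity> else 1)"

definition cover_curve :: "proj set" where
  "cover_curve = PS 1 - {pt (vec_of [1, 1]), pt (vec_of [1, - 1])}"

text \<open>The group of order two is \<open>integer_mod_group 2\<close>, with elements \<open>0\<close> and \<open>1\<close>.\<close>
definition cover_action :: "int \<Rightarrow> proj \<Rightarrow> proj" where
  "cover_action g = restrict
     (\<lambda>p. if g = 0 then p else pt (vec_of [- hcoord p 0, hcoord p 1])) cover_curve"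

definition cover_map :: "proj \<Rightarrow> proj" where
  "cover_map p = pt (vec_of [(hcoord p 0) ^ 2, (hcoord p 1) ^ 2])"

definition pencil_map :: "form \<Rightarrow> form \<Rightarrow> proj \<Rightarrow> proj" where
  "pencil_map l q p = pt (vec_of [f2 (hcoord p) * l (hcoord p) ^ 2, q (hcoord p) ^ 2])"

end

(* Write q = contact_conic = x z - y^2/2 and l = tangent_form = (3/sqrt 2) x. Then f4 = q^2 - f2 l^2, which is the
   pencil, and [f2 l^2 : q^2] = [1:1] exactly on f4 = 0. The double plane w^2 = f2 is unramified over the
   complement of the sextic, and [w l : q] lifts the pencil to the covering curve.

   Both characters are the monodromy of the covering {F = 1} -> {F \<noteq> 0}, v \<mapsto> [v], of degree 2,
   where F is a quadratic form: F = f2 on the plane, F = u v on the line. Their depths are positive because of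
   the variation of ln h along lifted paths, h = (l - q)/(l + q) and h = (u - 1)/(u + 1) respectively: the deck
   transformation inverts h, so the variation is a twisted cocycle, and it is not a coboundary, since it is
   non-zero on a loop with trivial monodromy. *)
theory Submission
  imports Defs
begin


section \<open>Points, lifts and forms\<close>

text \<open>Where f2 = 1 the quartic factors as f4 = (q - l)(q + l): over the double plane it splits
  into two curves exchanged by the deck transformation, and h is, up to sign, the quotient of their
  equations. Over the line, on u v = 1, the removed point [1:1] splits likewise into u = 1 and u =
  -1. The lifted pencil is u = l/q, which turns (u - 1)/(u + 1) into the h of the plane. For a
  crossed homomorphism c and a meridian mu with character -1 one has c(mu mu) = c(mu) - c(mu) = 0.
  So the variation, which lives on the thrice punctured line, survives the relations mu^2 = 1 and
  descends to the orbifold group. On the plane, \<open>depth\<close> refers to an unspecified local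
  system with the given monodromy; the cocycle is carried over to it by an isomorphism of local
  systems. The conic is dictated by the singularity: at S = [0:0:1], with z = 1, one has x = q +
  y^2/2 and f2 = y + x/3 - y^2/6, so that f4 = q^2 - (9/2) x^2 f2 is q^2 - (9/8) y^5 to leading
  order in the coordinates q, y. At [1:0:0], the other common point of the two curves, f4 has a
  linear term; this tells S from R.\<close>

lemma pt_eq_iff: "nonzero_vec v \<Longrightarrow> nonzero_vec w \<Longrightarrow> pt v = pt w \<longleftrightarrow> (\<exists>c. w = (\<lambda>i. c * v i))"
proof -
  assume nz: "nonzero_vec v" "nonzero_vec w"
  have r: "proportional u u" if "nonzero_vec u" for u
    using that by (auto simp: proportional_def intro!: exI[of _ 1])
  have "pt v = pt w \<longleftrightarrow> proportional v w"
    using Quotient3_rel[OF Quotient3_proj, of v w] r nz by auto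
  then show ?thesis using nz by (auto simp: proportional_def)
qed

lemma proportional_hcoord: "proportional (hcoord p) (hcoord p)"
  using Quotient3_rep_reflp[OF Quotient3_proj] by blast

lemma nonzero_hcoord [simp]: "nonzero_vec (hcoord p)"
  using proportional_hcoord[of p] by (simp add: proportional_def)

lemma pt_hcoord [simp]: "pt (hcoord p) = p"
  using Quotient3_abs_rep[OF Quotient3_proj] by blast

text \<open>\<open>hcoord\<close> is an unspecified section of \<open>pt\<close>. Forms on points
  are evaluated through it, so each such value has to be compared, up to this factor, with the value
  at a vector in hand.\<close>

lemma hcoord_ptE:
  assumes "nonzero_vec v"
  obtains c where "c \<noteq> 0" "hcoord (pt v) = (\<lambda>i. c * v i)"
proof -
  obtain c where c: "hcoord (pt v) = (\<lambda>i. c * v i)"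
    using pt_eq_iff[OF assms nonzero_hcoord, of "pt v"] by auto
  moreover have "c \<noteq> 0" using nonzero_hcoord[of "pt v"] unfolding c by (auto simp: nonzero_vec_def)
  ultimately show ?thesis using that by blast
qed

lemma hvec_nonzero: "v \<in> hvec N \<Longrightarrow> nonzero_vec v"
  by (simp add: hvec_def)

lemma hvec_scale: "v \<in> hvec N \<Longrightarrow> c \<noteq> 0 \<Longrightarrow> (\<lambda>i. c * v i) \<in> hvec N"
  by (auto simp: hvec_def nonzero_vec_def)

lemma pt_scale:
  assumes "nonzero_vec v" "c \<noteq> 0" shows "pt (\<lambda>i. c * v i) = pt v"
proof -
  have "nonzero_vec (\<lambda>i. c * v i)" using assms by (auto simp: nonzero_vec_def)
  then show ?thesis using pt_eq_iff[of v "\<lambda>i. c * v i"] assms by metis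
qed

lemma pt_in_PS: "v \<in> hvec N \<Longrightarrow> pt v \<in> PS N"
  by (simp add: PS_def)

lemma hcoord_in_hvec: assumes "p \<in> PS N" shows "hcoord p \<in> hvec N"
proof -
  obtain v where v: "v \<in> hvec N" "p = pt v" using assms by (auto simp: PS_def)
  then obtain c where "c \<noteq> 0" "hcoord p = (\<lambda>i. c * v i)" using hcoord_ptE hvec_nonzero by metis
  then show ?thesis using v hvec_scale by metis
qed

section \<open>Homogeneous polynomials and their zero sets\<close>

lemma hpoly_scale: "hpoly N d F \<Longrightarrow> F (\<lambda>i. c * v i) = c ^ d * F v"
  by (induction rule: hpoly.induct) (auto simp: algebra_simps)

lemma hpoly_continuous: "hpoly N d F \<Longrightarrow> continuous_on A F"
proof (induction rule: hpoly.induct)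
  case (mult_var d F i)
  have "continuous_on A (\<lambda>v::nat \<Rightarrow> complex. v i)" by (rule continuous_on_subset[OF continuous_on_product_coordinates]) simp
  then show ?case using mult_var by (intro continuous_intros) auto
qed (auto intro!: continuous_intros)

lemma hpoly_holomorphic:
  "hpoly N d F \<Longrightarrow> (\<And>i. (\<lambda>w. \<Delta> w i) holomorphic_on U) \<Longrightarrow> (\<lambda>w. F (\<Delta> w)) holomorphic_on U"
  by (induction rule: hpoly.induct) (auto intro!: holomorphic_intros)

lemma hpoly_zero: "hpoly N d (\<lambda>_. 0)"
proof (induction d)
  case 0 show ?case using hpoly.const[of N 0] by simp
next
  case (Suc d) then show ?case using hpoly.mult_var[of N d _ 0] by fastforce
qed

lemma hpoly_cmult: "hpoly N d F \<Longrightarrow> hpoly N d (\<lambda>v. c * F v)"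
proof (induction rule: hpoly.induct)
  case (const k) then show ?case using hpoly.const[of N "c * k"] by simp
next
  case (mult_var d F i)
  then show ?case using hpoly.mult_var[of N d "\<lambda>v. c * F v" i] by (simp add: mult.left_commute)
next
  case (add d F G) then show ?case using hpoly.add by (fastforce simp: distrib_left)
qed

lemma hpoly_mult: "hpoly N d F \<Longrightarrow> hpoly N e G \<Longrightarrow> hpoly N (d + e) (\<lambda>v. F v * G v)"
proof (induction rule: hpoly.induct)
  case (const k) then show ?case using hpoly_cmult by simp
next
  case (mult_var d F i)
  then show ?case using hpoly.mult_var[of N "d+e" "\<lambda>v. F v * G v" i] by (simp add: mult.assoc)
next
  case (add d F H) then show ?case using hpoly.add by (fastforce simp: distrib_right)
qed

lemma hpoly_var: "i \<le> N \<Longrightarrow> hpoly N 1 (\<lambda>v. v i)"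
  using hpoly.mult_var[OF hpoly.const[of N 1], of i] by simp

lemma hpoly_diff: "hpoly N d F \<Longrightarrow> hpoly N d G \<Longrightarrow> hpoly N d (\<lambda>v. F v - G v)"
  using hpoly.add[OF _ hpoly_cmult[of N d G "-1"]] by fastforce

lemma hpoly_power: "hpoly N d F \<Longrightarrow> e = k * d \<Longrightarrow> hpoly N e (\<lambda>v. F v ^ k)"
proof (induction k arbitrary: e)
  case 0 then show ?case using hpoly.const[of N 1] by simp
next
  case (Suc k) then show ?case using hpoly_mult[of N d F "k*d" "\<lambda>v. F v ^ k"] by auto
qed

lemma hpoly_mono: "hpoly N d F \<Longrightarrow> N \<le> M \<Longrightarrow> hpoly M d F"
  by (induction rule: hpoly.induct) (auto intro: hpoly.intros)

lemma hpoly_hcoord_zero_iff: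
  assumes "hpoly N d F" "nonzero_vec v" shows "F (hcoord (pt v)) = 0 \<longleftrightarrow> F v = 0"
proof -
  obtain c where c: "c \<noteq> 0" "hcoord (pt v) = (\<lambda>i. c * v i)" using hcoord_ptE assms by metis
  show ?thesis unfolding c(2) using hpoly_scale[OF assms(1), of c v] c(1) by simp
qed

lemma zeros_eq: assumes F: "hpoly N d F" shows "zeros N F = {p \<in> PS N. F (hcoord p) = 0}"
proof (intro Set.set_eqI iffI)
  fix p assume "p \<in> zeros N F"
  then obtain v where "v \<in> hvec N" "F v = 0" "p = pt v" by (auto simp: zeros_def)
  then show "p \<in> {p \<in> PS N. F (hcoord p) = 0}"
    using hpoly_hcoord_zero_iff[OF F] hvec_nonzero pt_in_PS by auto
next
  fix p assume "p \<in> {p \<in> PS N. F (hcoord p) = 0}"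
  then have "hcoord p \<in> {v \<in> hvec N. F v = 0}" using hcoord_in_hvec by auto
  then show "p \<in> zeros N F" unfolding zeros_def using pt_hcoord by (metis imageI)
qed

lemma pt_in_zeros: "hpoly N d F \<Longrightarrow> v \<in> hvec N \<Longrightarrow> pt v \<in> zeros N F \<longleftrightarrow> F v = 0"
  using zeros_eq hpoly_hcoord_zero_iff hvec_nonzero pt_in_PS by auto

section \<open>The topology of projective space\<close>

lemma open_nonzero: "open {v. nonzero_vec v}"
  using open_UNIV[where 'a=proj] unfolding open_proj_def by simp

lemma continuous_on_pt: "continuous_on {v. nonzero_vec v} pt"
  unfolding continuous_on_open_vimage[OF open_nonzero]
  by (auto simp: open_proj_def vimage_def Int_def conj_commute)

lemma continuous_on_pt_compose:
  assumes "continuous_on D g" "\<And>x. x \<in> D \<Longrightarrow> nonzero_vec (g x)"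
  shows "continuous_on D (\<lambda>x. pt (g x))"
  using continuous_on_compose2[OF continuous_on_pt assms(1)] assms(2) by auto

text \<open>Projective space has the quotient topology.\<close>
lemma continuous_on_descend:
  fixes g :: "(nat \<Rightarrow> complex) \<Rightarrow> 'b::topological_space"
  assumes W: "open W" "\<And>v. v \<in> W \<Longrightarrow> nonzero_vec v"
    and sat: "\<And>v c. v \<in> W \<Longrightarrow> c \<noteq> 0 \<Longrightarrow> (\<lambda>i. c * v i) \<in> W \<and> g (\<lambda>i. c * v i) = g v"
    and g: "continuous_on W g"
  shows "continuous_on {p. hcoord p \<in> W} (\<lambda>p. g (hcoord p))"
proof -
  have inv: "hcoord (pt v) \<in> W \<longleftrightarrow> v \<in> W" if nzv: "nonzero_vec v" for v
  proof -
    obtain c where c: "c \<noteq> 0" "hcoord (pt v) = (\<lambda>i. c * v i)" by (rule hcoord_ptE[OF nzv])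
    have eq: "(\<lambda>i. inverse c * (c * v i)) = v" using c(1) by (auto simp: field_simps)
    show ?thesis
      unfolding c(2) using sat[of v c] sat[of "\<lambda>i. c * v i" "inverse c"] c(1) nonzero_imp_inverse_nonzero[OF c(1)] unfolding eq by blast
  qed
  have ginv: "g (hcoord (pt v)) = g v" if vW: "v \<in> W" for v
  proof -
    obtain c where c: "c \<noteq> 0" "hcoord (pt v) = (\<lambda>i. c * v i)" by (rule hcoord_ptE[OF W(2)[OF vW]])
    show ?thesis unfolding c(2) using sat[OF vW c(1)] by blast
  qed
  have key: "{v. nonzero_vec v \<and> hcoord (pt v) \<in> W \<and> g (hcoord (pt v)) \<in> B} = g -` B \<inter> W" for B
  proof (intro Set.set_eqI iffI)
    fix v assume "v \<in> {v. nonzero_vec v \<and> hcoord (pt v) \<in> W \<and> g (hcoord (pt v)) \<in> B}"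
    then show "v \<in> g -` B \<inter> W" using inv[of v] ginv[of v] by simp
  next
    fix v assume "v \<in> g -` B \<inter> W"
    then show "v \<in> {v. nonzero_vec v \<and> hcoord (pt v) \<in> W \<and> g (hcoord (pt v)) \<in> B}"
      using inv[of v] ginv[of v] W(2)[of v] by simp
  qed
  have op: "open {p. hcoord p \<in> W}"
    using key[of UNIV] W(1) by (simp add: open_proj_def)
  show ?thesis
    unfolding continuous_on_open_vimage[OF op]
  proof (intro allI impI)
    fix B :: "'b set" assume "open B"
    then have "open (g -` B \<inter> W)" using g continuous_on_open_vimage[OF W(1)] by blast
    then show "open ((\<lambda>p. g (hcoord p)) -` B \<inter> {p. hcoord p \<in> W})"
      using key[of B] by (simp add: open_proj_def vimage_def Int_def conj_commute)
  qed
qed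

text \<open>The complex affine line \<open>e\<close> through representatives of the two points meets
  F = 0 for countably many parameters only, and the complex plane minus a countable set is path
  connected. As d > 0, F vanishes at the zero vector, so parameters with F non-zero also give
  non-zero vectors.\<close>

lemma path_connected_complement_zeros:
  assumes F: "hpoly N d F" and "d > 0"
  shows "path_connected (PS N - zeros N F)"
  unfolding path_connected_def
proof (intro ballI)
  fix p q assume pq: "p \<in> PS N - zeros N F" "q \<in> PS N - zeros N F"
  define v w where "v = hcoord p" and "w = hcoord q"
  have vw: "v \<in> hvec N" "w \<in> hvec N" "F v \<noteq> 0" "F w \<noteq> 0" "pt v = p" "pt w = q"
    using pq zeros_eq[OF F] hcoord_in_hvec by (auto simp: v_def w_def)
  show "\<exists>g. path g \<and> path_image g \<subseteq> PS N - zeros N F \<and> pathstart g = p \<and> pathfinish g = q"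
  proof -
    define e where "e = (\<lambda>t::complex. \<lambda>i. (1 - t) * v i + t * w i)"
    define Z where "Z = {t. F (e t) = 0}"
    have hol: "(\<lambda>t. F (e t)) holomorphic_on UNIV"
      by (rule hpoly_holomorphic[OF F]) (auto simp: e_def intro!: holomorphic_intros)
    have e01: "e 0 = v" "e 1 = w" by (auto simp: e_def)
    have cZ: "countable Z"
    proof -
      have "countable {z \<in> UNIV. F (e z) = 0}"
      proof (cases "(\<lambda>t. F (e t)) constant_on UNIV")
        case True
        then have "F (e z) \<noteq> 0" for z using vw e01 by (metis UNIV_I constant_on_def)
        then show ?thesis by simp
      next
        case False
        then show ?thesis
          using holomorphic_countable_zeros[OF hol open_UNIV connected_UNIV fsigma_UNIV] by blast
      qed
      then show ?thesis by (simp add: Z_def)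
    qed
    have "path_connected (- Z)" by (rule path_connected_complement_countable) (use cZ in auto)
    moreover have "0 \<in> -Z" "1 \<in> -Z" using e01 vw by (auto simp: Z_def)
    ultimately obtain g where g: "path g" "path_image g \<subseteq> - Z" "pathstart g = 0" "pathfinish g = 1"
      unfolding path_connected_def by blast
    have nzF: "F (e t) \<noteq> 0" if "t \<in> path_image g" for t using g that by (auto simp: Z_def)
    have nz: "e t \<in> hvec N" if "t \<in> path_image g" for t
    proof -
      have "nonzero_vec (e t)"
      proof (rule ccontr)
        assume "\<not> nonzero_vec (e t)"
        then have et: "e t = (\<lambda>_. 0)" by (auto simp: nonzero_vec_def)
        have "F (\<lambda>i. 0 * v i) = 0" using hpoly_scale[OF assms(1), of 0 v] assms(2) by simp
        then show False using nzF[OF that] et by simp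
      qed
      then show ?thesis using vw by (auto simp: hvec_def e_def)
    qed
    have ce: "continuous_on UNIV e" unfolding e_def
      by (intro continuous_on_coordinatewise_then_product continuous_intros)
    have "path (\<lambda>t. pt (e (g t)))"
      unfolding path_def
    proof (rule continuous_on_pt_compose)
      show "continuous_on {0..1} (\<lambda>t. e (g t))"
        using g by (intro continuous_on_compose2[OF ce]) (auto simp: path_def)
      show "nonzero_vec (e (g t))" if "t \<in> {0..1}" for t
        using nz[of "g t"] that by (auto simp: path_image_def hvec_nonzero)
    qed
    moreover have "pt (e t) \<in> PS N - zeros N F" if "t \<in> path_image g" for t
      using nz[OF that] nzF[OF that] pt_in_PS pt_in_zeros[OF F] by auto
    ultimately show ?thesis
      using g e01 vw by (intro exI[of _ "\<lambda>t. pt (e (g t))"])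
        (auto simp: path_image_def pathstart_def pathfinish_def)
  qed
qed


section \<open>The fundamental group\<close>

lemma loopsD:
  assumes "\<gamma> \<in> loops X b"
  shows "path \<gamma>" "path_image \<gamma> \<subseteq> X" "pathstart \<gamma> = b" "pathfinish \<gamma> = b"
  using assms by (auto simp: loops_def)

lemma loops_join: "\<gamma> \<in> loops X b \<Longrightarrow> \<delta> \<in> loops X b \<Longrightarrow> \<gamma> +++ \<delta> \<in> loops X b"
  by (auto simp: loops_def path_image_join)

lemma loops_reverse: "\<gamma> \<in> loops X b \<Longrightarrow> reversepath \<gamma> \<in> loops X b"
  by (auto simp: loops_def)

lemma loops_const: "b \<in> X \<Longrightarrow> (\<lambda>_. b) \<in> loops X b"
  by (auto simp: loops_def path_def path_image_def pathstart_def pathfinish_def)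

text \<open>The homotopies are images of homotopies of paths in the unit interval, for which the
  library has these facts; there they are stated for normed spaces only.\<close>
lemma homotopic_paths_interval_image:
  assumes "path p" "path_image p \<subseteq> S" "homotopic_paths {0..1::real} f g"
  shows "homotopic_paths S (p \<circ> f) (p \<circ> g)"
  using assms by (intro homotopic_paths_continuous_image[OF assms(3)]) (auto simp: path_def path_image_def)

lemma path_interval_id: "path (\<lambda>x. x::real)" "path_image (\<lambda>x. x::real) \<subseteq> {0..1}"
  by (auto simp: path_def path_image_def)

lemma homotopic_paths_const_left:
  assumes "path p" "path_image p \<subseteq> S"
  shows "homotopic_paths S ((\<lambda>_. pathstart p) +++ p) p"
  using homotopic_paths_interval_image[OF assms homotopic_paths_lid[OF path_interval_id], unfolded path_compose_join]
  by (simp add: o_def pathstart_def linepath_refl)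

lemma homotopic_paths_reverse_left:
  assumes "path p" "path_image p \<subseteq> S"
  shows "homotopic_paths S (reversepath p +++ p) (\<lambda>_. pathfinish p)"
  using homotopic_paths_interval_image[OF assms homotopic_paths_linv[OF path_interval_id], unfolded path_compose_join]
  by (simp add: o_def pathfinish_def linepath_refl reversepath_def)

lemma path_class_eq:
  "homotopic_paths X \<gamma> \<delta> \<Longrightarrow> path_class X \<gamma> = path_class X \<delta>"
  unfolding path_class_def using homotopic_paths_trans homotopic_paths_sym by blast

lemma mem_path_class_iff: "\<delta> \<in> path_class X \<gamma> \<longleftrightarrow> homotopic_paths X \<gamma> \<delta>"
  by (simp add: path_class_def)

lemma path_class_self: "\<gamma> \<in> loops X b \<Longrightarrow> \<gamma> \<in> path_class X \<gamma>"
  by (simp add: mem_path_class_iff loopsD)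

lemma carrier_pi1: "carrier (pi1 X b) = path_class X ` loops X b"
  and one_pi1: "\<one>\<^bsub>pi1 X b\<^esub> = path_class X (\<lambda>_. b)"
  by (simp_all add: pi1_def)

lemma mult_pi1:
  assumes "\<gamma> \<in> loops X b" "\<delta> \<in> loops X b"
  shows "path_class X \<gamma> \<otimes>\<^bsub>pi1 X b\<^esub> path_class X \<delta> = path_class X (\<gamma> +++ \<delta>)"
proof -
  have "{\<epsilon>. \<exists>\<alpha>\<in>path_class X \<gamma>. \<exists>\<beta>\<in>path_class X \<delta>. homotopic_paths X (\<alpha> +++ \<beta>) \<epsilon>}
      = {\<epsilon>. homotopic_paths X (\<gamma> +++ \<delta>) \<epsilon>}" (is "?L = ?R")
  proof
    show "?R \<subseteq> ?L" using path_class_self assms by blast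
    show "?L \<subseteq> ?R"
    proof
      fix \<epsilon> assume "\<epsilon> \<in> ?L"
      then obtain \<alpha> \<beta> where h: "homotopic_paths X \<gamma> \<alpha>" "homotopic_paths X \<delta> \<beta>" "homotopic_paths X (\<alpha> +++ \<beta>) \<epsilon>"
        by (auto simp: mem_path_class_iff)
      then have "homotopic_paths X (\<gamma> +++ \<delta>) (\<alpha> +++ \<beta>)"
        using assms by (intro homotopic_paths_join) (auto simp: loopsD)
      then show "\<epsilon> \<in> ?R" using h(3) homotopic_paths_trans by blast
    qed
  qed
  then show ?thesis by (simp add: pi1_def path_class_def)
qed

lemma group_pi1:
  assumes "b \<in> X" shows "group (pi1 X b)"
proof (rule groupI)
  show "\<one>\<^bsub>pi1 X b\<^esub> \<in> carrier (pi1 X b)"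
    using loops_const[OF assms] by (auto simp: carrier_pi1 one_pi1)
next
  fix x y assume "x \<in> carrier (pi1 X b)" "y \<in> carrier (pi1 X b)"
  then show "x \<otimes>\<^bsub>pi1 X b\<^esub> y \<in> carrier (pi1 X b)"
    by (auto simp: carrier_pi1 mult_pi1 intro!: imageI loops_join)
next
  fix x y z assume "x \<in> carrier (pi1 X b)" "y \<in> carrier (pi1 X b)" "z \<in> carrier (pi1 X b)"
  then obtain p q r where l: "p \<in> loops X b" "q \<in> loops X b" "r \<in> loops X b"
    "x = path_class X p" "y = path_class X q" "z = path_class X r"
    by (auto simp: carrier_pi1)
  have "homotopic_paths X ((p +++ q) +++ r) (p +++ q +++ r)"
    using l by (intro homotopic_paths_sym[OF homotopic_paths_assoc]) (auto simp: loopsD)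
  then show "x \<otimes>\<^bsub>pi1 X b\<^esub> y \<otimes>\<^bsub>pi1 X b\<^esub> z = x \<otimes>\<^bsub>pi1 X b\<^esub> (y \<otimes>\<^bsub>pi1 X b\<^esub> z)"
    using l by (simp add: mult_pi1 loops_join path_class_eq)
next
  fix x assume "x \<in> carrier (pi1 X b)"
  then obtain p where l: "p \<in> loops X b" "x = path_class X p" by (auto simp: carrier_pi1)
  have "homotopic_paths X ((\<lambda>_. b) +++ p) p"
    using homotopic_paths_const_left[of p X] loopsD[OF l(1)] by simp
  then show "\<one>\<^bsub>pi1 X b\<^esub> \<otimes>\<^bsub>pi1 X b\<^esub> x = x"
    using l loops_const[OF assms] by (simp add: mult_pi1 one_pi1 path_class_eq)
  have "homotopic_paths X (reversepath p +++ p) (\<lambda>_. b)"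
    using homotopic_paths_reverse_left[of p X] loopsD[OF l(1)] by simp
  then show "\<exists>y\<in>carrier (pi1 X b). y \<otimes>\<^bsub>pi1 X b\<^esub> x = \<one>\<^bsub>pi1 X b\<^esub>"
    using l loops_reverse[OF l(1)]
    by (intro bexI[of _ "path_class X (reversepath p)"]) (auto simp: mult_pi1 one_pi1 path_class_eq carrier_pi1)
qed

section \<open>Lifting lines to vectors\<close>

text \<open>\<open>v v\<^sup>T\<close> determines \<open>v\<close> up to sign, and near a vector with a nonzero coordinate a branch of the
  square root picks the sign. Matrices form a normed space, for which the library has lifting
  theorems; lines do not.\<close>

definition outer :: "complex ^ 'n \<Rightarrow> complex ^ 'n ^ 'n" where
  "outer v = (\<chi> i j. v $ i * v $ j)"

lemma outer_nth [simp]: "outer v $ i $ j = v $ i * v $ j"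
  by (simp add: outer_def)

lemma continuous_on_outer: "continuous_on A outer"
  unfolding outer_def by (intro continuous_intros)

lemma Re_power2_pos_imp: "Re (z\<^sup>2) > 0 \<Longrightarrow> Re z \<noteq> 0"
  by (auto simp: power2_eq_square)

text \<open>Row k of \<open>outer v\<close> is \<open>v $ k\<close> times v, so v is recovered by
  dividing the row by \<open>v $ k\<close>. The entry (k, k) determines \<open>v $ k / a\<close> up
  to sign, and the condition on the real part selects the root that \<open>csqrt\<close> returns.
  Replacing \<open>a\<close> by \<open>- a\<close> gives the other sheet.\<close>

lemma homeomorphism_outer:
  fixes a :: complex and k :: "'n::finite"
  assumes "a \<noteq> 0"
  shows "homeomorphism {v. Re ((v $ k / a)\<^sup>2) > 0 \<and> Re (v $ k / a) > 0}
     (outer ` (- {0}) \<inter> {M. Re (M $ k $ k / a\<^sup>2) > 0})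
     outer (\<lambda>M. \<chi> j. M $ k $ j / (a * csqrt (M $ k $ k / a\<^sup>2)))"
    (is "homeomorphism ?V ?T outer ?q")
proof (rule homeomorphismI)
  show "continuous_on ?V outer" by (rule continuous_on_outer)
  show "continuous_on ?T ?q"
  proof (intro continuous_intros)
    show "continuous_on ?T (\<lambda>M. csqrt (M $ k $ k / a\<^sup>2))"
      by (rule continuous_on_compose2[of "{z. Re z > 0}" csqrt])
        (use assms in \<open>auto intro!: continuous_at_imp_continuous_on continuous_at_csqrt continuous_intros simp: complex_nonpos_Reals_iff\<close>)
  qed (use assms in auto)
  have q1: "?q (outer v) = v" if "v \<in> ?V" for v
  proof -
    have "csqrt ((v $ k / a)\<^sup>2) = v $ k / a" using that by (intro csqrt_unique) auto
    moreover have "v $ k \<noteq> 0" using that by auto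
    ultimately show ?thesis using assms by (simp add: vec_eq_iff power_divide flip: power2_eq_square)
  qed
  have nz: "v \<noteq> 0" if "v \<in> ?V" for v using that by auto
  show im: "outer ` ?V \<subseteq> ?T"
    using nz by (auto simp: power_divide power2_eq_square)
  have q2: "?q M \<in> ?V \<and> outer (?q M) = M" if M: "M \<in> ?T" for M
  proof -
    obtain w where w: "w \<noteq> 0" "M = outer w" "Re (M $ k $ k / a\<^sup>2) > 0" using M by blast
    define s where "s = csqrt (M $ k $ k / a\<^sup>2)"
    have s2: "s\<^sup>2 = (w $ k / a)\<^sup>2" unfolding s_def power2_csqrt using w(2) by (simp add: power_divide power2_eq_square[of "w $ k"])
    have Re2: "Re (s\<^sup>2) > 0" unfolding s_def power2_csqrt by (rule w(3))
    have "s = w $ k / a \<or> s = - (w $ k / a)" using s2 power2_eq_iff by blast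
    then obtain e where e: "e = 1 \<or> e = -1" "s = e * (w $ k / a)" by (metis mult_1 mult_minus1)
    have wk: "w $ k \<noteq> 0" using Re2 s2 by auto
    have qw: "?q M = (\<chi> j. e * w $ j)"
      using e wk assms w(2) unfolding s_def[symmetric] by (auto simp: vec_eq_iff)
    have "Re s > 0"
    proof -
      have "Re s \<ge> 0" using csqrt_principal[of "M $ k $ k / a\<^sup>2"] by (auto simp: s_def)
      moreover have "Re s \<noteq> 0" by (rule Re_power2_pos_imp[OF Re2])
      ultimately show ?thesis by simp
    qed
    moreover have "?q M $ k / a = s" using qw e(2) by simp
    ultimately have "?q M \<in> ?V" using Re2 by simp
    moreover have "outer (?q M) = M" unfolding qw using e(1) w(2) by (auto simp: vec_eq_iff)
    ultimately show ?thesis by blast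
  qed
  show "?q ` ?T \<subseteq> ?V" using q2 by blast
  show "\<And>x. x \<in> ?V \<Longrightarrow> ?q (outer x) = x" by (rule q1)
  show "\<And>y. y \<in> ?T \<Longrightarrow> outer (?q y) = y" using q2 by blast
qed

text \<open>Around \<open>outer w\<close> with \<open>a = w $ k\<close> non-zero, take the matrices
  whose entry (k, k) divided by a^2 has positive real part. Over them \<open>v $ k / a\<close> lies
  in one of two opposite sectors of opening pi/2, around the positive and the negative real axis;
  these are the sheets \<open>V a\<close> and \<open>V (- a)\<close>.\<close>

lemma covering_space_outer: "covering_space (- {0}) outer (outer ` (- {0 :: complex ^ 'n::finite}))"
proof
  show "continuous_on (- {0}) outer" by (rule continuous_on_outer)
  fix x :: "complex ^ 'n ^ 'n" assume "x \<in> outer ` (- {0})"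
  then obtain w where w: "w \<noteq> 0" "x = outer w" by auto
  then obtain k where k: "w $ k \<noteq> 0" by (auto simp: vec_eq_iff)
  define a where "a = w $ k"
  define V where "V = (\<lambda>a. {v :: complex ^ 'n. Re ((v $ k / a)\<^sup>2) > 0 \<and> Re (v $ k / a) > 0})"
  define T where "T = outer ` (- {0}) \<inter> {M :: complex ^ 'n ^ 'n. Re (M $ k $ k / a\<^sup>2) > 0}"
  have a: "a \<noteq> 0" using k by (simp add: a_def)
  have "open {M :: complex ^ 'n ^ 'n. Re (M $ k $ k / a\<^sup>2) > 0}"
    using a by (intro open_Collect_less continuous_intros) auto
  then have "openin (top_of_set (outer ` (- {0}))) T"
    unfolding T_def by (rule openin_open_Int)
  moreover have "x \<in> T" using w k a by (auto simp: T_def a_def power2_eq_square)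
  moreover have "\<Union> {V a, V (- a)} = - {0} \<inter> outer -` T"
  proof -
    have 1: "v \<in> V a \<or> v \<in> V (- a)" if "Re ((v $ k / a)\<^sup>2) > 0" for v
    proof -
      have "Re (v $ k / a) \<noteq> 0" by (rule Re_power2_pos_imp[OF that])
      then show ?thesis using that by (auto simp: V_def power_divide)
    qed
    have 2: "Re ((v $ k / a)\<^sup>2) > 0" if "v \<in> V a \<or> v \<in> V (- a)" for v
      using that by (auto simp: V_def power_divide)
    have 3: "outer v \<in> T" "v \<noteq> 0" if "Re ((v $ k / a)\<^sup>2) > 0" for v
      using that by (auto simp: T_def power_divide power2_eq_square intro!: imageI)
    have 4: "Re ((v $ k / a)\<^sup>2) > 0" if "outer v \<in> T" for v
      using that by (auto simp: T_def power_divide power2_eq_square)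
    have "v \<in> \<Union> {V a, V (- a)} \<longleftrightarrow> v \<in> V a \<or> v \<in> V (- a)" for v by simp
    moreover have "v \<in> V a \<or> v \<in> V (- a) \<longleftrightarrow> Re ((v $ k / a)\<^sup>2) > 0" for v
      by (rule iffI) (erule 2, erule 1)
    moreover have "v \<in> - {0} \<inter> outer -` T \<longleftrightarrow> Re ((v $ k / a)\<^sup>2) > 0" for v
    proof
      assume "v \<in> - {0} \<inter> outer -` T"
      then show "Re ((v $ k / a)\<^sup>2) > 0" by (intro 4) (rule vimageD, rule IntD2)
    next
      assume "Re ((v $ k / a)\<^sup>2) > 0"
      from 3[OF this] show "v \<in> - {0} \<inter> outer -` T" by simp
    qed
    ultimately have "v \<in> \<Union> {V a, V (- a)} \<longleftrightarrow> v \<in> - {0} \<inter> outer -` T" for v by presburger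
    then show ?thesis by (rule Set.set_eqI)
  qed
  moreover have "openin (top_of_set (- {0})) (V c)" if "c \<noteq> 0" for c
  proof -
    have "open (V c)" unfolding V_def
      using that by (intro open_Collect_conj open_Collect_less continuous_intros) auto
    moreover have "V c \<subseteq> - {0}" by (auto simp: V_def)
    ultimately show ?thesis by (simp add: open_subset)
  qed
  moreover have "pairwise disjnt {V a, V (- a)}"
    by (auto simp: pairwise_insert disjnt_def V_def)
  moreover have "\<exists>q. homeomorphism (V c) T outer q" if "c = a \<or> c = - a" for c
    using homeomorphism_outer[of c k] that a unfolding V_def T_def by (auto simp: power2_eq_square)
  ultimately show "\<exists>T. x \<in> T \<and> openin (top_of_set (outer ` (- {0}))) T \<and>
      (\<exists>v. \<Union>v = - {0} \<inter> outer -` T \<and> (\<forall>u\<in>v. openin (top_of_set (- {0})) u) \<and>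
        pairwise disjnt v \<and> (\<forall>u\<in>v. \<exists>q. homeomorphism u T outer q))"
    using a by (intro exI[of _ T] conjI exI[of _ "{V a, V (- a)}"]) auto
qed simp

lemma lift_outer:
  fixes D :: "'a::real_normed_vector set" and f :: "'a \<Rightarrow> complex ^ 'n::finite ^ 'n"
  assumes "convex D" "continuous_on D f" "f ` D \<subseteq> outer ` (- {0})"
  obtains g where "continuous_on D g" "\<And>x. x \<in> D \<Longrightarrow> g x \<noteq> 0 \<and> outer (g x) = f x"
proof (cases "D = {}")
  case True then show ?thesis using that[of "\<lambda>_. 0"] by simp
next
  case False
  then obtain z where z: "z \<in> D" by blast
  then obtain a where a: "a \<in> - {0}" "f z = outer a" using assms(3) by auto
  show ?thesis
  proof (rule covering_space_lift_strong[OF covering_space_outer a(1) z _ _ assms(2) _ a(2)])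
    show "simply_connected D" "locally path_connected D"
      using assms(1) convex_imp_simply_connected convex_imp_locally_path_connected by auto
    show "f \<in> D \<rightarrow> outer ` (- {0})" using assms(3) by auto
    fix g assume "continuous_on D g" "g \<in> D \<rightarrow> - {0}" "\<And>y. y \<in> D \<Longrightarrow> outer (g y) = f y"
    then show thesis by (intro that[of g]) auto
  qed
qed


section \<open>The double covering of the complement of a quadric\<close>

text \<open>The vectors on which \<open>F\<close> takes the value \<open>1\<close> form a double covering of the complement of
  the quadric \<open>F = 0\<close>, with deck transformation \<open>v \<mapsto> - v\<close>.\<close>

definition unit_quadric :: "nat \<Rightarrow> form \<Rightarrow> proj set \<Rightarrow> (nat \<Rightarrow> complex) set" where
  "unit_quadric N F X = {v \<in> hvec N. F v = 1 \<and> pt v \<in> X}"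

lemma unit_quadric_proportional:
  assumes "hpoly N 2 F" "v \<in> unit_quadric N F X" "w \<in> unit_quadric N F X" "pt v = pt w"
  obtains e where "e = 1 \<or> e = - 1" "w = (\<lambda>i. e * v i)"
proof -
  have "nonzero_vec v" "nonzero_vec w" using assms(2,3) by (auto simp: unit_quadric_def hvec_nonzero)
  then obtain e where e: "w = (\<lambda>i. e * v i)" using pt_eq_iff assms(4) by blast
  have "e\<^sup>2 = 1"
    using assms(2,3) hpoly_scale[OF assms(1), of e v] unfolding e by (simp add: unit_quadric_def)
  then show thesis using that e power2_eq_1_iff by blast
qed

lemma normalize_unit_quadric:
  assumes "hpoly N 2 F" "v \<in> hvec N" "F v \<noteq> 0" "pt v \<in> X" "s\<^sup>2 = F v"
  shows "(\<lambda>i. inverse s * v i) \<in> unit_quadric N F X" "pt (\<lambda>i. inverse s * v i) = pt v"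
proof -
  have s: "s \<noteq> 0" using assms by auto
  show p: "pt (\<lambda>i. inverse s * v i) = pt v" using s assms(2) by (intro pt_scale) (auto simp: hvec_nonzero)
  show "(\<lambda>i. inverse s * v i) \<in> unit_quadric N F X"
    using hpoly_scale[OF assms(1), of "inverse s" v] assms s p hvec_scale[OF assms(2), of "inverse s"]
    by (simp add: unit_quadric_def power_inverse)
qed

section \<open>Existence and uniqueness of lifts to the double covering\<close>

definition lift_on where
  "lift_on N F X D f g \<longleftrightarrow> continuous_on D g \<and> (\<forall>x\<in>D. g x \<in> unit_quadric N F X \<and> pt (g x) = f x)"

lemma lift_on_compose:
  "lift_on N F X D f g \<Longrightarrow> continuous_on D' r \<Longrightarrow> r ` D' \<subseteq> D \<Longrightarrow> lift_on N F X D' (\<lambda>x. f (r x)) (\<lambda>x. g (r x))"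
  by (auto simp: lift_on_def intro: continuous_on_compose2)

text \<open>The quotient is homogeneous of degree 0, hence a function of the point. These functions
  are the entries of the outer square of a representative normalized to F = 1; they map the
  complement of the quadric into the base of the covering \<open>outer\<close>.\<close>

lemma continuous_on_quadratic_ratio:
  assumes F: "hpoly N 2 F"
  shows "continuous_on {p. F (hcoord p) \<noteq> 0} (\<lambda>p. hcoord p i * hcoord p j / F (hcoord p))"
proof -
  define W where "W = {v. nonzero_vec v} \<inter> F -` (- {0})"
  have "open W" unfolding W_def
    by (intro open_Int open_nonzero open_vimage hpoly_continuous[OF F]) auto
  moreover have "continuous_on W (\<lambda>v. v i * v j / F v)"
    by (intro continuous_intros hpoly_continuous[OF F]
        continuous_on_subset[OF continuous_on_product_coordinates]) (auto simp: W_def)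
  moreover have "(\<lambda>i. c * v i) \<in> W \<and> c * v i * (c * v j) / F (\<lambda>i. c * v i) = v i * v j / F v"
    if "v \<in> W" "c \<noteq> 0" for v c
    using that hpoly_scale[OF F, of c v] by (auto simp: W_def nonzero_vec_def power2_eq_square)
  ultimately have "continuous_on {p. hcoord p \<in> W} (\<lambda>p. hcoord p i * hcoord p j / F (hcoord p))"
    by (intro continuous_on_descend[of W "\<lambda>v. v i * v j / F v"]) (auto simp: W_def)
  moreover have "{p. hcoord p \<in> W} = {p. F (hcoord p) \<noteq> 0}" by (auto simp: W_def)
  ultimately show ?thesis by simp
qed

text \<open>The coordinates 0, 1, 2 are numbered by the finite type \<open>3\<close>, whose elements
  appear as 1, 2, 3. The projective line is treated in the same three coordinates, the last one
  being zero.\<close>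

definition index3 :: "3 \<Rightarrow> nat" where
  "index3 i = (if i = 1 then 0 else if i = 2 then 1 else 2)"

definition vec3 :: "complex ^ 3 \<Rightarrow> nat \<Rightarrow> complex" where
  "vec3 w i = (if i = 0 then w $ 1 else if i = 1 then w $ 2 else if i = 2 then w $ 3 else 0)"

lemma vec3_index3: "vec3 w (index3 i) = w $ i"
  using exhaust_3[of i] by (auto simp: vec3_def index3_def)

lemma index3_surj: "i \<le> 2 \<Longrightarrow> \<exists>k. i = index3 k"
  by (rule exI[of _ "if i = 0 then 1 else if i = 1 then 2 else 3"]) (auto simp: index3_def)

text \<open>A row k of the matrix with \<open>w $ k\<close> non-zero shows that w is a multiple c v,
  and the entry (k, k) then gives c^2 F(v) = 1.\<close>

lemma outer_proportional:
  assumes F: "hpoly N 2 F" "N \<le> 2" and v: "v \<in> hvec N" "F v \<noteq> 0"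
    and w: "w \<noteq> 0" "outer w = (\<chi> i j. v (index3 i) * v (index3 j) / F v)"
  shows "vec3 w \<in> hvec N \<and> F (vec3 w) = 1 \<and> pt (vec3 w) = pt v"
proof -
  have prod: "vec3 w i * vec3 w j = v i * v j / F v" for i j
  proof (cases "i \<le> 2 \<and> j \<le> 2")
    case True
    then obtain k l where "i = index3 k" "j = index3 l" using index3_surj by meson
    then show ?thesis using arg_cong[OF w(2), of "\<lambda>M. M $ k $ l"] by (simp add: vec3_index3)
  next
    case False
    then have "v i * v j = 0" "vec3 w i * vec3 w j = 0"
      using v(1) F(2) by (auto simp: hvec_def vec3_def)
    then show ?thesis by (metis div_0)
  qed
  obtain k where "w $ k \<noteq> 0" using w(1) by (auto simp: vec_eq_iff)
  then obtain k where k: "vec3 w k \<noteq> 0" using vec3_index3 by metis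
  define c where "c = v k / (F v * vec3 w k)"
  have "vec3 w j = c * v j" for j
    using prod[of k j] k v(2) by (simp add: c_def field_simps)
  then have eq: "vec3 w = (\<lambda>j. c * v j)" by auto
  have c2: "c\<^sup>2 * F v = 1"
  proof -
    have A: "vec3 w k * vec3 w k * F v = v k * v k" using prod[of k k] v(2) by simp
    then have "v k \<noteq> 0" using k v(2) by auto
    moreover have "c\<^sup>2 * F v = (v k * v k) / (vec3 w k * vec3 w k * F v)"
      using k v(2) by (simp add: c_def power2_eq_square)
    ultimately show ?thesis unfolding A by simp
  qed
  then have "c \<noteq> 0" by auto
  then show ?thesis
    unfolding eq using c2 hpoly_scale[OF F(1), of c v] hvec_scale[OF v(1)] pt_scale[of v c] hvec_nonzero[OF v(1)]
    by simp
qed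

text \<open>The matrix v v^T / F(v), for v over \<open>f x\<close>, does not depend on v and is
  continuous in x. Lifting it through the covering \<open>outer\<close> amounts to choosing the
  representative with F = 1 continuously.\<close>

lemma lift_exists:
  fixes D :: "'a::real_normed_vector set"
  assumes F: "hpoly N 2 F" "N \<le> 2" and X: "X \<subseteq> PS N" "\<And>p. p \<in> X \<Longrightarrow> F (hcoord p) \<noteq> 0"
    and D: "convex D" "continuous_on D f" "f ` D \<subseteq> X"
  shows "\<exists>g. lift_on N F X D f g"
proof -
  define M :: "'a \<Rightarrow> complex ^ 3 ^ 3" where
    "M = (\<lambda>x. \<chi> i j. hcoord (f x) (index3 i) * hcoord (f x) (index3 j) / F (hcoord (f x)))"
  have "continuous_on D M" unfolding M_def
    by (intro continuous_on_vec_lambda continuous_on_compose2[OF continuous_on_quadratic_ratio[OF F(1)] D(2)])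
      (use D(3) X in auto)
  moreover have "M x \<in> outer ` (- {0})" if "x \<in> D" for x
  proof -
    define v where "v = hcoord (f x)"
    have "f x \<in> X" using that D(3) by blast
    then have v: "v \<in> hvec N" "F v \<noteq> 0" using X hcoord_in_hvec unfolding v_def by blast+
    \<comment> \<open>A root taken pointwise is enough here: it shows that \<open>M x\<close> is in
      the image of \<open>outer\<close>, and continuity comes from the lifting theorem.\<close>
    define w :: "complex ^ 3" where "w = (\<chi> i. v (index3 i) / csqrt (F v))"
    have "outer w = M x"
      by (simp add: w_def M_def outer_def v_def[symmetric] vec_eq_iff) (metis power2_csqrt power2_eq_square)
    moreover have "w \<noteq> 0"
    proof -
      obtain i where "v i \<noteq> 0" using v by (auto simp: hvec_def nonzero_vec_def)
      then have "i \<le> 2" using v(1) F(2) by (auto simp: hvec_def) (meson le_trans not_le)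
      then show ?thesis using \<open>v i \<noteq> 0\<close> index3_surj v(2) by (auto simp: w_def vec_eq_iff)
    qed
    ultimately show ?thesis by (metis Compl_iff image_eqI singletonD)
  qed
  ultimately obtain g where g: "continuous_on D g" "\<And>x. x \<in> D \<Longrightarrow> g x \<noteq> 0 \<and> outer (g x) = M x"
    using lift_outer[OF D(1), of M] by blast
  have "lift_on N F X D f (\<lambda>x. vec3 (g x))"
    unfolding lift_on_def
  proof (intro conjI ballI)
    show "continuous_on D (\<lambda>x. vec3 (g x))"
    proof (rule continuous_on_coordinatewise_then_product)
      fix i
      show "continuous_on D (\<lambda>x. vec3 (g x) i)"
        unfolding vec3_def by (cases "i = 0"; cases "i = 1"; cases "i = 2") (auto intro!: continuous_intros g(1))
    qed
    fix x assume x: "x \<in> D"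
    have v: "hcoord (f x) \<in> hvec N" "F (hcoord (f x)) \<noteq> 0" "f x \<in> X"
    proof -
      show fx: "f x \<in> X" using x D(3) by blast
      show "hcoord (f x) \<in> hvec N" "F (hcoord (f x)) \<noteq> 0" using fx X hcoord_in_hvec by blast+
    qed
    have "vec3 (g x) \<in> hvec N \<and> F (vec3 (g x)) = 1 \<and> pt (vec3 (g x)) = pt (hcoord (f x))"
      using outer_proportional[OF F v(1,2), of "g x"] g(2)[OF x] by (simp add: M_def)
    then show "vec3 (g x) \<in> unit_quadric N F X" "pt (vec3 (g x)) = f x"
      using v(3) by (auto simp: unit_quadric_def)
  qed
  then show ?thesis by blast
qed

text \<open>The sets where g' = g and where g' = -g are closed, disjoint and cover the connected set
  D, so one of them is all of D.\<close>

lemma lift_unique: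
  assumes F: "hpoly N 2 F" and D: "connected D" and l: "lift_on N F X D f g" "lift_on N F X D f g'"
  obtains e where "e = 1 \<or> e = - 1" "\<And>x. x \<in> D \<Longrightarrow> g' x = (\<lambda>i. e * g x i)"
proof -
  define E where "E = (\<lambda>e::complex. {x \<in> D. g' x = (\<lambda>i. e * g x i)})"
  have "closedin (top_of_set D) (E e)" for e
  proof -
    have "E e = (\<Inter>i. {x \<in> D. g' x i - e * g x i = 0})" by (auto simp: E_def)
    moreover have "closedin (top_of_set D) {x \<in> D. g' x i - e * g x i = 0}" for i
    proof (rule continuous_closedin_preimage_constant)
      have "continuous_on D g" "continuous_on D g'" using l by (auto simp: lift_on_def)
      then show "continuous_on D (\<lambda>x. g' x i - e * g x i)"
        by (intro continuous_intros) (rule continuous_on_product_then_coordinatewise, assumption)+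
    qed
    ultimately show ?thesis by (auto intro!: closedin_INT)
  qed
  moreover have "D \<subseteq> E 1 \<union> E (- 1)"
  proof
    fix x assume x: "x \<in> D"
    have "g x \<in> unit_quadric N F X" "g' x \<in> unit_quadric N F X" "pt (g x) = pt (g' x)"
      using l x by (auto simp: lift_on_def)
    then obtain e where "e = 1 \<or> e = -1" "g' x = (\<lambda>i. e * g x i)"
      by (rule unit_quadric_proportional[OF F])
    then show "x \<in> E 1 \<union> E (- 1)" using x by (auto simp: E_def)
  qed
  moreover have "E 1 \<inter> E (- 1) = {}"
  proof -
    have False if "x \<in> E 1" "x \<in> E (- 1)" for x
    proof -
      have "g x i = 0" for i
      proof -
        have "g' x i = 1 * g x i" "g' x i = - 1 * g x i"
          using that unfolding E_def by (metis (mono_tags, lifting) mem_Collect_eq)+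
        then have "1 * g x i = - 1 * g x i" by (rule subst)
        then show ?thesis by simp
      qed
      then have "\<not> nonzero_vec (g x)" by (auto simp: nonzero_vec_def)
      then show False using that l by (auto simp: E_def lift_on_def unit_quadric_def hvec_nonzero)
    qed
    then show ?thesis by blast
  qed
  moreover have "E 1 \<union> E (- 1) \<subseteq> D" by (auto simp: E_def)
  ultimately have "E 1 = {} \<or> E (- 1) = {}"
    using D unfolding connected_closedin_eq by (metis subset_antisym)
  then have "D \<subseteq> E 1 \<or> D \<subseteq> E (- 1)" using \<open>D \<subseteq> E 1 \<union> E (- 1)\<close> by auto
  then show thesis
  proof
    assume "D \<subseteq> E 1" then show thesis by (intro that[of 1]) (auto simp: E_def)
  next
    assume "D \<subseteq> E (- 1)" then show thesis by (intro that[of "- 1"]) (auto simp: E_def)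
  qed
qed

text \<open>The values of M are multiples of 2 pi i, hence at least 1 apart when distinct; a
  continuous function with discrete range is constant on a connected set.\<close>

lemma exp_const_imp_const:
  fixes M :: "'a::topological_space \<Rightarrow> complex"
  assumes "connected D" "continuous_on D M" "\<And>x. x \<in> D \<Longrightarrow> exp (M x) = 1" "x \<in> D" "y \<in> D"
  shows "M x = M y"
proof -
  have "M constant_on D"
  proof (rule continuous_discrete_range_constant[OF assms(1,2)])
    fix x assume x: "x \<in> D"
    show "\<exists>e>0. \<forall>y. y \<in> D \<and> M y \<noteq> M x \<longrightarrow> e \<le> norm (M y - M x)"
    proof (intro exI[of _ 1] conjI allI impI)
      fix y assume y: "y \<in> D \<and> M y \<noteq> M x"
      have "exp (M y) = exp (M x)" using assms(3) x y by simp
      then obtain n :: int where n: "M y = M x + of_int (2 * n) * of_real pi * \<i>"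
        unfolding exp_eq by auto
      then have "n \<noteq> 0" using y by auto
      then have "2 * pi * 1 \<le> 2 * pi * \<bar>real_of_int n\<bar>" by (intro mult_left_mono) auto
      moreover have "norm (of_int (2 * n) * of_real pi * \<i>) = 2 * pi * \<bar>real_of_int n\<bar>"
        by (simp add: norm_mult)
      ultimately have "norm (of_int (2 * n) * of_real pi * \<i>) \<ge> 1" using pi_gt3 by linarith
      moreover have "norm (M y - M x) = norm (of_int (2 * n) * of_real pi * \<i>)" by (simp add: n)
      ultimately show "1 \<le> norm (M y - M x)" by linarith
    qed simp
  qed
  then show ?thesis using assms(4,5) by (auto simp: constant_on_def)
qed


section \<open>Monodromy and logarithmic variation\<close>

text \<open>A planar model of the standard 2-simplex with the vertices 0, 1, 2 at (0, 0), (1, 0),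
  (0, 1). The edges 01, 12, 02 are parametrized by (u, 0), (1 - u, u), (0, u).\<close>

definition unit_triangle :: "(real \<times> real) set" where
  "unit_triangle = {z. 0 \<le> fst z \<and> 0 \<le> snd z \<and> fst z + snd z \<le> 1}"

lemma convex_unit_triangle: "convex unit_triangle"
proof -
  have eq: "unit_triangle = {z. inner (-1, 0) z \<le> 0} \<inter> {z. inner (0, -1) z \<le> 0} \<inter> {z. inner (1, 1) z \<le> 1}"
    by (auto simp: unit_triangle_def inner_prod_def)
  show ?thesis unfolding eq by (intro convex_Int convex_halfspace_le)
qed

text \<open>\<open>h\<close> is inverted by the deck transformation, so that the variation of \<open>ln h\<close> along lifted paths
  is a cocycle with values in the local system of the double covering.\<close>

locale double_cover =
  fixes N :: nat and F :: form and X :: "proj set" and h :: form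
  assumes N_le: "N \<le> 2" and F: "hpoly N 2 F" and X_subset: "X \<subseteq> PS N"
    and F_nz: "p \<in> X \<Longrightarrow> F (hcoord p) \<noteq> 0"
    and h_cont: "continuous_on (unit_quadric N F X) h"
    and h_nz: "v \<in> unit_quadric N F X \<Longrightarrow> h v \<noteq> 0"
    and h_neg: "v \<in> unit_quadric N F X \<Longrightarrow> h (\<lambda>i. - v i) = inverse (h v)"
begin

abbreviation "Y \<equiv> unit_quadric N F X"

text \<open>A choice, without any continuity, of one of the two vectors over each point. It
  identifies the stalks of the local system of the covering with the complex numbers.\<close>

definition rep :: "proj \<Rightarrow> nat \<Rightarrow> complex" where
  "rep p = (SOME v. v \<in> Y \<and> pt v = p)"

lemma rep: assumes "p \<in> X" shows "rep p \<in> Y \<and> pt (rep p) = p"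
proof -
  have v: "hcoord p \<in> hvec N" "F (hcoord p) \<noteq> 0" using assms X_subset hcoord_in_hvec F_nz by blast+
  have "\<exists>v. v \<in> Y \<and> pt v = p"
    using normalize_unit_quadric[OF F v, of X "csqrt (F (hcoord p))"] assms by (metis power2_csqrt pt_hcoord)
  then show ?thesis unfolding rep_def by (rule someI_ex)
qed

text \<open>For v on the unit quadric over X this is the sign by which v differs from the chosen
  vector over its point.\<close>

definition sheet :: "(nat \<Rightarrow> complex) \<Rightarrow> complex" where
  "sheet v = (if v = rep (pt v) then 1 else - 1)"

lemma sheet_cases: "sheet v = 1 \<or> sheet v = - 1"
  by (simp add: sheet_def)

lemma sheet_square [simp]: "sheet v * sheet v = 1" "sheet v * (sheet v * z) = z"
  using sheet_cases[of v] by auto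

lemma sheet_nz [simp]: "sheet v \<noteq> 0"
  using sheet_cases[of v] by auto

lemma sheet_scale:
  assumes v: "v \<in> Y" and e: "e = 1 \<or> e = - 1"
  shows "sheet (\<lambda>i. e * v i) = e * sheet v"
proof -
  have "pt v \<in> X" "nonzero_vec v" using v by (auto simp: unit_quadric_def hvec_nonzero)
  then have r: "rep (pt v) \<in> Y" "pt v = pt (rep (pt v))" using rep by auto
  obtain d where d: "d = 1 \<or> d = - 1" "rep (pt v) = (\<lambda>i. d * v i)"
    using unit_quadric_proportional[OF F v r] by blast
  have p: "pt (\<lambda>i. e * v i) = pt v" using \<open>nonzero_vec v\<close> e by (intro pt_scale) auto
  obtain k where k: "v k \<noteq> 0" using \<open>nonzero_vec v\<close> by (auto simp: nonzero_vec_def)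
  have *: "(\<lambda>i. a * v i) = (\<lambda>i. b * v i) \<longleftrightarrow> a = b" for a b
    using k by (metis mult_cancel_right)
  have "sheet (\<lambda>i. e * v i) = (if e = d then 1 else - 1)" unfolding sheet_def p d(2) * ..
  moreover have "sheet v = (if 1 = d then 1 else - 1)"
    using *[of 1 d] unfolding sheet_def d(2) by simp
  ultimately show ?thesis using d e by auto
qed

abbreviation "lift \<equiv> lift_on N F X"

definition log_lift where
  "log_lift D f g L \<longleftrightarrow> lift D f g \<and> continuous_on D L \<and> (\<forall>x\<in>D. h (g x) = exp (L x))"

lemma log_lift_compose:
  assumes "log_lift D f g L" "continuous_on D' r" "r ` D' \<subseteq> D"
  shows "log_lift D' (\<lambda>x. f (r x)) (\<lambda>x. g (r x)) (\<lambda>x. L (r x))"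
proof -
  have "continuous_on D' (\<lambda>x. L (r x))"
    using assms by (intro continuous_on_compose2[of D L D' r]) (auto simp: log_lift_def)
  then show ?thesis using assms lift_on_compose[of N F X D f g D' r] by (auto simp: log_lift_def)
qed

lemma log_lift_exists:
  fixes D :: "'a::real_normed_vector set"
  assumes "convex D" "continuous_on D f" "f ` D \<subseteq> X"
  obtains g L where "log_lift D f g L"
proof -
  obtain g where g: "lift D f g" using lift_exists[OF F N_le X_subset F_nz assms] by blast
  have "continuous_on D (\<lambda>x. h (g x))" "\<And>x. x \<in> D \<Longrightarrow> h (g x) \<noteq> 0"
    using g h_nz by (auto simp: lift_on_def intro!: continuous_on_compose2[OF h_cont])
  then obtain L where "continuous_on D L" "\<And>x. x \<in> D \<Longrightarrow> h (g x) = exp (L x)"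
    using continuous_logarithm_on_contractible[OF _ convex_imp_contractible[OF assms(1)]] by blast
  then show ?thesis using g that by (auto simp: log_lift_def)
qed

text \<open>A second lift is e g with a constant sign e. Because the deck transformation inverts h,
  its logarithm is e L up to an additive constant, and the factor e cancels against the one in the
  sheets.\<close>

lemma log_lift_unique:
  assumes "connected D" "log_lift D f g L" "log_lift D f g' L'" "x \<in> D" "y \<in> D"
  shows "sheet (g' x) * sheet (g' y) = sheet (g x) * sheet (g y)"
    and "sheet (g' x) * (L' y - L' x) = sheet (g x) * (L y - L x)"
proof -
  have l: "lift D f g" "lift D f g'" using assms by (auto simp: log_lift_def)
  obtain e where e: "e = 1 \<or> e = - 1" "\<And>x. x \<in> D \<Longrightarrow> g' x = (\<lambda>i. e * g x i)"
    using lift_unique[OF F assms(1) l] by blast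
  have gY: "g z \<in> Y" if "z \<in> D" for z using l(1) that by (auto simp: lift_on_def)
  have s: "sheet (g' z) = e * sheet (g z)" if "z \<in> D" for z
    using sheet_scale[OF gY[OF that] e(1)] e(2)[OF that] by simp
  show "sheet (g' x) * sheet (g' y) = sheet (g x) * sheet (g y)" using s assms(4,5) e(1) by auto
  have "exp (L' z - e * L z) = 1" if "z \<in> D" for z
  proof -
    have E: "exp (L' z) = h (g' z)" "exp (L z) = h (g z)" using assms(2,3) that by (auto simp: log_lift_def)
    show ?thesis
    proof (cases "e = 1")
      case True
      then show ?thesis using E e(2)[OF that] h_nz[OF gY[OF that]] by (simp add: exp_diff)
    next
      case False
      then have "h (g' z) = inverse (h (g z))" using e(1) e(2)[OF that] h_neg[OF gY[OF that]] by simp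
      then show ?thesis using E False e(1) h_nz[OF gY[OF that]] by (simp add: exp_add)
    qed
  qed
  moreover have "continuous_on D (\<lambda>z. L' z - e * L z)"
    using assms(2,3) by (auto simp: log_lift_def intro!: continuous_intros)
  ultimately have "L' x - e * L x = L' y - e * L y"
    using exp_const_imp_const[OF assms(1), of "\<lambda>z. L' z - e * L z"] assms(4,5) by blast
  then have "L' y - L' x = e * (L y - L x)" by (simp add: algebra_simps)
  then show "sheet (g' x) * (L' y - L' x) = sheet (g x) * (L y - L x)"
    using s[OF assms(4)] e(1) by auto
qed

text \<open>The transport of the local system along a path, relative to the vectors
  \<open>rep\<close> at both ends. For a loop the choice of \<open>rep\<close> drops out, and the
  sign by which the lift fails to close up remains.\<close>

definition mon :: "(real \<Rightarrow> proj) \<Rightarrow> complex" where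
  "mon \<gamma> = (SOME z. \<exists>g L. log_lift {0..1} \<gamma> g L \<and> z = sheet (g 0) * sheet (g 1))"

text \<open>The sign \<open>sheet (g 0)\<close> makes the increment of the logarithm independent of
  the lift and expresses it in the stalk at the origin of the path.\<close>

definition var :: "(real \<Rightarrow> proj) \<Rightarrow> complex" where
  "var \<gamma> = (SOME z. \<exists>g L. log_lift {0..1} \<gamma> g L \<and> z = sheet (g 0) * (L 1 - L 0))"

lemma mon_eq: "log_lift {0..1} \<gamma> g L \<Longrightarrow> mon \<gamma> = sheet (g 0) * sheet (g 1)"
  unfolding mon_def
proof (rule some_equality)
  assume gL: "log_lift {0..1} \<gamma> g L"
  show "\<exists>g' L'. log_lift {0..1} \<gamma> g' L' \<and> sheet (g 0) * sheet (g 1) = sheet (g' 0) * sheet (g' 1)" using gL by blast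
  fix z assume "\<exists>g L. log_lift {0..1} \<gamma> g L \<and> z = sheet (g 0) * sheet (g 1)"
  then obtain g' L' where "log_lift {0..1} \<gamma> g' L'" "z = sheet (g' 0) * sheet (g' 1)" by blast
  then show "z = sheet (g 0) * sheet (g 1)" using log_lift_unique(1)[OF _ gL, of g' L' 0 1] by simp
qed

lemma var_eq: "log_lift {0..1} \<gamma> g L \<Longrightarrow> var \<gamma> = sheet (g 0) * (L 1 - L 0)"
  unfolding var_def
proof (rule some_equality)
  assume gL: "log_lift {0..1} \<gamma> g L"
  show "\<exists>g' L'. log_lift {0..1} \<gamma> g' L' \<and> sheet (g 0) * (L 1 - L 0) = sheet (g' 0) * (L' 1 - L' 0)" using gL by blast
  fix z assume "\<exists>g L. log_lift {0..1} \<gamma> g L \<and> z = sheet (g 0) * (L 1 - L 0)"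
  then obtain g' L' where "log_lift {0..1} \<gamma> g' L'" "z = sheet (g' 0) * (L' 1 - L' 0)" by blast
  then show "z = sheet (g 0) * (L 1 - L 0)" using log_lift_unique(2)[OF _ gL, of g' L' 0 1] by simp
qed

lemma log_lift_of_lift:
  assumes "lift {0..1::real} \<gamma> g" obtains L where "log_lift {0..1} \<gamma> g L"
proof -
  have "continuous_on {0..1} (\<lambda>x. h (g x))" "\<And>x. x \<in> {0..1} \<Longrightarrow> h (g x) \<noteq> 0"
    using assms h_nz by (auto simp: lift_on_def intro!: continuous_on_compose2[OF h_cont])
  then obtain L where "continuous_on {0..1} L" "\<And>x. x \<in> {0..1} \<Longrightarrow> h (g x) = exp (L x)"
    using continuous_logarithm_on_contractible[OF _ convex_imp_contractible[OF convex_real_interval(5)]] by blast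
  then show ?thesis using assms that by (auto simp: log_lift_def)
qed

lemma mon_eq_lift: "lift {0..1} \<gamma> g \<Longrightarrow> mon \<gamma> = sheet (g 0) * sheet (g 1)"
  using log_lift_of_lift mon_eq by metis

lemma mon_loop:
  assumes "lift {0..1} \<gamma> g" "e = 1 \<or> e = - 1" "g 1 = (\<lambda>i. e * g 0 i)"
  shows "mon \<gamma> = e"
proof -
  have "g 0 \<in> Y" using assms(1) by (auto simp: lift_on_def)
  then show ?thesis using mon_eq_lift[OF assms(1)] sheet_scale[OF _ assms(2)] assms(3) by simp
qed

lemma log_lift_cong: "log_lift D f g L \<Longrightarrow> (\<And>x. x \<in> D \<Longrightarrow> f x = f' x) \<Longrightarrow> log_lift D f' g L"
  by (auto simp: log_lift_def lift_on_def)

lemma log_lift_path: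
  assumes "path \<gamma>" "path_image \<gamma> \<subseteq> X" obtains g L where "log_lift {0..1} \<gamma> g L"
  by (rule log_lift_exists[of "{0..1::real}" \<gamma>]) (use assms in \<open>auto simp: path_def path_image_def\<close>)

lemma mon_cases:
  assumes "path \<gamma>" "path_image \<gamma> \<subseteq> X" shows "mon \<gamma> = 1 \<or> mon \<gamma> = - 1"
proof -
  obtain g L where "log_lift {0..1} \<gamma> g L" using log_lift_path[OF assms] .
  then show ?thesis using mon_eq sheet_cases[of "g 0"] sheet_cases[of "g 1"] by auto
qed

text \<open>Over the convex triangle a single lift with a single logarithm restricts to all three
  edges. In the first relation the signs at the middle vertex cancel, in the second the increments
  of L telescope. These are the condition on a local system and the twisted cocycle
  identity.\<close>

lemma triangle_relations:
  assumes "continuous_on unit_triangle f" "f ` unit_triangle \<subseteq> X"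
  shows "mon (\<lambda>u. f (u, 0)) * mon (\<lambda>u. f (1 - u, u)) = mon (\<lambda>u. f (0, u))"
    and "mon (\<lambda>u. f (u, 0)) * var (\<lambda>u. f (1 - u, u)) - var (\<lambda>u. f (0, u)) + var (\<lambda>u. f (u, 0)) = 0"
proof -
  obtain g L where gL: "log_lift unit_triangle f g L" using log_lift_exists[OF convex_unit_triangle assms] .
  have e: "log_lift {0..1} (\<lambda>u. f (r u)) (\<lambda>u. g (r u)) (\<lambda>u. L (r u))"
    if "continuous_on {0..1} r" "r ` {0..1} \<subseteq> unit_triangle" for r :: "real \<Rightarrow> real \<times> real"
    using log_lift_compose[OF gL that] .
  have 1: "log_lift {0..1} (\<lambda>u. f (u, 0)) (\<lambda>u. g (u, 0)) (\<lambda>u. L (u, 0))"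
    by (rule e) (auto simp: unit_triangle_def intro!: continuous_intros)
  have 2: "log_lift {0..1} (\<lambda>u. f (1 - u, u)) (\<lambda>u. g (1 - u, u)) (\<lambda>u. L (1 - u, u))"
    by (rule e) (auto simp: unit_triangle_def intro!: continuous_intros)
  have 3: "log_lift {0..1} (\<lambda>u. f (0, u)) (\<lambda>u. g (0, u)) (\<lambda>u. L (0, u))"
    by (rule e) (auto simp: unit_triangle_def intro!: continuous_intros)
  show "mon (\<lambda>u. f (u, 0)) * mon (\<lambda>u. f (1 - u, u)) = mon (\<lambda>u. f (0, u))"
    by (simp add: mon_eq[OF 1] mon_eq[OF 2] mon_eq[OF 3] mult.assoc)
  show "mon (\<lambda>u. f (u, 0)) * var (\<lambda>u. f (1 - u, u)) - var (\<lambda>u. f (0, u)) + var (\<lambda>u. f (u, 0)) = 0"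
    by (simp add: mon_eq[OF 1] var_eq[OF 1] var_eq[OF 2] var_eq[OF 3] mult.assoc algebra_simps)
qed

lemma mon_cong: "(\<And>t. t \<in> {0..1} \<Longrightarrow> \<gamma> t = \<delta> t) \<Longrightarrow> mon \<gamma> = mon \<delta>"
  and var_cong: "(\<And>t. t \<in> {0..1} \<Longrightarrow> \<gamma> t = \<delta> t) \<Longrightarrow> var \<gamma> = var \<delta>"
proof -
  assume eq: "\<And>t. t \<in> {0..1} \<Longrightarrow> \<gamma> t = \<delta> t"
  have "log_lift {0..1} \<gamma> = log_lift {0..1} \<delta>"
    unfolding log_lift_def lift_on_def fun_eq_iff using eq by simp
  then show "mon \<gamma> = mon \<delta>" "var \<gamma> = var \<delta>" by (simp_all add: mon_def var_def)
qed

text \<open>The affine map of the triangle onto [0, 1] that sends the vertices 0, 1, 2 to 0, 1/2, 1,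
  followed by the joined path, is a triangle whose edges are \<gamma>, \<delta> and their
  join.\<close>

lemma join_relations:
  assumes "path \<gamma>" "path_image \<gamma> \<subseteq> X" "path \<delta>" "path_image \<delta> \<subseteq> X" "pathfinish \<gamma> = pathstart \<delta>"
  shows "mon (\<gamma> +++ \<delta>) = mon \<gamma> * mon \<delta>" "var (\<gamma> +++ \<delta>) = var \<gamma> + mon \<gamma> * var \<delta>"
proof -
  define f where "f = (\<lambda>z::real\<times>real. (\<gamma> +++ \<delta>) (fst z / 2 + snd z))"
  have "continuous_on unit_triangle f" unfolding f_def
    by (rule continuous_on_compose2[of "{0..1}" "\<gamma> +++ \<delta>"])
      (use assms path_join_imp in \<open>auto simp: path_def[symmetric] unit_triangle_def intro!: continuous_intros\<close>)
  moreover have "f ` unit_triangle \<subseteq> X"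
  proof -
    have "f ` unit_triangle \<subseteq> path_image (\<gamma> +++ \<delta>)"
      unfolding path_image_def f_def by (auto simp: unit_triangle_def)
    then show ?thesis using assms by (auto simp: path_image_join)
  qed
  ultimately have T: "mon (\<lambda>u. f (u, 0)) * mon (\<lambda>u. f (1 - u, u)) = mon (\<lambda>u. f (0, u))"
    "mon (\<lambda>u. f (u, 0)) * var (\<lambda>u. f (1 - u, u)) - var (\<lambda>u. f (0, u)) + var (\<lambda>u. f (u, 0)) = 0"
    by (rule triangle_relations)+
  have 1: "f (t, 0) = \<gamma> t" if "t \<in> {0..1}" for t using that by (simp add: f_def joinpaths_def)
  have 2: "f (1 - t, t) = \<delta> t" if "t \<in> {0..1}" for t
  \<comment> \<open>At the parameter 1/2 \<open>joinpaths\<close> follows the first path, so the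
    beginning of \<delta> is reached through the common endpoint.\<close>
  proof (cases "t = 0")
    case True
    then show ?thesis using assms(5) by (simp add: f_def joinpaths_def pathfinish_def pathstart_def)
  next
    case False
    then have a: "((1 - t) / 2 + t \<le> 1 / 2) = False" "2 * ((1 - t) / 2 + t) - 1 = t"
      using that by (auto simp: field_simps)
    show ?thesis by (simp only: f_def joinpaths_def fst_conv snd_conv a if_False)
  qed
  have 3: "f (0, t) = (\<gamma> +++ \<delta>) t" for t by (simp add: f_def)
  have c: "mon (\<lambda>t. f (t, 0)) = mon \<gamma>" "mon (\<lambda>t. f (1 - t, t)) = mon \<delta>"
    by (rule mon_cong, erule 1 2)+
  have d: "var (\<lambda>t. f (t, 0)) = var \<gamma>" "var (\<lambda>t. f (1 - t, t)) = var \<delta>"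
    by (rule var_cong, erule 1 2)+
  show "mon (\<gamma> +++ \<delta>) = mon \<gamma> * mon \<delta>" "var (\<gamma> +++ \<delta>) = var \<gamma> + mon \<gamma> * var \<delta>"
    using T unfolding 3 c d by (simp_all add: algebra_simps)
qed

lemma mon_const: "p \<in> X \<Longrightarrow> mon (\<lambda>_. p) = 1" and var_const: "p \<in> X \<Longrightarrow> var (\<lambda>_. p) = 0"
proof -
  assume "p \<in> X"
  then have r: "rep p \<in> Y" "pt (rep p) = p" using rep by auto
  have "log_lift {0..1} (\<lambda>_. p) (\<lambda>_. rep p) (\<lambda>_. Ln (h (rep p)))"
    using r h_nz[OF r(1)] by (auto simp: log_lift_def lift_on_def)
  from mon_eq[OF this] var_eq[OF this] show "mon (\<lambda>_. p) = 1" "var (\<lambda>_. p) = 0" by simp_all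
qed

lemma reverse_relations:
  assumes "path \<gamma>" "path_image \<gamma> \<subseteq> X"
  shows "mon (reversepath \<gamma>) = mon \<gamma>" "var (reversepath \<gamma>) = - (mon \<gamma> * var \<gamma>)"
proof -
  obtain g L where gL: "log_lift {0..1} \<gamma> g L" using log_lift_path[OF assms] .
  have "log_lift {0..1} (\<lambda>x. \<gamma> (1 - x)) (\<lambda>x. g (1 - x)) (\<lambda>x. L (1 - x))"
    by (rule log_lift_compose[OF gL]) (auto intro!: continuous_intros)
  then have "log_lift {0..1} (reversepath \<gamma>) (\<lambda>x. g (1 - x)) (\<lambda>x. L (1 - x))"
    by (simp add: reversepath_def)
  note e = mon_eq[OF this] var_eq[OF this] mon_eq[OF gL] var_eq[OF gL]
  show "mon (reversepath \<gamma>) = mon \<gamma>" by (simp add: e)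
  show "var (reversepath \<gamma>) = - (mon \<gamma> * var \<gamma>)"
    using sheet_square(1)[of "g 0"] unfolding e by (simp add: algebra_simps)
qed

text \<open>The homotopy lifts over the square together with a logarithm. On the two sides where it
  is constant the lift covers a constant path, which has monodromy 1 and variation 0, so sheet and
  logarithm at the ends agree for both paths.\<close>

lemma homotopy_invariance:
  assumes "homotopic_paths X p q" shows "mon p = mon q" "var p = var q"
proof -
  obtain H where H: "continuous_on ({0..1} \<times> {0..1::real}) H" "H \<in> ({0..1} \<times> {0..1}) \<rightarrow> X"
    "\<And>x. x \<in> {0..1::real} \<Longrightarrow> H (0, x) = p x" "\<And>x. x \<in> {0..1} \<Longrightarrow> H (1, x) = q x"
    "\<And>t. t \<in> {0..1::real} \<Longrightarrow> pathstart (H \<circ> Pair t) = pathstart p \<and> pathfinish (H \<circ> Pair t) = pathfinish p"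
    using assms unfolding homotopic_paths by blast
  let ?D = "{0..1::real} \<times> {0..1::real}"
  have "convex ?D" by (intro convex_Times) auto
  moreover have HX: "H ` ?D \<subseteq> X" using H(2) by blast
  ultimately obtain g L where gL: "log_lift ?D H g L" using log_lift_exists H(1) by blast
  have e: "log_lift {0..1} (\<lambda>u. H (r u)) (\<lambda>u. g (r u)) (\<lambda>u. L (r u))"
    if "continuous_on {0..1} r" "r ` {0..1} \<subseteq> ?D" for r :: "real \<Rightarrow> real \<times> real"
    using log_lift_compose[OF gL that] .
  have "log_lift {0..1} (\<lambda>u. H (0, u)) (\<lambda>u. g (0, u)) (\<lambda>u. L (0, u))"
    by (rule e) (auto intro!: continuous_intros)
  then have 1: "log_lift {0..1} p (\<lambda>u. g (0, u)) (\<lambda>u. L (0, u))"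
    by (rule log_lift_cong) (rule H(3))
  have "log_lift {0..1} (\<lambda>u. H (1, u)) (\<lambda>u. g (1, u)) (\<lambda>u. L (1, u))"
    by (rule e) (auto intro!: continuous_intros)
  then have 2: "log_lift {0..1} q (\<lambda>u. g (1, u)) (\<lambda>u. L (1, u))"
    by (rule log_lift_cong) (rule H(4))
  have side: "sheet (g (0, x)) = sheet (g (1, x)) \<and> L (0, x) = L (1, x)" if x: "x = 0 \<or> x = 1" for x
  proof -
    have c: "H (u, x) = H (0, x)" if "u \<in> {0..1}" for u
      using H(5)[OF that] H(5)[of 0] x by (auto simp: pathstart_def pathfinish_def)
    have "log_lift {0..1} (\<lambda>u. H (u, x)) (\<lambda>u. g (u, x)) (\<lambda>u. L (u, x))"
      by (rule e) (use x in \<open>auto intro!: continuous_intros\<close>)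
    then have 3: "log_lift {0..1} (\<lambda>u. H (0, x)) (\<lambda>u. g (u, x)) (\<lambda>u. L (u, x))"
      by (rule log_lift_cong) (rule c)
    have "H (0, x) \<in> X" using HX x by auto
    then have "sheet (g (0, x)) * sheet (g (1, x)) = 1" "sheet (g (0, x)) * (L (1, x) - L (0, x)) = 0"
      using mon_eq[OF 3] var_eq[OF 3] mon_const var_const by simp_all
    then show ?thesis using sheet_cases[of "g (0, x)"] sheet_cases[of "g (1, x)"] by auto
  qed
  show "mon p = mon q" "var p = var q"
    using mon_eq[OF 1] var_eq[OF 1] mon_eq[OF 2] var_eq[OF 2] side[of 0] side[of 1] by simp_all
qed

text \<open>Since \<open>mon \<delta>\<close> squares to 1, it cancels in the monodromy. If moreover
  \<open>mon \<gamma>\<close> is 1, the variations along \<delta> and its reverse cancel and only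
  the sign \<open>mon \<delta>\<close> is left.\<close>

lemma conjugate_relations:
  assumes "path \<delta>" "path_image \<delta> \<subseteq> X" "path \<gamma>" "path_image \<gamma> \<subseteq> X"
    "pathstart \<gamma> = pathfinish \<delta>" "pathfinish \<gamma> = pathfinish \<delta>"
  shows "mon (\<delta> +++ (\<gamma> +++ reversepath \<delta>)) = mon \<gamma>"
    "mon \<gamma> = 1 \<Longrightarrow> var (\<delta> +++ (\<gamma> +++ reversepath \<delta>)) = mon \<delta> * var \<gamma>"
proof -
  have s: "mon \<delta> = 1 \<or> mon \<delta> = - 1" by (rule mon_cases[OF assms(1,2)])
  have r: "path (reversepath \<delta>)" "path_image (reversepath \<delta>) \<subseteq> X"
    "pathfinish \<gamma> = pathstart (reversepath \<delta>)"
    using assms by simp_all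
  have gr: "path (\<gamma> +++ reversepath \<delta>)" "path_image (\<gamma> +++ reversepath \<delta>) \<subseteq> X"
    "pathfinish \<delta> = pathstart (\<gamma> +++ reversepath \<delta>)"
    using assms r by (simp_all add: subset_path_image_join)
  note 1 = join_relations[OF assms(3,4) r, unfolded reverse_relations[OF assms(1,2)]]
  note 2 = join_relations[OF assms(1,2) gr]
  show "mon (\<delta> +++ (\<gamma> +++ reversepath \<delta>)) = mon \<gamma>" using s unfolding 1 2 by auto
  show "var (\<delta> +++ (\<gamma> +++ reversepath \<delta>)) = mon \<delta> * var \<gamma>" if "mon \<gamma> = 1"
    using s that unfolding 1 2 by auto
qed

section \<open>The character and the crossed homomorphism on the fundamental group\<close>

definition character :: "(real \<Rightarrow> proj) set \<Rightarrow> complex" where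
  "character A = mon (SOME \<gamma>. \<gamma> \<in> A)"

definition crossed :: "(real \<Rightarrow> proj) set \<Rightarrow> complex" where
  "crossed A = var (SOME \<gamma>. \<gamma> \<in> A)"

lemma character_class: "\<gamma> \<in> loops X b \<Longrightarrow> character (path_class X \<gamma>) = mon \<gamma>"
  and crossed_class: "\<gamma> \<in> loops X b \<Longrightarrow> crossed (path_class X \<gamma>) = var \<gamma>"
proof -
  assume "\<gamma> \<in> loops X b"
  then have "(SOME \<delta>. \<delta> \<in> path_class X \<gamma>) \<in> path_class X \<gamma>"
    using path_class_self by (metis someI)
  then have "homotopic_paths X \<gamma> (SOME \<delta>. \<delta> \<in> path_class X \<gamma>)" by (simp add: mem_path_class_iff)
  from homotopy_invariance[OF this]
  show "character (path_class X \<gamma>) = mon \<gamma>" "crossed (path_class X \<gamma>) = var \<gamma>"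
    by (simp_all add: character_def crossed_def)
qed

lemma character_mult:
  assumes "x \<in> carrier (pi1 X b)" "y \<in> carrier (pi1 X b)"
  shows "character (x \<otimes>\<^bsub>pi1 X b\<^esub> y) = character x * character y"
    "crossed (x \<otimes>\<^bsub>pi1 X b\<^esub> y) = crossed x + character x * crossed y"
proof -
  obtain p q where l: "p \<in> loops X b" "q \<in> loops X b" "x = path_class X p" "y = path_class X q"
    using assms by (auto simp: carrier_pi1)
  have j: "mon (p +++ q) = mon p * mon q" "var (p +++ q) = var p + mon p * var q"
    using join_relations[of p q] l by (auto simp: loopsD)
  note lj = loops_join[OF l(1,2)]
  show "character (x \<otimes>\<^bsub>pi1 X b\<^esub> y) = character x * character y"
    "crossed (x \<otimes>\<^bsub>pi1 X b\<^esub> y) = crossed x + character x * crossed y"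
    unfolding l(3,4) mult_pi1[OF l(1,2)] character_class[OF lj] crossed_class[OF lj]
      character_class[OF l(1)] character_class[OF l(2)] crossed_class[OF l(1)] crossed_class[OF l(2)] j
    by simp_all
qed

lemma character_cases:
  assumes "x \<in> carrier (pi1 X b)" shows "character x = 1 \<or> character x = - 1"
proof -
  obtain p where l: "p \<in> loops X b" "x = path_class X p" using assms by (auto simp: carrier_pi1)
  then show ?thesis using character_class[OF l(1)] mon_cases[of p] by (simp add: loopsD)
qed

lemma character_one: "b \<in> X \<Longrightarrow> character \<one>\<^bsub>pi1 X b\<^esub> = 1" "b \<in> X \<Longrightarrow> crossed \<one>\<^bsub>pi1 X b\<^esub> = 0"
  using character_class[OF loops_const] crossed_class[OF loops_const] mon_const var_const
  by (simp_all add: one_pi1)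

lemma character_hom: "character \<in> hom (pi1 X b) complex_units"
proof (rule homI)
  fix x y assume xy: "x \<in> carrier (pi1 X b)" "y \<in> carrier (pi1 X b)"
  then show "character (x \<otimes>\<^bsub>pi1 X b\<^esub> y) = character x \<otimes>\<^bsub>complex_units\<^esub> character y"
    by (simp add: character_mult complex_units_def)
  show "character x \<in> carrier complex_units" using character_cases[OF xy(1)] by (auto simp: complex_units_def)
qed

text \<open>Explicit loops are written down where formulas are easy. Conjugation with a path from
  \<open>b\<close> keeps the monodromy and, when that is 1, changes the variation at most by a sign,
  so a non-zero variation stays non-zero.\<close>

lemma based_loop_exists:
  assumes "path_connected X" "b \<in> X" "lift {0..1} \<gamma> g" "pathfinish \<gamma> = pathstart \<gamma>"
  obtains \<delta> where "\<delta> \<in> loops X b" "mon \<delta> = mon \<gamma>" "mon \<gamma> = 1 \<longrightarrow> var \<delta> = var \<gamma> \<or> var \<delta> = - var \<gamma>"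
proof -
  have "continuous_on {0..1} (\<lambda>t. pt (g t))"
    by (rule continuous_on_pt_compose)
      (use assms(3) in \<open>auto simp: lift_on_def unit_quadric_def intro: hvec_nonzero[of _ N]\<close>)
  then have "path \<gamma>" unfolding path_def
    by (rule continuous_on_eq) (use assms(3) in \<open>auto simp: lift_on_def\<close>)
  moreover have im: "path_image \<gamma> \<subseteq> X"
    using assms(3) by (auto simp: lift_on_def path_image_def unit_quadric_def)
  moreover have "pathstart \<gamma> \<in> X" using im pathstart_in_path_image by blast
  then obtain \<delta> where \<delta>: "path \<delta>" "path_image \<delta> \<subseteq> X" "pathstart \<delta> = b" "pathfinish \<delta> = pathstart \<gamma>"
    using assms(1,2) unfolding path_connected_def by blast
  ultimately have "\<delta> +++ (\<gamma> +++ reversepath \<delta>) \<in> loops X b"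
    "mon (\<delta> +++ (\<gamma> +++ reversepath \<delta>)) = mon \<gamma>"
    "mon \<gamma> = 1 \<Longrightarrow> var (\<delta> +++ (\<gamma> +++ reversepath \<delta>)) = mon \<delta> * var \<gamma>"
    using conjugate_relations[of \<delta> \<gamma>] assms(4) by (auto simp: loops_def path_image_join)
  then show ?thesis using that[of "\<delta> +++ (\<gamma> +++ reversepath \<delta>)"] mon_cases[OF \<delta>(1,2)] by auto
qed

end


section \<open>Local systems and depth\<close>

lemma singular_simplex_top_of_set:
  "singular_simplex p (top_of_set X) \<sigma> \<longleftrightarrow>
     continuous_on (standard_simplex p) \<sigma> \<and> \<sigma> ` standard_simplex p \<subseteq> X \<and> \<sigma> \<in> extensional (standard_simplex p)"
  unfolding singular_simplex_def euclidean_product_topology continuous_map_in_subtopology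
  by (auto simp: image_subset_iff_funcset)

definition edge_point :: "real \<Rightarrow> nat \<Rightarrow> real" where
  "edge_point t = (\<lambda>i. if i = 0 then 1 - t else if i = 1 then t else 0)"

definition triangle_point :: "real \<times> real \<Rightarrow> nat \<Rightarrow> real" where
  "triangle_point z = (\<lambda>i. if i = 0 then 1 - fst z - snd z else if i = 1 then fst z else if i = 2 then snd z else 0)"

lemma edge_point_in: "t \<in> {0..1} \<Longrightarrow> edge_point t \<in> standard_simplex 1"
  by (auto simp: edge_point_def standard_simplex_def)

lemma standard_simplex_1D:
  assumes "x \<in> standard_simplex 1"
  shows "0 \<le> x 1" "x 1 \<le> 1" "x 0 = 1 - x 1" "x = edge_point (x 1)"
proof -
  show "0 \<le> x 1" "x 1 \<le> 1" using assms by (auto simp: standard_simplex_def)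
  show x0: "x 0 = 1 - x 1" using assms by (simp add: standard_simplex_def)
  show "x = edge_point (x 1)"
  proof
    fix i show "x i = edge_point (x 1) i"
      using assms x0 by (cases "i = 0"; cases "i = 1") (auto simp: edge_point_def standard_simplex_def)
  qed
qed

lemma triangle_point_in: "z \<in> unit_triangle \<Longrightarrow> triangle_point z \<in> standard_simplex 2"
  by (auto simp: unit_triangle_def triangle_point_def standard_simplex_def numeral_2_eq_2)

lemma continuous_edge_point: "continuous_on A edge_point"
proof (rule continuous_on_coordinatewise_then_product)
  fix i show "continuous_on A (\<lambda>t. edge_point t i)"
    unfolding edge_point_def by (cases "i = 0"; cases "i = 1") (auto intro!: continuous_intros)
qed

lemma continuous_triangle_point: "continuous_on A triangle_point"
proof (rule continuous_on_coordinatewise_then_product)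
  fix i show "continuous_on A (\<lambda>t. triangle_point t i)"
    unfolding triangle_point_def
    by (cases "i = 0"; cases "i = 1"; cases "i = 2") (auto intro!: continuous_intros)
qed

definition simplex_path :: "((nat \<Rightarrow> real) \<Rightarrow> 'a) \<Rightarrow> real \<Rightarrow> 'a" where
  "simplex_path \<sigma> = (\<lambda>t. \<sigma> (edge_point t))"

lemma simplex_path:
  assumes "singular_simplex 1 (top_of_set X) \<sigma>"
  shows "path (simplex_path \<sigma>)" "path_image (simplex_path \<sigma>) \<subseteq> X" "path_simplex (simplex_path \<sigma>) = \<sigma>"
    "pathstart (simplex_path \<sigma>) = \<sigma> (vertex 0)" "pathfinish (simplex_path \<sigma>) = \<sigma> (vertex 1)"
proof -
  have s: "continuous_on (standard_simplex 1) \<sigma>" "\<sigma> ` standard_simplex 1 \<subseteq> X" "\<sigma> \<in> extensional (standard_simplex 1)"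
    using assms by (auto simp: singular_simplex_top_of_set)
  show "path (simplex_path \<sigma>)" unfolding path_def simplex_path_def
    by (rule continuous_on_compose2[OF s(1) continuous_edge_point]) (use edge_point_in in blast)
  show "path_image (simplex_path \<sigma>) \<subseteq> X"
    using s(2) edge_point_in unfolding path_image_def simplex_path_def by blast
  show "path_simplex (simplex_path \<sigma>) = \<sigma>"
  proof
    fix x show "path_simplex (simplex_path \<sigma>) x = \<sigma> x"
    proof (cases "x \<in> standard_simplex 1")
      case True
      then show ?thesis using standard_simplex_1D(4)[OF True] by (simp add: path_simplex_def simplex_path_def)
    next
      case False
      then show ?thesis using s(3) by (simp add: path_simplex_def extensional_def)
    qed
  qed
  have "edge_point 0 = vertex 0" "edge_point 1 = vertex 1" by (auto simp: edge_point_def vertex_def)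
  then show "pathstart (simplex_path \<sigma>) = \<sigma> (vertex 0)" "pathfinish (simplex_path \<sigma>) = \<sigma> (vertex 1)"
    by (simp_all add: simplex_path_def pathstart_def pathfinish_def)
qed

lemma simplex_path_path_simplex: "t \<in> {0..1} \<Longrightarrow> simplex_path (path_simplex \<gamma>) t = \<gamma> t"
  using edge_point_in by (simp add: simplex_path_def path_simplex_def edge_point_def)

lemma singular_path_simplex:
  assumes "path \<gamma>" "path_image \<gamma> \<subseteq> X"
  shows "singular_simplex 1 (top_of_set X) (path_simplex \<gamma>)"
proof -
  have r: "(\<lambda>x. x 1) ` standard_simplex 1 \<subseteq> {0..1::real}" by (auto simp: standard_simplex_def)
  have c: "continuous_on (standard_simplex 1) (\<lambda>x. x (1::nat))"
    by (rule continuous_on_subset[OF continuous_on_product_coordinates]) simp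
  have "continuous_on (standard_simplex 1) (\<lambda>x. \<gamma> (x 1))"
    using assms(1) r by (intro continuous_on_compose2[OF _ c, of "{0..1}"]) (auto simp: path_def)
  then show ?thesis
    using assms(2) r unfolding singular_simplex_top_of_set path_simplex_def path_image_def
    by (auto simp: image_subset_iff cong: continuous_on_cong)
qed

lemma vertex_in_standard_simplex: "i \<le> p \<Longrightarrow> vertex i \<in> standard_simplex p"
  by (auto simp: standard_simplex_def vertex_def)

lemma simplical_face_vertex: "simplical_face k (vertex i) = vertex (if i < k then i else Suc i)"
  by (auto simp: simplical_face_def vertex_def fun_eq_iff)

lemma face_vertices:
  "singular_face 2 2 \<tau> (vertex 0) = \<tau> (vertex 0)" "singular_face 2 2 \<tau> (vertex 1) = \<tau> (vertex 1)"
  "singular_face 2 1 \<tau> (vertex 0) = \<tau> (vertex 0)" "singular_face 2 0 \<tau> (vertex 0) = \<tau> (vertex 1)"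
proof -
  have v: "vertex 0 \<in> standard_simplex (2 - Suc 0)" "vertex 1 \<in> standard_simplex (2 - Suc 0)"
    by (rule vertex_in_standard_simplex, simp)+
  show "singular_face 2 2 \<tau> (vertex 0) = \<tau> (vertex 0)" "singular_face 2 2 \<tau> (vertex 1) = \<tau> (vertex 1)"
    "singular_face 2 1 \<tau> (vertex 0) = \<tau> (vertex 0)" "singular_face 2 0 \<tau> (vertex 0) = \<tau> (vertex 1)"
    unfolding singular_face_def restrict_apply' [OF v(1)] restrict_apply' [OF v(2)] o_def simplical_face_vertex
    by simp_all
qed

lemma ext_nat3:
  fixes f g :: "nat \<Rightarrow> 'a"
  assumes "f 0 = g 0" "f 1 = g 1" "f 2 = g 2" "\<And>i. i > 2 \<Longrightarrow> f i = g i"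
  shows "f = g"
proof (rule ext)
  fix i :: nat
  consider "i = 0" | "i = 1" | "i = 2" | "i > 2" by linarith
  then show "f i = g i" by cases (use assms in simp_all)
qed

lemma simplical_face_edge_point:
  "simplical_face 2 (edge_point t) = triangle_point (t, 0)"
  "simplical_face 0 (edge_point t) = triangle_point (1 - t, t)"
  "simplical_face 1 (edge_point t) = triangle_point (0, t)"
  by (rule ext_nat3; simp add: simplical_face_def edge_point_def triangle_point_def)+

lemma face_simplex_path:
  assumes "t \<in> {0..1}"
  shows "simplex_path (singular_face 2 2 \<tau>) t = \<tau> (triangle_point (t, 0))"
    "simplex_path (singular_face 2 0 \<tau>) t = \<tau> (triangle_point (1 - t, t))"
    "simplex_path (singular_face 2 1 \<tau>) t = \<tau> (triangle_point (0, t))"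
proof -
  have e: "edge_point t \<in> standard_simplex (2 - Suc 0)" using edge_point_in[OF assms] by simp
  show "simplex_path (singular_face 2 2 \<tau>) t = \<tau> (triangle_point (t, 0))"
    "simplex_path (singular_face 2 0 \<tau>) t = \<tau> (triangle_point (1 - t, t))"
    "simplex_path (singular_face 2 1 \<tau>) t = \<tau> (triangle_point (0, t))"
    unfolding simplex_path_def singular_face_def restrict_apply'[OF e] o_def simplical_face_edge_point by simp_all
qed

text \<open>For an arbitrary local system the same triangle as in \<open>join_relations\<close> is
  used, now as a singular 2-simplex: the simplex is collapsed onto [0, 1] with its vertices going to
  0, 1/2, 1.\<close>

lemma local_system_join:
  assumes L: "local_system (top_of_set X) L"
    and p: "path \<gamma>" "path_image \<gamma> \<subseteq> X" "path \<delta>" "path_image \<delta> \<subseteq> X" "pathfinish \<gamma> = pathstart \<delta>"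
  shows "L (path_simplex (\<gamma> +++ \<delta>)) = L (path_simplex \<gamma>) * L (path_simplex \<delta>)"
proof -
  define \<tau> where "\<tau> = restrict (\<lambda>x. (\<gamma> +++ \<delta>) (x 1 / 2 + x 2)) (standard_simplex 2)"
  have r: "x 1 / 2 + x 2 \<in> {0..1}" if "x \<in> standard_simplex 2" for x
  proof -
    have "x 0 + x 1 + x 2 = 1" "0 \<le> x 0" "0 \<le> x 1" "0 \<le> x 2"
      using that by (auto simp: standard_simplex_def numeral_2_eq_2)
    then show ?thesis by simp
  qed
  have c: "continuous_on (standard_simplex 2) (\<lambda>x. x i)" for i :: nat
    by (rule continuous_on_subset[OF continuous_on_product_coordinates]) simp
  have pj: "path (\<gamma> +++ \<delta>)" using p by (simp add: path_join_imp)
  have c0: "continuous_on (standard_simplex 2) (\<lambda>x. (\<gamma> +++ \<delta>) (x 1 / 2 + x 2))"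
  proof (rule continuous_on_compose2[of "{0..1}" "\<gamma> +++ \<delta>"])
    show "continuous_on (standard_simplex 2) (\<lambda>x::nat \<Rightarrow> real. x 1 / 2 + x 2)"
      by (intro continuous_on_add continuous_on_divide continuous_on_const c) simp
    show "(\<lambda>x. x 1 / 2 + x 2) ` standard_simplex 2 \<subseteq> {0..1}" by (rule image_subsetI) (rule r)
  qed (use pj in \<open>simp add: path_def\<close>)
  have eq: "\<tau> x = (\<gamma> +++ \<delta>) (x 1 / 2 + x 2)" if "x \<in> standard_simplex 2" for x
    unfolding \<tau>_def by (rule restrict_apply'[OF that])
  have im: "\<tau> x \<in> X" if "x \<in> standard_simplex 2" for x
  proof (rule subsetD[OF subset_path_image_join[OF p(2,4)]])
    show "\<tau> x \<in> path_image (\<gamma> +++ \<delta>)"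
      unfolding path_image_def eq[OF that] by (rule imageI[OF r[OF that]])
  qed
  have "singular_simplex 2 (top_of_set X) \<tau>"
    unfolding singular_simplex_top_of_set
  proof (intro conjI image_subsetI im)
    show "continuous_on (standard_simplex 2) \<tau>"
      by (rule iffD2[OF continuous_on_cong[OF refl eq] c0])
    show "\<tau> \<in> extensional (standard_simplex 2)" unfolding \<tau>_def by (rule restrict_extensional)
  qed
  then have "L (singular_face 2 2 \<tau>) * L (singular_face 2 0 \<tau>) = L (singular_face 2 1 \<tau>)"
    using L by (simp add: local_system_def)
  moreover have "singular_face 2 k \<tau> = path_simplex \<epsilon>"
    if "k \<le> 2" "\<And>x. x \<in> standard_simplex 1 \<Longrightarrow>
        (\<gamma> +++ \<delta>) (simplical_face k x 1 / 2 + simplical_face k x 2) = \<epsilon> (x 1)" for k \<epsilon>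
  proof
    fix x
    show "singular_face 2 k \<tau> x = path_simplex \<epsilon> x"
    proof (cases "x \<in> standard_simplex 1")
      case True
      then have x: "x \<in> standard_simplex (2 - Suc 0)" by simp
      then have y: "simplical_face k x \<in> standard_simplex 2"
        using that(1) by (intro simplical_face_in_standard_simplex) simp_all
      show ?thesis
        unfolding singular_face_def path_simplex_def \<tau>_def restrict_apply'[OF x] restrict_apply'[OF True] o_def
          restrict_apply'[OF y] by (rule that(2)[OF True])
    next
      case False
      then have "x \<notin> standard_simplex (2 - Suc 0)" by simp
      then show ?thesis using False by (simp only: singular_face_def path_simplex_def restrict_def if_False)
    qed
  qed
  note face = this
  have "singular_face 2 2 \<tau> = path_simplex \<gamma>"
    by (rule face) (simp_all add: simplical_face_def joinpaths_def standard_simplex_1D[unfolded One_nat_def])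
  moreover have "singular_face 2 1 \<tau> = path_simplex (\<gamma> +++ \<delta>)"
    by (rule face) (simp_all add: simplical_face_def)
  moreover have "singular_face 2 0 \<tau> = path_simplex \<delta>"
  proof (rule face)
    fix x :: "nat \<Rightarrow> real" assume x: "x \<in> standard_simplex 1"
    have "(\<gamma> +++ \<delta>) ((1 - t) / 2 + t) = \<delta> t" if "0 \<le> t" for t
    proof (cases "t = 0")
      case True
      then show ?thesis using p(5) by (simp add: joinpaths_def pathfinish_def pathstart_def)
    next
      case False
      then have a: "((1 - t) / 2 + t \<le> 1 / 2) = False" "2 * ((1 - t) / 2 + t) - 1 = t"
        using that by (auto simp: field_simps)
      show ?thesis by (simp only: joinpaths_def a if_False)
    qed
    then show "(\<gamma> +++ \<delta>) (simplical_face 0 x 1 / 2 + simplical_face 0 x 2) = \<delta> (x 1)"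
      using standard_simplex_1D[OF x] by (simp add: simplical_face_def)
  qed simp
  ultimately show ?thesis by simp
qed

lemma local_system_nz:
  "local_system (top_of_set X) L \<Longrightarrow> path \<gamma> \<Longrightarrow> path_image \<gamma> \<subseteq> X \<Longrightarrow> L (path_simplex \<gamma>) \<noteq> 0"
  using singular_path_simplex[of \<gamma> X] by (auto simp: local_system_def)

text \<open>Dividing both systems, one gets a system \<open>M\<close> without monodromy; its transport from the base
  point is the isomorphism.\<close>
lemma local_system_isomorphic:
  assumes X: "path_connected X" "b \<in> X"
    and L: "local_system (top_of_set X) L" "local_system (top_of_set X) L'"
    and loops: "\<And>\<gamma>. \<gamma> \<in> loops X b \<Longrightarrow> L (path_simplex \<gamma>) = L' (path_simplex \<gamma>)"
  obtains g where "\<And>p. p \<in> X \<Longrightarrow> g p \<noteq> 0"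
    "\<And>\<sigma>. singular_simplex 1 (top_of_set X) \<sigma> \<Longrightarrow> L \<sigma> = L' \<sigma> * g (\<sigma> (vertex 1)) / g (\<sigma> (vertex 0))"
proof -
  define M where "M = (\<lambda>\<gamma>. L (path_simplex \<gamma>) / L' (path_simplex \<gamma>))"
  have nz: "L (path_simplex \<gamma>) \<noteq> 0" "L' (path_simplex \<gamma>) \<noteq> 0" if "path \<gamma>" "path_image \<gamma> \<subseteq> X" for \<gamma>
    using local_system_nz[OF L(1) that] local_system_nz[OF L(2) that] by auto
  have Mj: "M (\<gamma> +++ \<delta>) = M \<gamma> * M \<delta>"
    if "path \<gamma>" "path_image \<gamma> \<subseteq> X" "path \<delta>" "path_image \<delta> \<subseteq> X" "pathfinish \<gamma> = pathstart \<delta>" for \<gamma> \<delta>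
    using local_system_join[OF L(1) that] local_system_join[OF L(2) that] by (simp add: M_def)
  have Ml: "M \<gamma> = 1" if "\<gamma> \<in> loops X b" for \<gamma>
    using loops[OF that] nz[of \<gamma>] loopsD[OF that] by (simp add: M_def)
  define \<delta> where "\<delta> = (\<lambda>p. SOME \<gamma>. path \<gamma> \<and> path_image \<gamma> \<subseteq> X \<and> pathstart \<gamma> = b \<and> pathfinish \<gamma> = p)"
  have \<delta>: "path (\<delta> p) \<and> path_image (\<delta> p) \<subseteq> X \<and> pathstart (\<delta> p) = b \<and> pathfinish (\<delta> p) = p" if "p \<in> X" for p
  proof -
    have "\<exists>\<gamma>. path \<gamma> \<and> path_image \<gamma> \<subseteq> X \<and> pathstart \<gamma> = b \<and> pathfinish \<gamma> = p"
      using X that unfolding path_connected_def by blast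
    then show ?thesis unfolding \<delta>_def by (rule someI_ex)
  qed
  have gnz: "M (\<delta> p) \<noteq> 0" if "p \<in> X" for p using nz[of "\<delta> p"] \<delta>[OF that] by (simp add: M_def)
  show thesis
  proof (rule that[of "\<lambda>p. M (\<delta> p)"])
    show "M (\<delta> p) \<noteq> 0" if "p \<in> X" for p by (rule gnz[OF that])
    fix \<sigma> assume s: "singular_simplex 1 (top_of_set X) \<sigma>"
    define \<gamma> where "\<gamma> = simplex_path \<sigma>"
    define p q where "p = \<sigma> (vertex 0)" and "q = \<sigma> (vertex 1)"
    have \<gamma>: "path \<gamma>" "path_image \<gamma> \<subseteq> X" "path_simplex \<gamma> = \<sigma>" "pathstart \<gamma> = p" "pathfinish \<gamma> = q"
      using simplex_path[OF s] by (simp_all add: \<gamma>_def p_def q_def)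
    then have pq: "p \<in> X" "q \<in> X" using pathstart_in_path_image pathfinish_in_path_image by blast+
    note dp = \<delta>[OF pq(1)] and dq = \<delta>[OF pq(2)]
    have j: "path (\<delta> p +++ \<gamma>)" "path_image (\<delta> p +++ \<gamma>) \<subseteq> X" "pathfinish (\<delta> p +++ \<gamma>) = q"
      using dp \<gamma> by (simp_all add: subset_path_image_join)
    \<comment> \<open>This loop at \<open>b\<close>, through p and q, and the loop out to q and back
      below both have M = 1. Comparing the two eliminates the factor of the reversed path and leaves
      M on \<gamma> as a quotient.\<close>
    have "M (\<delta> p) * M \<gamma> * M (reversepath (\<delta> q)) = M ((\<delta> p +++ \<gamma>) +++ reversepath (\<delta> q))"
      using Mj[of "\<delta> p" \<gamma>] Mj[of "\<delta> p +++ \<gamma>" "reversepath (\<delta> q)"] dp dq \<gamma> j by simp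
    also have "\<dots> = 1" using dp dq j by (intro Ml) (simp add: loops_def subset_path_image_join)
    finally have 1: "M (\<delta> p) * M \<gamma> * M (reversepath (\<delta> q)) = 1" .
    have "M (\<delta> q) * M (reversepath (\<delta> q)) = M (\<delta> q +++ reversepath (\<delta> q))"
      using Mj[of "\<delta> q" "reversepath (\<delta> q)"] dq by simp
    also have "\<dots> = 1" using dq by (intro Ml) (simp add: loops_def subset_path_image_join)
    finally have 2: "M (\<delta> q) * M (reversepath (\<delta> q)) = 1" .
    have r: "M (reversepath (\<delta> q)) \<noteq> 0" using 2 by auto
    have "M (\<delta> p) * M \<gamma> * M (reversepath (\<delta> q)) = M (\<delta> q) * M (reversepath (\<delta> q))"
      unfolding 1 2 ..
    then have "M \<gamma> = M (\<delta> q) / M (\<delta> p)" using r gnz[OF pq(1)] by (simp add: field_simps)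
    moreover have "L \<sigma> = L' \<sigma> * M \<gamma>" using nz[OF \<gamma>(1,2)] \<gamma>(3) by (simp add: M_def)
    ultimately show "L \<sigma> = L' \<sigma> * M (\<delta> (\<sigma> (vertex 1))) / M (\<delta> (\<sigma> (vertex 0)))"
      unfolding p_def q_def by simp
  qed
qed

text \<open>Evaluation at x annihilates W but not c, so that c alone is independent modulo W. In
  both applications x is a loop with trivial monodromy: coboundaries vanish there.\<close>

lemma quotient_dim_pos:
  assumes "c \<in> V" "c x \<noteq> 0" "\<And>w. w \<in> W \<Longrightarrow> w x = 0"
  shows "quotient_dim V W > 0"
proof -
  have "a c = 0" if "(\<lambda>x. \<Sum>f\<in>{c}. a f * f x) \<in> W" for a
    using assms(3)[OF that] assms(2) by simp
  then have "{c} \<in> {B. finite B \<and> B \<subseteq> V \<and> (\<forall>a. (\<lambda>x. \<Sum>f\<in>B. a f * f x) \<in> W \<longrightarrow> (\<forall>f\<in>B. a f = 0))}"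
    using assms(1) by simp
  then have "enat (card {c}) \<le> quotient_dim V W"
    unfolding quotient_dim_def by (rule SUP_upper)
  then show ?thesis by (auto simp: zero_enat_def one_enat_def intro: less_le_trans[rotated])
qed

section \<open>Positivity of the depth\<close>

context double_cover
begin

lemma simplex_relations:
  assumes "singular_simplex 2 (top_of_set X) \<tau>"
  shows "mon (simplex_path (singular_face 2 2 \<tau>)) * mon (simplex_path (singular_face 2 0 \<tau>))
      = mon (simplex_path (singular_face 2 1 \<tau>))"
    "mon (simplex_path (singular_face 2 2 \<tau>)) * var (simplex_path (singular_face 2 0 \<tau>))
      - var (simplex_path (singular_face 2 1 \<tau>)) + var (simplex_path (singular_face 2 2 \<tau>)) = 0"
proof -
  define f where "f = (\<lambda>z. \<tau> (triangle_point z))"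
  have s: "continuous_on (standard_simplex 2) \<tau>" "\<tau> ` standard_simplex 2 \<subseteq> X"
    using assms by (auto simp: singular_simplex_top_of_set)
  have "continuous_on unit_triangle f" unfolding f_def
    by (rule continuous_on_compose2[OF s(1) continuous_triangle_point]) (use triangle_point_in in blast)
  moreover have "f ` unit_triangle \<subseteq> X" using s(2) triangle_point_in unfolding f_def by blast
  ultimately have T: "mon (\<lambda>u. f (u, 0)) * mon (\<lambda>u. f (1 - u, u)) = mon (\<lambda>u. f (0, u))"
    "mon (\<lambda>u. f (u, 0)) * var (\<lambda>u. f (1 - u, u)) - var (\<lambda>u. f (0, u)) + var (\<lambda>u. f (u, 0)) = 0"
    by (rule triangle_relations)+
  have m: "mon (simplex_path (singular_face 2 2 \<tau>)) = mon (\<lambda>u. f (u, 0))"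
    "mon (simplex_path (singular_face 2 0 \<tau>)) = mon (\<lambda>u. f (1 - u, u))"
    "mon (simplex_path (singular_face 2 1 \<tau>)) = mon (\<lambda>u. f (0, u))"
    by (rule mon_cong, simp only: f_def face_simplex_path)+
  have v: "var (simplex_path (singular_face 2 2 \<tau>)) = var (\<lambda>u. f (u, 0))"
    "var (simplex_path (singular_face 2 0 \<tau>)) = var (\<lambda>u. f (1 - u, u))"
    "var (simplex_path (singular_face 2 1 \<tau>)) = var (\<lambda>u. f (0, u))"
    by (rule var_cong, simp only: f_def face_simplex_path)+
  show "mon (simplex_path (singular_face 2 2 \<tau>)) * mon (simplex_path (singular_face 2 0 \<tau>))
      = mon (simplex_path (singular_face 2 1 \<tau>))"
    "mon (simplex_path (singular_face 2 2 \<tau>)) * var (simplex_path (singular_face 2 0 \<tau>))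
      - var (simplex_path (singular_face 2 1 \<tau>)) + var (simplex_path (singular_face 2 2 \<tau>)) = 0"
    using T unfolding m v .
qed

lemma mon_local_system: "local_system (top_of_set X) (\<lambda>\<sigma>. mon (simplex_path \<sigma>))"
  unfolding local_system_def
proof (intro conjI allI impI)
  fix \<sigma> :: "(nat \<Rightarrow> real) \<Rightarrow> proj" assume "singular_simplex 1 (top_of_set X) \<sigma>"
  then show "mon (simplex_path \<sigma>) \<noteq> 0" using mon_cases simplex_path(1,2) by fastforce
qed (rule simplex_relations)

lemma mon_path_simplex: "mon (simplex_path (path_simplex \<gamma>)) = mon \<gamma>"
  and var_path_simplex: "var (simplex_path (path_simplex \<gamma>)) = var \<gamma>"
  by (rule mon_cong, erule simplex_path_path_simplex) (rule var_cong, erule simplex_path_path_simplex)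

text \<open>The system L behind \<open>depth\<close> has the same values on loops at
  \<open>b\<close> as the system given by \<open>mon\<close>, so it is isomorphic to it through some
  g, and g transports the cocycle \<open>var\<close>. On the simplex of \<gamma> the result is
  non-zero, while a coboundary takes the value L u(b) - u(b) with L = 1.\<close>

lemma depth_pos:
  assumes X: "path_connected X" "b \<in> X"
    and \<gamma>: "\<gamma> \<in> loops X b" "mon \<gamma> = 1" "var \<gamma> \<noteq> 0"
  shows "depth X b character > 0"
proof -
  let ?P = "\<lambda>L. local_system (top_of_set X) L \<and>
      (\<forall>\<gamma>\<in>loops X b. L (path_simplex \<gamma>) = character (path_class X \<gamma>))"
  define L where "L = (SOME L. ?P L)"
  have "?P (\<lambda>\<sigma>. mon (simplex_path \<sigma>))"
    using mon_local_system character_class by (auto simp: mon_path_simplex)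
  then have "?P L" unfolding L_def by (rule someI[of ?P])
  then have L: "local_system (top_of_set X) L"
    "\<And>\<gamma>. \<gamma> \<in> loops X b \<Longrightarrow> L (path_simplex \<gamma>) = mon (simplex_path (path_simplex \<gamma>))"
    using character_class by (auto simp: mon_path_simplex)
  obtain g where g: "\<And>p. p \<in> X \<Longrightarrow> g p \<noteq> 0"
    "\<And>\<sigma>. singular_simplex 1 (top_of_set X) \<sigma> \<Longrightarrow>
       L \<sigma> = mon (simplex_path \<sigma>) * g (\<sigma> (vertex 1)) / g (\<sigma> (vertex 0))"
    using local_system_isomorphic[OF X L(1) mon_local_system L(2)] by blast
  \<comment> \<open>The value of a cochain lies in the stalk at the vertex 0, which is why g is
    taken at the origin of the simplex.\<close>
  define c where "c = (\<lambda>\<sigma>. if singular_simplex 1 (top_of_set X) \<sigma>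
      then var (simplex_path \<sigma>) / g (\<sigma> (vertex 0)) else 0)"
  have "quotient_dim (twisted_cocycles (top_of_set X) L) (twisted_coboundaries (top_of_set X) L) > 0"
  proof (rule quotient_dim_pos)
    show "c \<in> twisted_cocycles (top_of_set X) L"
      unfolding twisted_cocycles_def
    proof (intro CollectI conjI allI impI)
      fix \<tau> :: "(nat \<Rightarrow> real) \<Rightarrow> proj" assume \<tau>: "singular_simplex 2 (top_of_set X) \<tau>"
      have f: "singular_simplex 1 (top_of_set X) (singular_face 2 k \<tau>)" if "k \<le> 2" for k
        using singular_simplex_singular_face[OF \<tau>, of k] that by simp
      have v: "\<tau> (vertex i) \<in> X" if "i \<le> 2" for i
        using \<tau> vertex_in_standard_simplex[OF that] unfolding singular_simplex_top_of_set by blast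
      define A B E where "A = mon (simplex_path (singular_face 2 2 \<tau>))"
        and "B = var (simplex_path (singular_face 2 0 \<tau>))" and "E = var (simplex_path (singular_face 2 1 \<tau>))"
      define H where "H = var (simplex_path (singular_face 2 2 \<tau>))"
      have "A * B - E + H = 0"
        using simplex_relations(2)[OF \<tau>] by (simp add: A_def B_def E_def H_def)
      moreover have "L (singular_face 2 2 \<tau>) = A * g (\<tau> (vertex 1)) / g (\<tau> (vertex 0))"
        using g(2)[OF f[of 2]] by (simp add: face_vertices[unfolded One_nat_def] A_def)
      moreover have "c (singular_face 2 2 \<tau>) = H / g (\<tau> (vertex 0))" "c (singular_face 2 1 \<tau>) = E / g (\<tau> (vertex 0))"
        "c (singular_face 2 0 \<tau>) = B / g (\<tau> (vertex 1))"
        using f[of 2] f[of 1] f[of 0] by (simp_all add: c_def face_vertices[unfolded One_nat_def] B_def E_def H_def)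
      ultimately show "L (singular_face 2 2 \<tau>) * c (singular_face 2 0 \<tau>)
          - c (singular_face 2 1 \<tau>) + c (singular_face 2 2 \<tau>) = 0"
        using g(1)[OF v[of 0]] g(1)[OF v[of 1]] by (simp add: add_divide_distrib[symmetric] diff_divide_distrib[symmetric])
    qed (simp add: c_def)
    have sp: "singular_simplex 1 (top_of_set X) (path_simplex \<gamma>)"
      using loopsD[OF \<gamma>(1)] by (intro singular_path_simplex)
    have v: "path_simplex \<gamma> (vertex 0) = b" "path_simplex \<gamma> (vertex 1) = b"
      using loopsD[OF \<gamma>(1)] vertex_in_standard_simplex[of 0 1] vertex_in_standard_simplex[of 1 1]
      by (simp_all add: path_simplex_def pathstart_def pathfinish_def) (simp_all add: vertex_def)
    show "c (path_simplex \<gamma>) \<noteq> 0" using sp v g(1)[OF X(2)] \<gamma>(3) by (simp add: c_def var_path_simplex)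
    fix w assume "w \<in> twisted_coboundaries (top_of_set X) L"
    then obtain u where "w (path_simplex \<gamma>) = L (path_simplex \<gamma>) * u b - u b"
      using sp v unfolding twisted_coboundaries_def by auto
    moreover have "L (path_simplex \<gamma>) = 1" using L(2)[OF \<gamma>(1)] \<gamma>(2) by (simp add: mon_path_simplex)
    ultimately show "w (path_simplex \<gamma>) = 0" by simp
  qed
  then show ?thesis unfolding depth_def L_def[symmetric] Let_def .
qed

lemma marking_character:
  assumes "path_connected X" "b \<in> X"
    and "\<gamma> \<in> loops X b" "mon \<gamma> = 1" "var \<gamma> \<noteq> 0" and \<delta>: "\<delta> \<in> loops X b" "mon \<delta> = - 1"
  shows "marking X b character"
proof -
  have "path_class X \<delta> \<in> carrier (pi1 X b)" "character (path_class X \<delta>) \<noteq> 1"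
    using \<delta> character_class by (auto simp: carrier_pi1)
  then show ?thesis
    using depth_pos[OF assms(1-5)] character_hom by (auto simp: marking_def nontrivial_character_def)
qed

end


section \<open>The orbifold fundamental group\<close>

lemma (in group) one_in_normal_closure: "\<one> \<in> normal_closure G S"
  unfolding normal_closure_def using normal_imp_subgroup subgroup.one_closed by blast

lemma normal_closure_least: "H \<lhd> G \<Longrightarrow> S \<subseteq> H \<Longrightarrow> normal_closure G S \<subseteq> H"
  unfolding normal_closure_def by blast

text \<open>The subgroup H shows that the family intersected is non-empty; an empty one would give
  the whole type instead of a subset of the carrier.\<close>

lemma (in group) normal_closure_normal:
  assumes "H \<lhd> G" "S \<subseteq> H" shows "normal_closure G S \<lhd> G"
proof (rule normal_invI)
  have "subgroup K G" if "K \<in> {H. H \<lhd> G \<and> S \<subseteq> H}" for K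
    using that normal_imp_subgroup by blast
  then show "subgroup (normal_closure G S) G"
    unfolding normal_closure_def using assms by (intro subgroups_Inter) blast+
  show "x \<otimes> k \<otimes> inv x \<in> normal_closure G S" if "x \<in> carrier G" "k \<in> normal_closure G S" for x k
    unfolding normal_closure_def
  proof (rule InterI)
    fix K assume K: "K \<in> {H. H \<lhd> G \<and> S \<subseteq> H}"
    then have "k \<in> K" using that(2) unfolding normal_closure_def by blast
    then show "x \<otimes> k \<otimes> inv x \<in> K" using K that(1) normal_invE(2) by blast
  qed
qed

context double_cover
begin

text \<open>The cocycle identity makes this a normal subgroup; it contains all squares of elements on
  which the character is \<open>- 1\<close>.\<close>
definition trivial_part :: "proj \<Rightarrow> (real \<Rightarrow> proj) set set" where
  "trivial_part b = {x \<in> carrier (pi1 X b). character x = 1 \<and> crossed x = 0}"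

lemma trivial_part_normal:
  assumes "b \<in> X" shows "trivial_part b \<lhd> pi1 X b"
proof -
  interpret group "pi1 X b" by (rule group_pi1[OF assms])
  have inv: "character x * character (inv\<^bsub>pi1 X b\<^esub> x) = 1"
    "crossed x + character x * crossed (inv\<^bsub>pi1 X b\<^esub> x) = 0" if "x \<in> carrier (pi1 X b)" for x
    using character_mult[OF that inv_closed[OF that]] character_one[OF assms] r_inv[OF that] by simp_all
  show ?thesis
  proof (rule normal_invI)
    show "subgroup (trivial_part b) (pi1 X b)"
    proof (rule subgroupI)
      show "trivial_part b \<subseteq> carrier (pi1 X b)" by (auto simp: trivial_part_def)
      show "trivial_part b \<noteq> {}" using character_one[OF assms] by (auto simp: trivial_part_def)
      show "inv\<^bsub>pi1 X b\<^esub> x \<in> trivial_part b" if "x \<in> trivial_part b" for x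
        using that inv[of x] by (auto simp: trivial_part_def)
      show "x \<otimes>\<^bsub>pi1 X b\<^esub> y \<in> trivial_part b" if "x \<in> trivial_part b" "y \<in> trivial_part b" for x y
        using that by (auto simp: trivial_part_def character_mult)
    qed
    fix x h assume x: "x \<in> carrier (pi1 X b)" and h: "h \<in> trivial_part b"
    then have hc: "h \<in> carrier (pi1 X b)" "character h = 1" "crossed h = 0" by (auto simp: trivial_part_def)
    note xh = m_closed[OF x hc(1)]
    have "character (x \<otimes>\<^bsub>pi1 X b\<^esub> h \<otimes>\<^bsub>pi1 X b\<^esub> inv\<^bsub>pi1 X b\<^esub> x) = 1"
      "crossed (x \<otimes>\<^bsub>pi1 X b\<^esub> h \<otimes>\<^bsub>pi1 X b\<^esub> inv\<^bsub>pi1 X b\<^esub> x) = 0"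
      using inv[OF x] unfolding character_mult[OF xh inv_closed[OF x]] character_mult[OF x hc(1)] hc by simp_all
    then show "x \<otimes>\<^bsub>pi1 X b\<^esub> h \<otimes>\<^bsub>pi1 X b\<^esub> inv\<^bsub>pi1 X b\<^esub> x \<in> trivial_part b"
      using x hc by (simp add: trivial_part_def)
  qed
qed

lemma square_in_trivial_part:
  assumes "b \<in> X" "\<mu> \<in> loops X b" "mon \<mu> = - 1"
  shows "path_class X \<mu> [^]\<^bsub>pi1 X b\<^esub> (2::nat) \<in> trivial_part b"
proof -
  interpret group "pi1 X b" by (rule group_pi1[OF assms(1)])
  have m: "path_class X \<mu> \<in> carrier (pi1 X b)" using assms(2) by (auto simp: carrier_pi1)
  have "path_class X \<mu> [^]\<^bsub>pi1 X b\<^esub> (2::nat) = path_class X \<mu> \<otimes>\<^bsub>pi1 X b\<^esub> path_class X \<mu>"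
    using m by (simp add: numeral_2_eq_2)
  then show ?thesis
    using m assms(3) character_mult[OF m m] character_class[OF assms(2)] by (simp add: trivial_part_def)
qed

end

text \<open>All orbifold labels are to be 2 and all meridians of orbifold points to have monodromy
  -1. The relations are then generated by squares on which the character is 1 and the crossed
  homomorphism is 0.\<close>

locale orbifold_cover = double_cover N F X h for N F X h +
  fixes \<nu> :: labels and b :: proj
  assumes X_regular: "regular_part \<nu> = X" and b: "b \<in> X"
    and orbifold_meridian: "p \<in> PS 1 \<Longrightarrow> \<nu> p = enat m \<Longrightarrow> m > 1 \<Longrightarrow>
      \<mu> \<in> point_meridians (PS 1 - X) p b \<Longrightarrow> m = 2 \<and> \<mu> \<in> loops X b \<and> mon \<mu> = - 1"
begin

text \<open>Meant for functions that are constant on cosets of the relations;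
  \<open>mem_orb_class\<close> shows that \<open>character\<close> and \<open>crossed\<close>
  are.\<close>

definition orb_lift :: "((real \<Rightarrow> proj) set \<Rightarrow> complex) \<Rightarrow> (real \<Rightarrow> proj) set set \<Rightarrow> complex" where
  "orb_lift f A = f (SOME x. x \<in> A)"

lemma squares_trivial:
  "{path_class (regular_part \<nu>) \<mu> [^]\<^bsub>pi1 (regular_part \<nu>) b\<^esub> m | \<mu> m p.
      p \<in> PS 1 \<and> \<nu> p = enat m \<and> m > 1 \<and> \<mu> \<in> point_meridians (PS 1 - regular_part \<nu>) p b}
    \<subseteq> trivial_part b"
proof
  fix x assume "x \<in> {path_class (regular_part \<nu>) \<mu> [^]\<^bsub>pi1 (regular_part \<nu>) b\<^esub> m | \<mu> m p.
      p \<in> PS 1 \<and> \<nu> p = enat m \<and> m > 1 \<and> \<mu> \<in> point_meridians (PS 1 - regular_part \<nu>) p b}"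
  then obtain \<mu> m p where x: "x = path_class X \<mu> [^]\<^bsub>pi1 X b\<^esub> m" and
    m: "p \<in> PS 1" "\<nu> p = enat m" "m > 1" "\<mu> \<in> point_meridians (PS 1 - X) p b"
    unfolding X_regular by blast
  then show "x \<in> trivial_part b"
    using orbifold_meridian[OF m] square_in_trivial_part[OF b] by blast
qed

lemma orb_relations_trivial: "orb_relations \<nu> b \<subseteq> trivial_part b"
  unfolding orb_relations_def
  by (rule normal_closure_least) (use trivial_part_normal[OF b] squares_trivial in \<open>simp_all only: X_regular\<close>)

lemma orb_class_eq:
  assumes "A \<in> carrier (orb_pi1 \<nu> b)"
  obtains \<gamma> where "\<gamma> \<in> loops X b" "A = orb_class \<nu> b \<gamma>"
  using assms unfolding orb_pi1_def FactGroup_def RCOSETS_def X_regular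
  by (auto simp: carrier_pi1 orb_class_def X_regular)

lemma orb_class_in_carrier: "\<gamma> \<in> loops X b \<Longrightarrow> orb_class \<nu> b \<gamma> \<in> carrier (orb_pi1 \<nu> b)"
  unfolding orb_pi1_def FactGroup_def RCOSETS_def X_regular
  by (auto simp: carrier_pi1 orb_class_def X_regular)

text \<open>A relation multiplied from the left contributes the summand 0 and the factor 1 to the
  crossed homomorphism, and the factor 1 to the character.\<close>

lemma mem_orb_class:
  assumes "\<gamma> \<in> loops X b" "x \<in> orb_class \<nu> b \<gamma>"
  shows "x \<in> carrier (pi1 X b)" "character x = mon \<gamma>" "crossed x = var \<gamma>"
proof -
  interpret group "pi1 X b" by (rule group_pi1[OF b])
  obtain n where n: "n \<in> orb_relations \<nu> b" "x = n \<otimes>\<^bsub>pi1 X b\<^esub> path_class X \<gamma>"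
    using assms(2) unfolding orb_class_def r_coset_def X_regular by blast
  then have n': "n \<in> carrier (pi1 X b)" "character n = 1" "crossed n = 0"
    using orb_relations_trivial by (auto simp: trivial_part_def)
  have g: "path_class X \<gamma> \<in> carrier (pi1 X b)" using assms(1) by (auto simp: carrier_pi1)
  show "x \<in> carrier (pi1 X b)" using n(2) n'(1) g by simp
  show "character x = mon \<gamma>" "crossed x = var \<gamma>"
    unfolding n(2) character_mult[OF n'(1) g] character_class[OF assms(1)] crossed_class[OF assms(1)] n'
    by simp_all
qed

lemma path_class_in_orb_class:
  assumes "\<gamma> \<in> loops X b" shows "path_class X \<gamma> \<in> orb_class \<nu> b \<gamma>"
proof -
  interpret group "pi1 X b" by (rule group_pi1[OF b])
  have g: "path_class X \<gamma> \<in> carrier (pi1 X b)" using assms by (auto simp: carrier_pi1)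
  have "\<one>\<^bsub>pi1 X b\<^esub> \<in> orb_relations \<nu> b"
    unfolding orb_relations_def X_regular by (rule one_in_normal_closure)
  then have "\<one>\<^bsub>pi1 X b\<^esub> \<otimes>\<^bsub>pi1 X b\<^esub> path_class X \<gamma> \<in> orb_class \<nu> b \<gamma>"
    unfolding orb_class_def r_coset_def X_regular by blast
  then show ?thesis using g by simp
qed

lemma orb_lift_class:
  assumes "\<gamma> \<in> loops X b"
  shows "orb_lift character (orb_class \<nu> b \<gamma>) = mon \<gamma>" "orb_lift crossed (orb_class \<nu> b \<gamma>) = var \<gamma>"
proof -
  have "(SOME x. x \<in> orb_class \<nu> b \<gamma>) \<in> orb_class \<nu> b \<gamma>"
    using path_class_in_orb_class[OF assms] by (rule someI)
  from mem_orb_class[OF assms this]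
  show "orb_lift character (orb_class \<nu> b \<gamma>) = mon \<gamma>" "orb_lift crossed (orb_class \<nu> b \<gamma>) = var \<gamma>"
    by (simp_all add: orb_lift_def)
qed

lemma orb_lift_mult:
  assumes "A \<in> carrier (orb_pi1 \<nu> b)" "B \<in> carrier (orb_pi1 \<nu> b)"
  shows "orb_lift character (A \<otimes>\<^bsub>orb_pi1 \<nu> b\<^esub> B) = orb_lift character A * orb_lift character B"
    "orb_lift crossed (A \<otimes>\<^bsub>orb_pi1 \<nu> b\<^esub> B) = orb_lift crossed A + orb_lift character A * orb_lift crossed B"
proof -
  obtain \<gamma> where g: "\<gamma> \<in> loops X b" "A = orb_class \<nu> b \<gamma>" using orb_class_eq[OF assms(1)] .
  obtain \<delta> where d: "\<delta> \<in> loops X b" "B = orb_class \<nu> b \<delta>" using orb_class_eq[OF assms(2)] .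
  have AB: "A \<otimes>\<^bsub>orb_pi1 \<nu> b\<^esub> B = A <#>\<^bsub>pi1 X b\<^esub> B"
    by (simp add: orb_pi1_def FactGroup_def X_regular)
  have "path_class X \<gamma> \<otimes>\<^bsub>pi1 X b\<^esub> path_class X \<delta> \<in> A \<otimes>\<^bsub>orb_pi1 \<nu> b\<^esub> B"
    unfolding AB set_mult_def using path_class_in_orb_class g d by blast
  then have "(SOME x. x \<in> A \<otimes>\<^bsub>orb_pi1 \<nu> b\<^esub> B) \<in> A \<otimes>\<^bsub>orb_pi1 \<nu> b\<^esub> B" by (rule someI)
  then obtain x y where xy: "x \<in> A" "y \<in> B" "(SOME x. x \<in> A \<otimes>\<^bsub>orb_pi1 \<nu> b\<^esub> B) = x \<otimes>\<^bsub>pi1 X b\<^esub> y"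
    unfolding AB set_mult_def by blast
  note x = mem_orb_class[OF g(1) xy(1)[unfolded g(2)]]
  note y = mem_orb_class[OF d(1) xy(2)[unfolded d(2)]]
  have r: "orb_lift f (A \<otimes>\<^bsub>orb_pi1 \<nu> b\<^esub> B) = f (x \<otimes>\<^bsub>pi1 X b\<^esub> y)" for f
    unfolding orb_lift_def xy(3) ..
  show "orb_lift character (A \<otimes>\<^bsub>orb_pi1 \<nu> b\<^esub> B) = orb_lift character A * orb_lift character B"
    "orb_lift crossed (A \<otimes>\<^bsub>orb_pi1 \<nu> b\<^esub> B) = orb_lift crossed A + orb_lift character A * orb_lift crossed B"
    unfolding r character_mult[OF x(1) y(1)] unfolding g(2) d(2) orb_lift_class[OF g(1)] orb_lift_class[OF d(1)]
    using x y by simp_all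
qed

lemma group_orb_pi1: "group (orb_pi1 \<nu> b)"
proof -
  interpret group "pi1 X b" by (rule group_pi1[OF b])
  have "orb_relations \<nu> b \<lhd> pi1 X b"
    unfolding orb_relations_def X_regular
    by (rule normal_closure_normal[OF trivial_part_normal[OF b]]) (use squares_trivial in \<open>simp add: X_regular\<close>)
  then show ?thesis unfolding orb_pi1_def X_regular by (rule normal.factorgroup_is_group)
qed

text \<open>The crossed homomorphism on cosets is non-zero at the class of \<gamma>, whereas
  principal ones vanish wherever the character is 1.\<close>

lemma orb_marking_character:
  assumes "\<gamma> \<in> loops X b" "mon \<gamma> = 1" "var \<gamma> \<noteq> 0" "\<delta> \<in> loops X b" "mon \<delta> = - 1"
  shows "orb_marking \<nu> b (orb_lift character)"
proof -
  let ?G = "orb_pi1 \<nu> b"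
  have "orb_lift character \<in> hom ?G complex_units"
  proof (rule homI)
    fix A B assume AB: "A \<in> carrier ?G" "B \<in> carrier ?G"
    show "orb_lift character (A \<otimes>\<^bsub>?G\<^esub> B) = orb_lift character A \<otimes>\<^bsub>complex_units\<^esub> orb_lift character B"
      by (simp add: orb_lift_mult(1)[OF AB] complex_units_def)
    obtain \<epsilon> where e: "\<epsilon> \<in> loops X b" "A = orb_class \<nu> b \<epsilon>" using orb_class_eq[OF AB(1)] .
    have "mon \<epsilon> = 1 \<or> mon \<epsilon> = - 1" using mon_cases loopsD(1,2)[OF e(1)] by blast
    then show "orb_lift character A \<in> carrier complex_units"
      unfolding e(2) orb_lift_class(1)[OF e(1)] by (auto simp: complex_units_def)
  qed
  moreover have "orb_class \<nu> b \<delta> \<in> carrier ?G" "orb_lift character (orb_class \<nu> b \<delta>) \<noteq> 1"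
    using orb_class_in_carrier[OF assms(4)] orb_lift_class(1)[OF assms(4)] assms(5) by simp_all
  moreover have "group_depth ?G (orb_lift character) > 0"
    unfolding group_depth_def
  proof (rule quotient_dim_pos)
    define c where "c = (\<lambda>A. if A \<in> carrier ?G then orb_lift crossed A else 0)"
    have closed: "A \<otimes>\<^bsub>?G\<^esub> B \<in> carrier ?G" if "A \<in> carrier ?G" "B \<in> carrier ?G" for A B
      using monoid.m_closed[OF group.is_monoid[OF group_orb_pi1] that] .
    show "c \<in> {c. (\<forall>g. g \<notin> carrier ?G \<longrightarrow> c g = 0) \<and> (\<forall>g\<in>carrier ?G. \<forall>k\<in>carrier ?G.
        c (g \<otimes>\<^bsub>?G\<^esub> k) = c g + orb_lift character g * c k)}"
      using closed orb_lift_mult(2) by (auto simp: c_def)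
    show "c (orb_class \<nu> b \<gamma>) \<noteq> 0"
      using orb_class_in_carrier[OF assms(1)] orb_lift_class(2)[OF assms(1)] assms(3) by (simp add: c_def)
    fix w assume "w \<in> {c. \<exists>a. \<forall>g. c g = (if g \<in> carrier ?G then orb_lift character g * a - a else 0)}"
    then obtain a where "w (orb_class \<nu> b \<gamma>) = orb_lift character (orb_class \<nu> b \<gamma>) * a - a"
      using orb_class_in_carrier[OF assms(1)] by auto
    then show "w (orb_class \<nu> b \<gamma>) = 0" using orb_lift_class(1)[OF assms(1)] assms(2) by simp
  qed
  ultimately show ?thesis by (auto simp: orb_marking_def nontrivial_character_def)
qed

end


section \<open>Meridians\<close>

context double_cover
begin

text \<open>Division by a continuous square root s of F(v) normalizes the vectors to F = 1. For a
  closed v the monodromy is therefore the sign by which s changes around the loop.\<close>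

lemma lift_of_vectors:
  assumes "continuous_on {0..1::real} v" "continuous_on {0..1} s"
    and "\<And>t. t \<in> {0..1} \<Longrightarrow> v t \<in> hvec N \<and> pt (v t) \<in> X \<and> (s t)\<^sup>2 = F (v t)"
  shows "lift {0..1} (\<lambda>t. pt (v t)) (\<lambda>t i. inverse (s t) * v t i)"
  unfolding lift_on_def
proof (intro conjI ballI)
  have nz: "F (v t) \<noteq> 0" if "t \<in> {0..1}" for t
    using F_nz[of "pt (v t)"] assms(3)[OF that] hpoly_hcoord_zero_iff[OF F, of "v t"] hvec_nonzero by blast
  have "s t \<noteq> 0" if "t \<in> {0..1}" for t using nz[OF that] assms(3)[OF that] by auto
  then show "continuous_on {0..1} (\<lambda>t i. inverse (s t) * v t i)"
    by (intro continuous_on_coordinatewise_then_product continuous_on_mult continuous_on_inverse assms(2)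
        continuous_on_product_then_coordinatewise[OF assms(1)]) auto
  fix t :: real assume t: "t \<in> {0..1}"
  note n = normalize_unit_quadric[OF F _ nz[OF t], of X "s t"]
  show "(\<lambda>i. inverse (s t) * v t i) \<in> Y" "pt (\<lambda>i. inverse (s t) * v t i) = pt (v t)"
    using n assms(3)[OF t] by blast+
qed

lemma mon_of_vectors:
  assumes "continuous_on {0..1::real} v" "continuous_on {0..1} s"
    and "\<And>t. t \<in> {0..1} \<Longrightarrow> v t \<in> hvec N \<and> pt (v t) \<in> X \<and> (s t)\<^sup>2 = F (v t)"
    and "v 1 = v 0" "s 1 = e * s 0" "e = 1 \<or> e = - 1"
  shows "mon (\<lambda>t. pt (v t)) = e"
  by (rule mon_loop[OF lift_of_vectors[OF assms(1-3)] assms(6)]) (use assms(4-6) in auto)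

end

definition unit_circle :: "real \<Rightarrow> complex" where
  "unit_circle t = cis (2 * pi * t)"

lemma unit_circle: "continuous_on A unit_circle" "unit_circle t \<in> cball 0 1" "unit_circle t \<noteq> 0"
  "norm (unit_circle t) = 1" "unit_circle 0 = 1" "unit_circle 1 = 1"
  unfolding unit_circle_def by (auto intro!: continuous_intros)

definition holomorphic_disk :: "nat \<Rightarrow> (complex \<Rightarrow> nat \<Rightarrow> complex) \<Rightarrow> bool" where
  "holomorphic_disk N \<Delta> \<longleftrightarrow> (\<exists>U. open U \<and> cball 0 1 \<subseteq> U \<and>
     (\<forall>i. (\<lambda>w. \<Delta> w i) holomorphic_on U) \<and> (\<forall>w\<in>U. \<Delta> w \<in> hvec N))"

lemma holomorphic_disk_continuous: "holomorphic_disk N \<Delta> \<Longrightarrow> continuous_on (cball 0 1) \<Delta>"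
  unfolding holomorphic_disk_def
  by (intro continuous_on_coordinatewise_then_product) (meson continuous_on_subset holomorphic_on_imp_continuous_on)

text \<open>The quotient f(w)/w, extended by the derivative at 0, is continuous without zeros on the
  closed disk, which is contractible; so it has a continuous square root.\<close>

lemma simple_zero_factor:
  assumes "open U" "cball 0 1 \<subseteq> U" "f holomorphic_on U" "f 0 = 0" "deriv f 0 \<noteq> 0"
    and "\<And>w. w \<in> cball 0 1 \<Longrightarrow> w \<noteq> 0 \<Longrightarrow> f w \<noteq> 0"
  shows "\<exists>k. continuous_on (cball 0 1) k \<and> (\<forall>w\<in>cball 0 1. f w = w * (k w)\<^sup>2)"
proof -
  define G where "G = (\<lambda>z. if z = 0 then deriv f 0 else (f z - f 0) / (z - 0))"
  have "0 \<in> interior U" using assms(1,2) by (auto simp: interior_open)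
  then have "G holomorphic_on U" unfolding G_def by (rule pole_lemma[OF assms(3)])
  then have "continuous_on (cball 0 1) G"
    using assms(2) holomorphic_on_imp_continuous_on continuous_on_subset by blast
  moreover have "G w \<noteq> 0" if "w \<in> cball 0 1" for w
    using assms(4,5) assms(6)[OF that] by (auto simp: G_def)
  moreover have "contractible (cball (0::complex) 1)" by (rule convex_imp_contractible) (rule convex_cball)
  ultimately obtain k where k: "continuous_on (cball 0 1) k" "\<And>w. w \<in> cball 0 1 \<Longrightarrow> G w = (k w)\<^sup>2"
    using continuous_sqrt_on_contractible[of "cball 0 1" G] by metis
  have "f w = w * (k w)\<^sup>2" if "w \<in> cball 0 1" for w
  proof (cases "w = 0")
    case False
    then have "f w / w = (k w)\<^sup>2" using k(2)[OF that] assms(4) by (simp add: G_def)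
    then show ?thesis using False by (simp add: divide_eq_eq mult.commute)
  qed (simp add: assms(4))
  with k(1) show ?thesis by blast
qed

context double_cover
begin

text \<open>Along the disk F is k^2 if it does not vanish at the centre, and w k^2 if it has a
  simple zero there. On the boundary circle the root k closes up, whereas
  \<open>cis (pi * t)\<close> times k changes sign as t runs from 0 to 1.\<close>

lemma mon_circle:
  assumes \<Delta>: "holomorphic_disk N \<Delta>" and X: "\<And>w. w \<in> cball 0 1 \<Longrightarrow> w \<noteq> 0 \<Longrightarrow> pt (\<Delta> w) \<in> X"
    and e: "if F (\<Delta> 0) \<noteq> 0 then e = 1 else deriv (\<lambda>w. F (\<Delta> w)) 0 \<noteq> 0 \<and> e = - 1"
  shows "mon (\<lambda>t. pt (\<Delta> (unit_circle t))) = e"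
proof -
  obtain U where U: "open U" "cball 0 1 \<subseteq> U" "\<And>i. (\<lambda>w. \<Delta> w i) holomorphic_on U" "\<And>w. w \<in> U \<Longrightarrow> \<Delta> w \<in> hvec N"
    using \<Delta> unfolding holomorphic_disk_def by blast
  have hol: "(\<lambda>w. F (\<Delta> w)) holomorphic_on U" by (rule hpoly_holomorphic[OF F U(3)])
  have hv: "\<Delta> w \<in> hvec N" if "w \<in> cball 0 1" for w using U(2,4) that by blast
  have nz: "F (\<Delta> w) \<noteq> 0" if "w \<in> cball 0 1" "w \<noteq> 0" for w
    using F_nz[OF X[OF that]] hpoly_hcoord_zero_iff[OF F hvec_nonzero[OF hv[OF that(1)]]] by blast
  have cd: "continuous_on {0..1} (\<lambda>t. \<Delta> (unit_circle t))"
    by (rule continuous_on_compose2[OF holomorphic_disk_continuous[OF \<Delta>] unit_circle(1)]) (use unit_circle(2) in blast)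
  have pX: "\<Delta> (unit_circle t) \<in> hvec N \<and> pt (\<Delta> (unit_circle t)) \<in> X" for t
    using hv[OF unit_circle(2)] X[OF unit_circle(2,3)] by blast
  show ?thesis
  proof (cases "F (\<Delta> 0) = 0")
    case False
    then have "\<And>w. w \<in> cball 0 1 \<Longrightarrow> F (\<Delta> w) \<noteq> 0" using nz by metis
    moreover have "continuous_on (cball 0 1) (\<lambda>w. F (\<Delta> w))"
      using hol U(2) holomorphic_on_imp_continuous_on continuous_on_subset by blast
    moreover have "contractible (cball (0::complex) 1)" by (rule convex_imp_contractible) (rule convex_cball)
    ultimately obtain k where k: "continuous_on (cball 0 1) k" "\<And>w. w \<in> cball 0 1 \<Longrightarrow> F (\<Delta> w) = (k w)\<^sup>2"
      using continuous_sqrt_on_contractible[of "cball 0 1" "\<lambda>w. F (\<Delta> w)"] by metis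
    have "mon (\<lambda>t. pt (\<Delta> (unit_circle t))) = 1"
    proof (rule mon_of_vectors[OF cd, of "\<lambda>t. k (unit_circle t)"])
      show "continuous_on {0..1} (\<lambda>t. k (unit_circle t))"
        by (rule continuous_on_compose2[OF k(1) unit_circle(1)]) (use unit_circle(2) in blast)
    qed (use pX k(2)[OF unit_circle(2)] unit_circle(5,6) in auto)
    then show ?thesis using e False by simp
  next
    case True
    then have d: "deriv (\<lambda>w. F (\<Delta> w)) 0 \<noteq> 0" "e = - 1" using e by auto
    obtain k where k: "continuous_on (cball 0 1) k" "\<And>w. w \<in> cball 0 1 \<Longrightarrow> F (\<Delta> w) = w * (k w)\<^sup>2"
      using simple_zero_factor[OF U(1,2) hol True d(1)] nz by blast
    show ?thesis
    proof (rule mon_of_vectors[OF cd, of "\<lambda>t. cis (pi * t) * k (unit_circle t)"])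
      have "continuous_on {0..1} (\<lambda>t. k (unit_circle t))"
        by (rule continuous_on_compose2[OF k(1) unit_circle(1)]) (use unit_circle(2) in blast)
      then show "continuous_on {0..1} (\<lambda>t. cis (pi * t) * k (unit_circle t))"
        by (intro continuous_intros)
      have "(cis (pi * t))\<^sup>2 = unit_circle t" for t
        by (simp add: power2_eq_square cis_mult unit_circle_def mult_2[symmetric] mult.assoc)
      then show "\<Delta> (unit_circle t) \<in> hvec N \<and> pt (\<Delta> (unit_circle t)) \<in> X \<and>
          (cis (pi * t) * k (unit_circle t))\<^sup>2 = F (\<Delta> (unit_circle t))" for t
        using pX k(2)[OF unit_circle(2)] by (simp add: power_mult_distrib)
    qed (use d unit_circle(5,6) in auto)
  qed
qed

lemma disk_loop:
  assumes XD: "X = PS N - D" and \<Delta>: "disk_at N D \<Delta>" and \<gamma>: "\<gamma> \<in> disk_loops N D b \<Delta>"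
    and e: "if F (\<Delta> 0) \<noteq> 0 then e = 1 else deriv (\<lambda>w. F (\<Delta> w)) 0 \<noteq> 0 \<and> e = - 1"
  shows "\<gamma> \<in> loops X b" "mon \<gamma> = e"
proof -
  have hd: "holomorphic_disk N \<Delta>" using \<Delta> unfolding disk_at_def holomorphic_disk_def by blast
  have hv: "\<Delta> w \<in> hvec N" if "w \<in> cball 0 1" for w using hd that unfolding holomorphic_disk_def by blast
  have X: "pt (\<Delta> w) \<in> X" if "w \<in> cball 0 1" "w \<noteq> 0" for w
    using \<Delta> that pt_in_PS[OF hv[OF that(1)]] unfolding disk_at_def XD by blast
  define c where "c = (\<lambda>t. pt (\<Delta> (unit_circle t)))"
  obtain \<delta> where d: "\<gamma> = \<delta> +++ (c +++ reversepath \<delta>)" "path \<delta>" "path_image \<delta> \<subseteq> X" "pathstart \<delta> = b"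
    "pathfinish \<delta> = pt (\<Delta> 1)"
    using \<gamma> unfolding disk_loops_def c_def unit_circle_def XD by blast
  have "continuous_on {0..1} (\<lambda>t. \<Delta> (unit_circle t))"
    by (rule continuous_on_compose2[OF holomorphic_disk_continuous[OF hd] unit_circle(1)]) (use unit_circle(2) in blast)
  then have pc: "path c" unfolding path_def c_def
    by (rule continuous_on_pt_compose) (rule hvec_nonzero[OF hv[OF unit_circle(2)]])
  have ic: "path_image c \<subseteq> X"
    using X[OF unit_circle(2,3)] unfolding path_image_def c_def by blast
  have ec: "pathstart c = pathfinish \<delta>" "pathfinish c = pathfinish \<delta>"
    using d(5) unit_circle(5,6) by (simp_all add: c_def pathstart_def pathfinish_def)
  show "mon \<gamma> = e"
    using conjugate_relations(1)[OF d(2,3) pc ic ec] mon_circle[OF hd X e] unfolding d(1) c_def by simp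
  show "\<gamma> \<in> loops X b"
    unfolding d(1) loops_def using d(2-5) pc ic ec by (simp add: subset_path_image_join)
qed

end

section \<open>The orbicurve\<close>

lemma hvec_1_nz:
  assumes "v \<in> hvec 1" shows "v 0 \<noteq> 0 \<or> v 1 \<noteq> 0"
proof -
  obtain i where i: "v i \<noteq> 0" using assms by (auto simp: hvec_def nonzero_vec_def)
  then have "\<not> i > 1" using assms by (auto simp: hvec_def)
  then have "i = 0 \<or> i = 1" by linarith
  then show ?thesis using i by auto
qed

lemma hvec_1_line_eq:
  assumes "v \<in> hvec 1" "w \<in> hvec 1"
  shows "pt v = pt w \<longleftrightarrow> v 0 * w 1 = v 1 * w 0"
proof
  assume "pt v = pt w"
  then obtain c where "w = (\<lambda>i. c * v i)" using pt_eq_iff assms hvec_nonzero by blast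
  then show "v 0 * w 1 = v 1 * w 0" by simp
next
  assume eq: "v 0 * w 1 = v 1 * w 0"
  have z: "v i = 0 \<and> w i = 0" if "i > 1" for i using assms that by (auto simp: hvec_def)
  note nz = hvec_1_nz[OF assms(1)]
  define c where "c = (if v 0 \<noteq> 0 then w 0 / v 0 else w 1 / v 1)"
  have c: "w 0 = c * v 0" "w 1 = c * v 1"
    using nz eq by (auto simp: c_def field_simps)
  have "w i = c * v i" for i
  proof -
    consider "i = 0" | "i = 1" | "i > 1" by linarith
    then show ?thesis by cases (use c z[of i] in simp_all)
  qed
  then have "w = (\<lambda>i. c * v i)" by (rule ext)
  then show "pt v = pt w" using pt_eq_iff assms hvec_nonzero by blast
qed

lemma vec_of_2 [simp]: "vec_of [a, c] 0 = a" "vec_of [a, c] 1 = c" "vec_of [a, c] (Suc 0) = c" "i > 1 \<Longrightarrow> vec_of [a, c] i = 0"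
  by (auto simp: vec_of_def)

lemma vec_of_2_hvec: "vec_of [a, c] \<in> hvec 1 \<longleftrightarrow> a \<noteq> 0 \<or> c \<noteq> 0"
proof -
  have "a \<noteq> 0 \<or> c \<noteq> 0" if "vec_of [a, c] \<in> hvec 1" using hvec_1_nz[OF that] by simp
  moreover have "vec_of [a, c] \<in> hvec 1" if "a \<noteq> 0 \<or> c \<noteq> 0"
  proof -
    have "vec_of [a, c] 0 \<noteq> 0 \<or> vec_of [a, c] 1 \<noteq> 0" using that by simp
    then have "nonzero_vec (vec_of [a, c])" unfolding nonzero_vec_def by blast
    then show ?thesis by (simp add: hvec_def)
  qed
  ultimately show ?thesis by blast
qed

lemma pt_eq_vec_of:
  assumes "v \<in> hvec 1" "a \<noteq> 0 \<or> c \<noteq> 0"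
  shows "pt v = pt (vec_of [a, c]) \<longleftrightarrow> v 0 * c = v 1 * a"
  using hvec_1_line_eq[OF assms(1), of "vec_of [a, c]"] vec_of_2_hvec assms(2) by simp

lemma orb_labels_pt:
  assumes "v \<in> hvec 1"
  shows "orb_labels (pt v) = (if v 0 = 0 \<or> v 1 = 0 then 2 else if v 0 = v 1 then \<infinity> else 1)"
  unfolding orb_labels_def by (simp add: pt_eq_vec_of[OF assms])

lemma pt_in_regular_part:
  assumes "v \<in> hvec 1"
  shows "pt v \<in> regular_part orb_labels \<longleftrightarrow> v 0 \<noteq> 0 \<and> v 1 \<noteq> 0 \<and> v 0 \<noteq> v 1"
  using pt_in_PS[OF assms] by (simp add: regular_part_def orb_labels_pt[OF assms])

lemma pt_in_underlying_curve:
  assumes "v \<in> hvec 1"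
  shows "pt v \<in> underlying_curve orb_labels \<longleftrightarrow> v 0 \<noteq> v 1"
proof -
  have "v 0 \<noteq> 0 \<or> v 1 \<noteq> 0" by (rule hvec_1_nz[OF assms])
  then show ?thesis
    using pt_in_PS[OF assms] by (auto simp: underlying_curve_def orb_labels_pt[OF assms] simp del: not_infinity_eq)
qed

text \<open>Its zeros on the line are the two orbifold points. The vectors with value 1 are (u,
  1/u), so the double covering is u -> [u : 1/u] = [u^2 : 1], the quotient map of the covering curve
  in the affine coordinate.\<close>

definition toric :: form where "toric v = v 0 * v 1"

lemma hpoly_toric: "hpoly 1 2 toric"
  using hpoly_mult[OF hpoly_var[of 0 1] hpoly_var[of 1 1]] unfolding toric_def[abs_def] by (simp add: numeral_2_eq_2)

lemma unit_quadric_toricD: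
  assumes "v \<in> unit_quadric 1 toric (regular_part orb_labels)"
  shows "v \<in> hvec 1" "v 0 * v 1 = 1" "v 0 \<noteq> 1" "v 0 \<noteq> - 1"
proof -
  show "v \<in> hvec 1" "v 0 * v 1 = 1" using assms by (auto simp: unit_quadric_def toric_def)
  moreover have "v 0 \<noteq> v 1"
    using assms pt_in_regular_part by (auto simp: unit_quadric_def)
  ultimately show "v 0 \<noteq> 1" "v 0 \<noteq> - 1" by (auto simp: minus_equation_iff)
qed

text \<open>On u v = 1 the points u = 1 and u = -1 over the removed point [1:1] are the zero and the
  pole of h, and u -> -u exchanges them.\<close>

interpretation line: double_cover 1 toric "regular_part orb_labels" "\<lambda>v. (v 0 - 1) / (v 0 + 1)"
proof
  show "(1::nat) \<le> 2" "hpoly 1 2 toric" "regular_part orb_labels \<subseteq> PS 1"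
    using hpoly_toric by (auto simp: regular_part_def)
  show "toric (hcoord p) \<noteq> 0" if "p \<in> regular_part orb_labels" for p
    using that pt_in_regular_part[of "hcoord p"] hcoord_in_hvec[of p 1] by (auto simp: regular_part_def toric_def)
  have nz: "v 0 + 1 \<noteq> 0 \<and> v 0 - 1 \<noteq> 0" if "v \<in> unit_quadric 1 toric (regular_part orb_labels)" for v
    using unit_quadric_toricD[OF that] by (simp add: add_eq_0_iff2)
  show "continuous_on (unit_quadric 1 toric (regular_part orb_labels)) (\<lambda>v. (v 0 - 1) / (v 0 + 1))"
    by (intro continuous_intros continuous_on_subset[OF continuous_on_product_coordinates])
      (use nz in auto)
  fix v assume v: "v \<in> unit_quadric 1 toric (regular_part orb_labels)"
  show "(v 0 - 1) / (v 0 + 1) \<noteq> 0" using nz[OF v] by simp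
  have "- v 0 - 1 = - (v 0 + 1)" "- v 0 + 1 = - (v 0 - 1)" by simp_all
  then show "(- v 0 - 1) / (- v 0 + 1) = inverse ((v 0 - 1) / (v 0 + 1))"
    by (simp only: minus_divide_divide inverse_divide)
qed

lemma regular_part_complement: "regular_part orb_labels = PS 1 - (PS 1 - regular_part orb_labels)"
  by (auto simp: regular_part_def)

text \<open>An injective holomorphic function has non-zero derivative. Writing u v as (u/v) v^2,
  with u/v vanishing at 0, gives the derivative of u/v times v(0)^2. Applied to the coordinates of
  an embedded disk, it shows that \<open>toric\<close> has a simple zero at its centre.\<close>

lemma deriv_mult_nz_of_injective_ratio:
  assumes "open U" "cball 0 1 \<subseteq> U" "u holomorphic_on U" "v holomorphic_on U"
    and "\<And>w. w \<in> cball 0 1 \<Longrightarrow> v w \<noteq> 0" "u 0 = 0" "inj_on (\<lambda>w. u w / v w) (cball 0 1)"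
  shows "deriv (\<lambda>w. u w * v w) 0 \<noteq> 0"
proof -
  have sub: "ball 0 1 \<subseteq> U" "ball (0::complex) 1 \<subseteq> cball 0 1" using assms(2) by auto
  have v: "v holomorphic_on ball 0 1" and u: "u holomorphic_on ball 0 1"
    using assms(3,4) sub(1) holomorphic_on_subset by blast+
  have r: "(\<lambda>w. u w / v w) holomorphic_on ball 0 1"
    using u v assms(5) by (intro holomorphic_on_divide) auto
  have r0: "deriv (\<lambda>w. u w / v w) 0 \<noteq> 0"
    using holomorphic_injective_imp_regular[OF r open_ball inj_on_subset[OF assms(7) sub(2)]] by simp
  have "((\<lambda>w. u w / v w) has_field_derivative deriv (\<lambda>w. u w / v w) 0) (at 0)"
    using holomorphic_derivI[OF r open_ball] by simp
  moreover have "(v has_field_derivative deriv v 0) (at 0)"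
    using holomorphic_derivI[OF v open_ball] by simp
  ultimately have "((\<lambda>w. u w / v w * (v w * v w)) has_field_derivative
      deriv (\<lambda>w. u w / v w) 0 * (v 0 * v 0)) (at 0)"
    by (intro DERIV_cong[OF DERIV_mult[OF _ DERIV_mult]]) (assumption | simp add: assms(6))+
  then have "((\<lambda>w. u w * v w) has_field_derivative deriv (\<lambda>w. u w / v w) 0 * (v 0 * v 0)) (at 0)"
    by (rule has_field_derivative_transform_within_open[of _ _ _ "ball 0 1"]) (use assms(5) in auto)
  then have "deriv (\<lambda>w. u w * v w) 0 = deriv (\<lambda>w. u w / v w) 0 * (v 0 * v 0)" by (rule DERIV_imp_deriv)
  then show ?thesis using r0 assms(5)[of 0] by simp
qed

text \<open>The disks defining these meridians are injective, with no condition on a derivative. At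
  an orbifold point the simple zero of \<open>toric\<close> follows from injectivity of the ratio of
  the coordinates; at [1:1] \<open>toric\<close> is non-zero.\<close>

lemma point_meridian_mon:
  assumes p: "p \<in> {pt (vec_of [0, 1]), pt (vec_of [1, 0]), pt (vec_of [1, 1])}"
    and \<gamma>: "\<gamma> \<in> point_meridians (PS 1 - regular_part orb_labels) p b"
  shows "\<gamma> \<in> loops (regular_part orb_labels) b"
    "line.mon \<gamma> = (if p = pt (vec_of [1, 1]) then 1 else - 1)"
proof -
  define D where "D = PS 1 - regular_part orb_labels"
  have XD: "regular_part orb_labels = PS 1 - D" unfolding D_def by (rule regular_part_complement)
  obtain \<Delta> where \<Delta>: "disk_at 1 D \<Delta>" "pt (\<Delta> 0) = p" "\<gamma> \<in> disk_loops 1 D b \<Delta>"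
    using \<gamma> unfolding point_meridians_def D_def by blast
  obtain U where U: "open U" "cball 0 1 \<subseteq> U" "\<And>i. (\<lambda>w. \<Delta> w i) holomorphic_on U" "\<And>w. w \<in> U \<Longrightarrow> \<Delta> w \<in> hvec 1"
    using \<Delta>(1) unfolding disk_at_def by blast
  have hv: "\<Delta> w \<in> hvec 1" if "w \<in> cball 0 1" for w using U(2,4) that by blast
  have inj: "w = w'" if "w \<in> cball 0 1" "w' \<in> cball 0 1" "\<Delta> w 0 * \<Delta> w' 1 = \<Delta> w 1 * \<Delta> w' 0" for w w'
    using \<Delta>(1) that hvec_1_line_eq[OF hv[OF that(1)] hv[OF that(2)]] unfolding disk_at_def inj_on_def by blast
  have reg: "\<Delta> w 0 \<noteq> 0 \<and> \<Delta> w 1 \<noteq> 0" if "w \<in> cball 0 1" "w \<noteq> 0" for w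
  proof -
    have "pt (\<Delta> w) \<in> regular_part orb_labels"
      using \<Delta>(1) that pt_in_PS[OF hv[OF that(1)]] unfolding disk_at_def XD by blast
    then show ?thesis using pt_in_regular_part[OF hv[OF that(1)]] by blast
  qed
  have h0: "\<Delta> 0 \<in> hvec 1" by (rule hv) simp
  have e: "if toric (\<Delta> 0) \<noteq> 0 then (if p = pt (vec_of [1, 1]) then 1 else - 1) = (1::complex)
     else deriv (\<lambda>w. toric (\<Delta> w)) 0 \<noteq> 0 \<and> (if p = pt (vec_of [1, 1]) then 1 else - 1) = (- 1::complex)"
  proof -
    have n0: "\<Delta> 0 0 \<noteq> 0 \<or> \<Delta> 0 1 \<noteq> 0" by (rule hvec_1_nz[OF h0])
    have pe: "p = pt (vec_of [1, 1]) \<longleftrightarrow> \<Delta> 0 0 = \<Delta> 0 1" "p = pt (vec_of [0, 1]) \<longleftrightarrow> \<Delta> 0 0 = 0"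
      "p = pt (vec_of [1, 0]) \<longleftrightarrow> \<Delta> 0 1 = 0"
      using pt_eq_vec_of[OF h0] \<Delta>(2) by auto
    consider "\<Delta> 0 0 = \<Delta> 0 1" | "\<Delta> 0 0 = 0" "\<Delta> 0 1 \<noteq> 0" | "\<Delta> 0 1 = 0" "\<Delta> 0 0 \<noteq> 0"
      using p pe n0 by auto
    then show ?thesis
    proof cases
      case 1
      then show ?thesis using n0 pe by (simp add: toric_def)
    next
      case 2
      have nz: "\<Delta> w 1 \<noteq> 0" if "w \<in> cball 0 1" for w using reg[OF that] 2 by (cases "w = 0") auto
      have "deriv (\<lambda>w. \<Delta> w 0 * \<Delta> w 1) 0 \<noteq> 0"
      proof (rule deriv_mult_nz_of_injective_ratio[OF U(1,2) U(3) U(3) nz 2(1)])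
        show "inj_on (\<lambda>w. \<Delta> w 0 / \<Delta> w 1) (cball 0 1)"
          by (rule inj_onI, rule inj) (use nz in \<open>auto simp: field_simps\<close>)
      qed
      then show ?thesis using 2 pe by (simp add: toric_def)
    next
      case 3
      have nz: "\<Delta> w 0 \<noteq> 0" if "w \<in> cball 0 1" for w using reg[OF that] 3 by (cases "w = 0") auto
      have "deriv (\<lambda>w. \<Delta> w 1 * \<Delta> w 0) 0 \<noteq> 0"
      proof (rule deriv_mult_nz_of_injective_ratio[OF U(1,2) U(3) U(3) nz 3(1)])
        show "inj_on (\<lambda>w. \<Delta> w 1 / \<Delta> w 0) (cball 0 1)"
          by (rule inj_onI, rule inj) (use nz in \<open>auto simp: field_simps\<close>)
      qed
      then show ?thesis using 3 pe by (simp add: toric_def mult.commute)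
    qed
  qed
  show "\<gamma> \<in> loops (regular_part orb_labels) b"
    "line.mon \<gamma> = (if p = pt (vec_of [1, 1]) then 1 else - 1)"
    using line.disk_loop[OF XD \<Delta>(1,3) e] by blast+
qed


section \<open>The global quotient\<close>

definition contact_conic :: form where "contact_conic v = v 0 * v 2 - v 1 ^ 2 / 2"

text \<open>The factor makes the square equal to (9/2) x^2, the normalization for which f4 is
  exactly the difference of q^2 and f2 l^2, so that C4 lies over [1:1].\<close>

definition tangent_form :: form where "tangent_form v = of_real (3 / sqrt 2) * v 0"

lemma f4_eq: "f4 v = contact_conic v ^ 2 - f2 v * tangent_form v ^ 2"
proof -
  have "(of_real (3 / sqrt 2) :: complex) ^ 2 = 9 / 2"
  proof -
    have "3 / sqrt 2 * (3 / sqrt 2) = (9 / 2 :: real)" by simp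
    then show ?thesis unfolding power2_eq_square of_real_mult[symmetric] by simp
  qed
  then have t: "tangent_form v ^ 2 = 9 / 2 * v 0 ^ 2" by (simp only: tangent_form_def power_mult_distrib)
  show ?thesis
    unfolding t by (simp add: f4_def f2_def contact_conic_def Let_def algebra_simps power2_eq_square power4_eq_xxxx power3_eq_cube)
qed

section \<open>Degrees of the forms and the complement of the sextic\<close>

lemma hpoly_tangent_form: "hpoly 2 1 tangent_form"
  unfolding tangent_form_def[abs_def] by (intro hpoly_cmult hpoly_var) simp

lemma hpoly_var_mult: "i \<le> N \<Longrightarrow> j \<le> N \<Longrightarrow> hpoly N 2 (\<lambda>v. v i * v j)"
  using hpoly_mult[OF hpoly_var[of i N] hpoly_var[of j N]] by (simp add: numeral_2_eq_2)

lemma hpoly_f2: "hpoly 2 2 f2"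
proof -
  have "hpoly 2 2 (\<lambda>v. (v 1 * v 2 + (1/3) * (v 0 * v 2)) + (- (1/6)) * (v 1 * v 1))"
    by (intro hpoly.add hpoly_cmult hpoly_var_mult) simp_all
  moreover have "f2 = (\<lambda>v. (v 1 * v 2 + (1/3) * (v 0 * v 2)) + (- (1/6)) * (v 1 * v 1))"
    by (rule ext) (simp add: f2_def Let_def field_simps power2_eq_square)
  ultimately show ?thesis by simp
qed

lemma hpoly_conic: "hpoly 2 2 contact_conic"
proof -
  have "hpoly 2 2 (\<lambda>v. v 0 * v 2 + (- (1/2)) * (v 1 * v 1))"
    by (intro hpoly.add hpoly_cmult hpoly_var_mult) simp_all
  moreover have "contact_conic = (\<lambda>v. v 0 * v 2 + (- (1/2)) * (v 1 * v 1))"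
    by (rule ext) (simp add: contact_conic_def power2_eq_square)
  ultimately show ?thesis by simp
qed

lemma hpoly_pencil_members:
  "hpoly 2 4 (\<lambda>v. f2 v * tangent_form v ^ 2)" "hpoly 2 4 (\<lambda>v. contact_conic v ^ 2)"
  using hpoly_mult[OF hpoly_f2 hpoly_power[OF hpoly_tangent_form, of 2 2]] hpoly_power[OF hpoly_conic, of 4 2]
  by simp_all

lemma hpoly_f4: "hpoly 2 4 f4"
  using hpoly_diff[OF hpoly_pencil_members(2,1)] unfolding f4_eq[abs_def] .

lemma hpoly_f6: "hpoly 2 6 f6"
  using hpoly_mult[OF hpoly_f2 hpoly_f4] unfolding f6_def[abs_def] by simp

lemma C6_zeros: "C6 = zeros 2 f6"
  unfolding C6_def C2_def C4_def zeros_eq[OF hpoly_f2] zeros_eq[OF hpoly_f4] zeros_eq[OF hpoly_f6]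
  by (auto simp: f6_def)

lemma pt_notin_C6: "v \<in> hvec 2 \<Longrightarrow> pt v \<in> PS 2 - C6 \<longleftrightarrow> f2 v \<noteq> 0 \<and> f4 v \<noteq> 0"
  unfolding C6_zeros using pt_in_zeros[OF hpoly_f6] pt_in_PS by (auto simp: f6_def)

lemma complement_C6_eq: "PS 2 - C6 = {p \<in> PS 2. f6 (hcoord p) \<noteq> 0}"
  unfolding C6_zeros zeros_eq[OF hpoly_f6] by blast

lemma pencil_map_pt:
  assumes "v \<in> hvec 2" "f4 v \<noteq> 0"
  shows "pencil_map tangent_form contact_conic (pt v) = pt (vec_of [f2 v * tangent_form v ^ 2, contact_conic v ^ 2])"
proof -
  obtain c where c: "c \<noteq> 0" "hcoord (pt v) = (\<lambda>i. c * v i)" using hcoord_ptE[OF hvec_nonzero[OF assms(1)]] by blast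
  let ?w = "vec_of [f2 v * tangent_form v ^ 2, contact_conic v ^ 2]"
  have nz: "f2 v * tangent_form v ^ 2 \<noteq> 0 \<or> contact_conic v ^ 2 \<noteq> 0" using assms(2) f4_eq[of v] by auto
  have "vec_of [f2 (hcoord (pt v)) * tangent_form (hcoord (pt v)) ^ 2, contact_conic (hcoord (pt v)) ^ 2]
      = (\<lambda>i. c ^ 4 * ?w i)"
    unfolding c(2) hpoly_scale[OF hpoly_f2] hpoly_scale[OF hpoly_conic] hpoly_scale[OF hpoly_tangent_form]
    by (auto simp: vec_of_def less_Suc_eq fun_eq_iff power_mult_distrib power2_eq_square power4_eq_xxxx)
  then show ?thesis
    unfolding pencil_map_def using pt_scale[of ?w "c ^ 4"] c(1) vec_of_2_hvec nz hvec_nonzero by (metis power_not_zero)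
qed

section \<open>Open manifolds and regular maps\<close>

lemma zariski_closed_form: "hpoly N d F \<Longrightarrow> zariski_closed N {p \<in> PS N. F (hcoord p) = 0}"
  unfolding zariski_closed_def by (rule exI[of _ "{F}"]) auto

lemma zariski_closed_PS: "zariski_closed N (PS N)"
  unfolding zariski_closed_def by (rule exI[of _ "{}"]) auto

text \<open>In codimension 0 there are no local equations, so the Jacobian condition is empty; the
  hypersurface itself serves as the closed set to be removed.\<close>

lemma open_manifold:
  assumes "hpoly N d F"
  shows "quasi_projective_manifold N N {p \<in> PS N. F (hcoord p) \<noteq> 0}"
proof -
  have eq: "{p \<in> PS N. F (hcoord p) \<noteq> 0} = PS N - {p \<in> PS N. F (hcoord p) = 0}" by blast
  have "quasi_projective N {p \<in> PS N. F (hcoord p) \<noteq> 0}"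
    unfolding quasi_projective_def using eq zariski_closed_form[OF assms] zariski_closed_PS by blast
  then show ?thesis
    unfolding quasi_projective_manifold_def using zariski_closed_form[OF assms]
    by (intro conjI ballI exI[of _ "{p \<in> PS N. F (hcoord p) = 0}"]) auto
qed

text \<open>The case in which one vector of forms without common zero on X represents the map
  everywhere.\<close>

lemma regular_mapI:
  assumes "\<And>i. hpoly N d (F i)" "\<And>i. i > M \<Longrightarrow> F i = (\<lambda>_. 0)"
    and "\<And>p. p \<in> X \<Longrightarrow> nonzero_vec (\<lambda>i. F i (hcoord p)) \<and> f p = pt (\<lambda>i. F i (hcoord p)) \<and> f p \<in> Y"
  shows "regular_map N M X Y f"
  unfolding regular_map_def
proof (intro conjI image_subsetI ballI exI[of _ d] exI[of _ F])
  show "\<forall>i. hpoly N d (F i)" "\<forall>i>M. F i = (\<lambda>_. 0)" using assms(1,2) by blast+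
  show "f p \<in> Y" "nonzero_vec (\<lambda>i. F i (hcoord p))" if "p \<in> X" for p using assms(3)[OF that] by blast+
  show "nonzero_vec (\<lambda>i. F i (hcoord q)) \<longrightarrow> f q = pt (\<lambda>i. F i (hcoord q))" if "q \<in> X" for q
    using assms(3)[OF that] by blast
qed

lemma regular_map_cong:
  assumes "regular_map N M X Y f" and eq: "\<And>p. p \<in> X \<Longrightarrow> f p = f' p"
  shows "regular_map N M X Y f'"
proof -
  have "f ` X = f' ` X" by (rule image_cong[OF refl eq])
  moreover have "(\<forall>q\<in>X. P q \<longrightarrow> f q = r q) \<longleftrightarrow> (\<forall>q\<in>X. P q \<longrightarrow> f' q = r q)" for P r
    using eq by auto
  ultimately show ?thesis using assms(1) unfolding regular_map_def by simp
qed

section \<open>Quotients by an involution\<close>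

definition involution_action :: "proj set \<Rightarrow> (proj \<Rightarrow> proj) \<Rightarrow> int \<Rightarrow> proj \<Rightarrow> proj" where
  "involution_action E s g = restrict (\<lambda>p. if g = 0 then p else s p) E"

lemma carrier_Z2: "carrier (integer_mod_group 2) = {0, 1}"
  by (auto simp: carrier_integer_mod_group)

lemma involution_group_action:
  assumes "\<And>p. p \<in> E \<Longrightarrow> s p \<in> E \<and> s (s p) = p"
  shows "group_action (integer_mod_group 2) E (involution_action E s)"
  unfolding group_action_def
proof (rule group_hom.intro)
  show "group (integer_mod_group 2)" "group (BijGroup E)"
    using group_integer_mod_group group_BijGroup by blast+
  show "group_hom_axioms (integer_mod_group 2) (BijGroup E) (involution_action E s)"
  proof (rule group_hom_axioms.intro, rule homI)
    have bij: "involution_action E s g \<in> Bij E" if "g = 0 \<or> g = 1" for g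
    proof -
      have "bij_betw (involution_action E s g) E E"
        by (rule bij_betw_byWitness[where f' = "involution_action E s g"])
          (use that assms in \<open>auto simp: involution_action_def\<close>)
      then show ?thesis by (simp add: Bij_def involution_action_def)
    qed
    fix g k assume g: "g \<in> carrier (integer_mod_group 2)" and k: "k \<in> carrier (integer_mod_group 2)"
    have gk: "g = 0 \<or> g = 1" "k = 0 \<or> k = 1" using g k unfolding carrier_Z2 by auto
    show "involution_action E s g \<in> carrier (BijGroup E)" using bij[OF gk(1)] by (simp add: BijGroup_def)
    have "involution_action E s ((g + k) mod 2) = compose E (involution_action E s g) (involution_action E s k)"
    proof
      fix p
      show "involution_action E s ((g + k) mod 2) p = compose E (involution_action E s g) (involution_action E s k) p"
      proof (cases "p \<in> E")
        case True
        then show ?thesis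
          using gk assms[OF True] by (elim disjE) (simp_all add: involution_action_def compose_def)
      qed (simp add: involution_action_def compose_def)
    qed
    then show "involution_action E s (g \<otimes>\<^bsub>integer_mod_group 2\<^esub> k)
        = involution_action E s g \<otimes>\<^bsub>BijGroup E\<^esub> involution_action E s k"
      using bij[OF gk(1)] bij[OF gk(2)] by (simp add: BijGroup_def mult_integer_mod_group)
  qed
qed

text \<open>For the group of order two the orbit of p is {p, s p} and the stabilizer has order 2
  exactly at the fixed points of s, so orbits and labels can be stated through s alone.\<close>

lemma involution_quotient:
  assumes s: "\<And>p. p \<in> E \<Longrightarrow> s p \<in> E \<and> s (s p) = p" and E: "E \<subseteq> PS N"
    and reg: "regular_map N N E E s" "regular_map N M E Y \<pi>"
    and Y: "\<And>y. y \<in> Y \<Longrightarrow> \<exists>p\<in>E. \<pi> p = y"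
    and fib: "\<And>p q. p \<in> E \<Longrightarrow> q \<in> E \<Longrightarrow> \<pi> p = \<pi> q \<longleftrightarrow> q = p \<or> q = s p"
    and \<nu>: "\<And>p. p \<in> E \<Longrightarrow> \<nu> (\<pi> p) = (if s p = p then 2 else 1)"
  shows "orbifold_quotient N E (integer_mod_group 2) (involution_action E s) M Y \<nu> \<pi>"
  unfolding orbifold_quotient_def
proof (intro conjI ballI)
  let ?G = "integer_mod_group 2" and ?a = "involution_action E s"
  show "finite (carrier ?G)" unfolding carrier_Z2 by simp
  show "group_action ?G E ?a" by (rule involution_group_action[OF s])
  show "regular_map N N E E (?a g)" if "g \<in> carrier ?G" for g
  proof (cases "g = 0")
    case True
    show ?thesis
    \<comment> \<open>The identity is truncated at N because components beyond the dimension of the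
      target have to be the zero form.\<close>
    proof (rule regular_mapI[where d = 1 and F = "\<lambda>i v. if i \<le> N then v i else 0"])
      show "hpoly N 1 (\<lambda>v. if i \<le> N then v i else 0)" for i
        using hpoly_var[of i N] hpoly_zero[of N 1] by (cases "i \<le> N") simp_all
      fix p assume p: "p \<in> E"
      then have "hcoord p \<in> hvec N" using E hcoord_in_hvec by blast
      then have "(\<lambda>i. if i \<le> N then hcoord p i else 0) = hcoord p" by (auto simp: hvec_def fun_eq_iff)
      then show "nonzero_vec (\<lambda>i. if i \<le> N then hcoord p i else 0) \<and>
          ?a g p = pt (\<lambda>i. if i \<le> N then hcoord p i else 0) \<and> ?a g p \<in> E"
        using p True by (simp add: involution_action_def)
    qed auto
  next
    case False
    then have "s p = ?a g p" if "p \<in> E" for p using that by (simp add: involution_action_def)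
    then show ?thesis by (rule regular_map_cong[OF reg(1)])
  qed
  show "regular_map N M E Y \<pi>" by (rule reg(2))
  have "\<pi> ` E \<subseteq> Y" using reg(2) by (simp add: regular_map_def)
  moreover have "Y \<subseteq> \<pi> ` E" using Y by blast
  ultimately show "\<pi> ` E = Y" by (rule subset_antisym)
  fix p assume p: "p \<in> E"
  have orb: "orbit ?G ?a p = {p, s p}"
  proof -
    have "{?a g p | g. g \<in> {0, 1}} = {?a 0 p, ?a 1 p}" by blast
    then show ?thesis using p unfolding orbit_def carrier_Z2 by (simp add: involution_action_def)
  qed
  show "\<pi> p = \<pi> q \<longleftrightarrow> q \<in> orbit ?G ?a p" if "q \<in> E" for q
    unfolding orb using fib[OF p that] by simp
  have "stabilizer ?G ?a p = (if s p = p then {0, 1} else {0})"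
    using p unfolding stabilizer_def carrier_Z2 by (auto simp: involution_action_def)
  then show "\<nu> (\<pi> p) = enat (card (stabilizer ?G ?a p))"
    using \<nu>[OF p] by (simp add: numeral_eq_enat one_enat_def)
qed

subsection \<open>The covering of the orbicurve\<close>

lemma pt_in_cover_curve:
  assumes "v \<in> hvec 1" shows "pt v \<in> cover_curve \<longleftrightarrow> v 0 \<noteq> v 1 \<and> v 0 \<noteq> - v 1"
proof -
  have "- v 0 = v 1 \<longleftrightarrow> v 0 = - v 1" by (metis minus_minus)
  then show ?thesis
    using pt_in_PS[OF assms] pt_eq_vec_of[OF assms, of 1 1] pt_eq_vec_of[OF assms, of 1 "- 1"]
    by (simp add: cover_curve_def)
qed

definition line_involution :: "proj \<Rightarrow> proj" where
  "line_involution p = pt (vec_of [- hcoord p 0, hcoord p 1])"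

lemma line_involution_pt:
  assumes "v \<in> hvec 1"
  shows "line_involution (pt v) = pt (vec_of [- v 0, v 1])" "cover_map (pt v) = pt (vec_of [v 0 ^ 2, v 1 ^ 2])"
proof -
  obtain c where c: "c \<noteq> 0" "hcoord (pt v) = (\<lambda>i. c * v i)" using hcoord_ptE[OF hvec_nonzero[OF assms]] by blast
  have nz: "v 0 \<noteq> 0 \<or> v 1 \<noteq> 0" by (rule hvec_1_nz[OF assms])
  have h: "vec_of [a, d] \<in> hvec 1" if "a \<noteq> 0 \<or> d \<noteq> 0" for a d using that vec_of_2_hvec by blast
  show "line_involution (pt v) = pt (vec_of [- v 0, v 1])"
    unfolding line_involution_def c(2)
    by (subst hvec_1_line_eq[OF h h]) (use nz c(1) in auto)
  show "cover_map (pt v) = pt (vec_of [v 0 ^ 2, v 1 ^ 2])"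
    unfolding cover_map_def c(2)
    by (subst hvec_1_line_eq[OF h h]) (use nz c(1) in \<open>auto simp: power_mult_distrib\<close>)
qed

lemma cover_curve_cases:
  assumes "p \<in> cover_curve"
  obtains v where "v \<in> hvec 1" "p = pt v" "v = hcoord p" "v 0 \<noteq> v 1" "v 0 \<noteq> - v 1"
proof -
  have p: "p \<in> PS 1" using assms by (simp add: cover_curve_def)
  show ?thesis
    using that[of "hcoord p"] hcoord_in_hvec[OF p] pt_in_cover_curve[OF hcoord_in_hvec[OF p]] assms by simp
qed

lemma hpoly_vec_of:
  assumes "hpoly N d F" "hpoly N d G" shows "hpoly N d (\<lambda>v. vec_of [F v, G v] i)"
proof -
  consider "i = 0" | "i = 1" | "i > 1" by linarith
  then show ?thesis by cases (use assms hpoly_zero in simp_all)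
qed

lemma regular_map_vec_of:
  assumes "hpoly N d F" "hpoly N d G"
    and "\<And>p. p \<in> X \<Longrightarrow> (F (hcoord p) \<noteq> 0 \<or> G (hcoord p) \<noteq> 0) \<and> f p = pt (vec_of [F (hcoord p), G (hcoord p)]) \<and> f p \<in> Y"
  shows "regular_map N 1 X Y f"
proof (rule regular_mapI[where d = d and F = "\<lambda>i v. vec_of [F v, G v] i"])
  show "hpoly N d (\<lambda>v. vec_of [F v, G v] i)" for i by (rule hpoly_vec_of[OF assms(1,2)])
  show "(\<lambda>v. vec_of [F v, G v] i) = (\<lambda>_. 0)" if "i > 1" for i using that by simp
  fix p assume p: "p \<in> X"
  have "vec_of [F (hcoord p), G (hcoord p)] \<in> hvec 1" using assms(3)[OF p] vec_of_2_hvec by blast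
  then show "nonzero_vec (\<lambda>i. vec_of [F (hcoord p), G (hcoord p)] i) \<and>
      f p = pt (\<lambda>i. vec_of [F (hcoord p), G (hcoord p)] i) \<and> f p \<in> Y"
    using assms(3)[OF p] hvec_nonzero by blast
qed

text \<open>The points over [a:d] are given by square roots of a and d, which are unique up to sign.
  They form one orbit, and it is a single point exactly when a or d is 0, that is, at the points of
  label 2.\<close>

lemma cover_quotient:
  "orbifold_quotient 1 cover_curve (integer_mod_group 2) cover_action 1 (underlying_curve orb_labels) orb_labels cover_map"
proof -
  have act: "cover_action = involution_action cover_curve line_involution"
    by (auto simp: cover_action_def involution_action_def line_involution_def fun_eq_iff)
  have h: "vec_of [a, d] \<in> hvec 1" if "a \<noteq> 0 \<or> d \<noteq> 0" for a d using that vec_of_2_hvec by blast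
  show ?thesis
    unfolding act
  proof (rule involution_quotient)
    show "cover_curve \<subseteq> PS 1" by (auto simp: cover_curve_def)
    have inv: "line_involution p \<in> cover_curve" if "p \<in> cover_curve" for p
    proof -
      obtain v where v: "v \<in> hvec 1" "p = pt v" "v 0 \<noteq> v 1" "v 0 \<noteq> - v 1" using cover_curve_cases[OF \<open>p \<in> cover_curve\<close>] by metis
      have nz: "- v 0 \<noteq> 0 \<or> v 1 \<noteq> 0" using hvec_1_nz[OF v(1)] by simp
      have "- v 0 = v 1 \<longleftrightarrow> v 0 = - v 1" by (metis minus_minus)
      then show ?thesis
        unfolding v(2) line_involution_pt[OF v(1)] pt_in_cover_curve[OF h[OF nz]] using v(3,4) by simp
    qed
    show "line_involution p \<in> cover_curve \<and> line_involution (line_involution p) = p" if "p \<in> cover_curve" for p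
    proof -
      obtain v where v: "v \<in> hvec 1" "p = pt v" using cover_curve_cases[OF \<open>p \<in> cover_curve\<close>] by metis
      have nz: "- v 0 \<noteq> 0 \<or> v 1 \<noteq> 0" using hvec_1_nz[OF v(1)] by simp
      have "pt (vec_of [v 0, v 1]) = pt v"
        using nz by (subst hvec_1_line_eq[OF h v(1)]) auto
      then have "line_involution (line_involution p) = p"
        unfolding v(2) line_involution_pt[OF v(1)] line_involution_pt[OF h[OF nz]] by simp
      then show ?thesis using inv[OF that] by simp
    qed
    show "regular_map 1 1 cover_curve cover_curve line_involution"
    proof (rule regular_map_vec_of)
      show "hpoly 1 1 (\<lambda>v. - v 0)" using hpoly_cmult[OF hpoly_var[of 0 1], of "- 1"] by simp
      show "hpoly 1 1 (\<lambda>v. v 1)" by (rule hpoly_var) simp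
      fix p assume p: "p \<in> cover_curve"
      then have "hcoord p \<in> hvec 1" by (auto simp: cover_curve_def intro: hcoord_in_hvec)
      then show "(- hcoord p 0 \<noteq> 0 \<or> hcoord p 1 \<noteq> 0) \<and>
          line_involution p = pt (vec_of [- hcoord p 0, hcoord p 1]) \<and> line_involution p \<in> cover_curve"
        using inv[OF p] hvec_1_nz by (auto simp: line_involution_def)
    qed
    show "regular_map 1 1 cover_curve (underlying_curve orb_labels) cover_map"
    proof (rule regular_map_vec_of)
      show "hpoly 1 2 (\<lambda>v. v 0 ^ 2)" "hpoly 1 2 (\<lambda>v. v 1 ^ 2)"
        using hpoly_var_mult[of 0 1 0] hpoly_var_mult[of 1 1 1] by (simp_all add: power2_eq_square)
      fix p assume "p \<in> cover_curve"
      then obtain v where v: "v \<in> hvec 1" "p = pt v" "v = hcoord p" "v 0 \<noteq> v 1" "v 0 \<noteq> - v 1" by (rule cover_curve_cases)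
      have nz: "v 0 ^ 2 \<noteq> 0 \<or> v 1 ^ 2 \<noteq> 0" using hvec_1_nz[OF v(1)] by simp
      have "cover_map p = pt (vec_of [v 0 ^ 2, v 1 ^ 2])" unfolding v(2) by (rule line_involution_pt(2)[OF v(1)])
      moreover have "pt (vec_of [v 0 ^ 2, v 1 ^ 2]) \<in> underlying_curve orb_labels"
        unfolding pt_in_underlying_curve[OF h[OF nz]] using v(4,5) by (simp add: power2_eq_iff)
      ultimately show "(hcoord p 0 ^ 2 \<noteq> 0 \<or> hcoord p 1 ^ 2 \<noteq> 0) \<and>
          cover_map p = pt (vec_of [hcoord p 0 ^ 2, hcoord p 1 ^ 2]) \<and> cover_map p \<in> underlying_curve orb_labels"
        using nz unfolding v(3) by simp
    qed
    fix y assume "y \<in> underlying_curve orb_labels"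
    then have "y \<in> PS 1" by (simp add: underlying_curve_def)
    then have y: "hcoord y \<in> hvec 1" by (rule hcoord_in_hvec)
    define a d where "a = hcoord y 0" and "d = hcoord y 1"
    have nz: "csqrt a \<noteq> 0 \<or> csqrt d \<noteq> 0" using hvec_1_nz[OF y] by (simp add: a_def d_def)
    have ad: "a \<noteq> d"
      using \<open>y \<in> underlying_curve orb_labels\<close> pt_in_underlying_curve[OF y] by (simp add: a_def d_def)
    then have "csqrt a \<noteq> csqrt d" "csqrt a \<noteq> - csqrt d" by (metis power2_csqrt power2_minus)+
    then have "pt (vec_of [csqrt a, csqrt d]) \<in> cover_curve"
      unfolding pt_in_cover_curve[OF h[OF nz]] by simp
    moreover have "cover_map (pt (vec_of [csqrt a, csqrt d])) = y"
    proof -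
      have nz': "a \<noteq> 0 \<or> d \<noteq> 0" using nz by simp
      have "pt (vec_of [a, d]) = pt (hcoord y)"
        by (subst hvec_1_line_eq[OF h[OF nz'] y]) (simp add: a_def d_def)
      then show ?thesis unfolding line_involution_pt(2)[OF h[OF nz]] by simp
    qed
    ultimately show "\<exists>p\<in>cover_curve. cover_map p = y" by blast
  next
    fix p q assume "p \<in> cover_curve" "q \<in> cover_curve"
    then obtain v w where v: "v \<in> hvec 1" "p = pt v" "w \<in> hvec 1" "q = pt w" by (metis cover_curve_cases)
    have nz: "v 0 ^ 2 \<noteq> 0 \<or> v 1 ^ 2 \<noteq> 0" "w 0 ^ 2 \<noteq> 0 \<or> w 1 ^ 2 \<noteq> 0" "- v 0 \<noteq> 0 \<or> v 1 \<noteq> 0"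
      using hvec_1_nz[OF v(1)] hvec_1_nz[OF v(3)] by simp_all
    \<comment> \<open>The two square roots of this equation are the two possibilities for q: the
      point p and its image under the involution.\<close>
    have "cover_map p = cover_map q \<longleftrightarrow> (v 0 * w 1) ^ 2 = (v 1 * w 0) ^ 2"
      unfolding v(2,4) line_involution_pt(2)[OF v(1)] line_involution_pt(2)[OF v(3)]
        hvec_1_line_eq[OF h[OF nz(1)] h[OF nz(2)]] by (simp add: power_mult_distrib)
    also have "\<dots> \<longleftrightarrow> v 0 * w 1 = v 1 * w 0 \<or> v 0 * w 1 = - (v 1 * w 0)" by (rule power2_eq_iff)
    also have "v 0 * w 1 = v 1 * w 0 \<longleftrightarrow> q = p" using hvec_1_line_eq[OF v(1,3)] v(2,4) by auto
    also have "v 0 * w 1 = - (v 1 * w 0) \<longleftrightarrow> q = line_involution p"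
      unfolding v(2,4) line_involution_pt(1)[OF v(1)] hvec_1_line_eq[OF v(3) h[OF nz(3)]]
      by (auto simp: algebra_simps add_eq_0_iff)
    finally show "cover_map p = cover_map q \<longleftrightarrow> q = p \<or> q = line_involution p" .
  next
    fix p assume "p \<in> cover_curve"
    then obtain v where v: "v \<in> hvec 1" "p = pt v" "v 0 \<noteq> v 1" "v 0 \<noteq> - v 1" by (metis cover_curve_cases)
    have nz: "v 0 ^ 2 \<noteq> 0 \<or> v 1 ^ 2 \<noteq> 0" "- v 0 \<noteq> 0 \<or> v 1 \<noteq> 0" using hvec_1_nz[OF v(1)] by simp_all
    have "line_involution p = p \<longleftrightarrow> v 0 = 0 \<or> v 1 = 0"
      unfolding v(2) line_involution_pt(1)[OF v(1)] hvec_1_line_eq[OF h[OF nz(2)] v(1)]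
      by (auto simp: algebra_simps)
    moreover have "v 0 ^ 2 \<noteq> v 1 ^ 2" using v(3,4) by (simp add: power2_eq_iff)
    ultimately show "orb_labels (cover_map p) = (if line_involution p = p then 2 else 1)"
      unfolding v(2) line_involution_pt(2)[OF v(1)] orb_labels_pt[OF h[OF nz(1)]] by auto
  qed
qed

lemma cover_curve_manifold: "quasi_projective_manifold 1 1 cover_curve"
proof -
  \<comment> \<open>The form u^2 - v^2 vanishes exactly at the removed points [1:1] and
    [1:-1].\<close>
  have hp: "hpoly 1 2 (\<lambda>v. v 0 * v 0 - v 1 * v 1)" by (intro hpoly_diff hpoly_var_mult) simp_all
  have eq: "cover_curve = {p \<in> PS 1. hcoord p 0 * hcoord p 0 - hcoord p 1 * hcoord p 1 \<noteq> 0}"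
  proof (rule Set.set_eqI)
    fix p
    have "p \<in> cover_curve \<longleftrightarrow> hcoord p 0 \<noteq> hcoord p 1 \<and> hcoord p 0 \<noteq> - hcoord p 1" if "p \<in> PS 1"
      using pt_in_cover_curve[OF hcoord_in_hvec[OF that]] by simp
    then show "p \<in> cover_curve \<longleftrightarrow> p \<in> {p \<in> PS 1. hcoord p 0 * hcoord p 0 - hcoord p 1 * hcoord p 1 \<noteq> 0}"
      by (auto simp: cover_curve_def square_eq_iff)
  qed
  show ?thesis unfolding eq by (rule open_manifold[OF hp])
qed

subsection \<open>The covering of the complement of the sextic\<close>

text \<open>As f2 has degree 2, the double plane is a quadric in 3-space, with w as coordinate 3.
  The condition on f6 keeps the part over the complement of the sextic, where w is non-zero.\<close>

definition double_plane :: "proj set" where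
  "double_plane = {p \<in> PS 3. hcoord p 3 ^ 2 = f2 (hcoord p) \<and> f6 (hcoord p) \<noteq> 0}"

definition plane_involution :: "proj \<Rightarrow> proj" where
  "plane_involution p = pt (\<lambda>i. if i = 3 then - hcoord p 3 else hcoord p i)"

definition plane_projection :: "proj \<Rightarrow> proj" where
  "plane_projection p = pt (\<lambda>i. if i \<le> 2 then hcoord p i else 0)"

definition lifted_pencil :: "proj \<Rightarrow> proj" where
  "lifted_pencil p = pt (vec_of [hcoord p 3 * tangent_form (hcoord p), contact_conic (hcoord p)])"

lemma forms_truncate:
  assumes "\<And>i. i \<le> 2 \<Longrightarrow> v i = w i"
  shows "f2 v = f2 w" "f4 v = f4 w" "f6 v = f6 w" "contact_conic v = contact_conic w" "tangent_form v = tangent_form w"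
  using assms[of 0] assms[of 1] assms[of 2]
  by (simp_all add: f6_def f2_def f4_def contact_conic_def tangent_form_def Let_def)

lemma hpoly_double_plane: "hpoly 3 2 (\<lambda>v. v 3 * v 3 - f2 v)" "hpoly 3 6 f6"
  using hpoly_mono[OF hpoly_f6] by (auto intro!: hpoly_diff hpoly_var_mult hpoly_mono[OF hpoly_f2])

lemma pt_in_double_plane:
  assumes "v \<in> hvec 3" shows "pt v \<in> double_plane \<longleftrightarrow> v 3 ^ 2 = f2 v \<and> f6 v \<noteq> 0"
proof -
  note z = hpoly_hcoord_zero_iff[OF hpoly_double_plane(1) hvec_nonzero[OF assms]]
    hpoly_hcoord_zero_iff[OF hpoly_double_plane(2) hvec_nonzero[OF assms]]
  show ?thesis
    unfolding double_plane_def power2_eq_square mem_Collect_eq z[unfolded right_minus_eq]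
    using pt_in_PS[OF assms] by simp
qed

lemma double_plane_cases:
  assumes "p \<in> double_plane"
  shows "hcoord p \<in> hvec 3" "hcoord p 3 ^ 2 = f2 (hcoord p)" "f6 (hcoord p) \<noteq> 0"
    "hcoord p 3 \<noteq> 0" "\<exists>k\<le>2. hcoord p k \<noteq> 0"
proof -
  show 1: "hcoord p \<in> hvec 3" "hcoord p 3 ^ 2 = f2 (hcoord p)" "f6 (hcoord p) \<noteq> 0"
    using assms hcoord_in_hvec by (auto simp: double_plane_def)
  show "hcoord p 3 \<noteq> 0" using 1(2,3) by (auto simp: f6_def)
  show "\<exists>k\<le>2. hcoord p k \<noteq> 0"
  \<comment> \<open>The point in question is [0:0:0:1], the centre of the projection; it is excluded
    because f2, and hence f6, vanishes there.\<close>
  proof (rule ccontr)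
    assume "\<not> (\<exists>k\<le>2. hcoord p k \<noteq> 0)"
    then have "f2 (hcoord p) = f2 (\<lambda>_. 0)" by (intro forms_truncate) auto
    then show False using 1(3) by (simp add: f6_def f2_def Let_def)
  qed
qed

text \<open>There is one equation, w^2 - f2, and its derivative in the direction of w is 2 w, which
  is non-zero off the sextic.\<close>

lemma double_plane_manifold: "quasi_projective_manifold 3 2 double_plane"
proof -
  let ?F = "\<lambda>v. v 3 * v 3 - f2 v"
  let ?Z = "{p \<in> PS 3. ?F (hcoord p) = 0}" and ?W = "{p \<in> PS 3. f6 (hcoord p) = 0}"
  have eq: "double_plane = ?Z - ?W" by (auto simp: double_plane_def power2_eq_square)
  have zW: "zariski_closed 3 ?W" by (rule zariski_closed_form[OF hpoly_double_plane(2)])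
  have "quasi_projective 3 double_plane"
    unfolding quasi_projective_def using eq zariski_closed_form[OF hpoly_double_plane(1)] zW by blast
  moreover have "\<exists>(F :: nat \<Rightarrow> form) Z. (\<forall>j < 3 - 2. \<exists>d. hpoly 3 d (F j)) \<and> zariski_closed 3 Z \<and> p \<notin> Z \<and>
        double_plane - Z = {q \<in> PS 3. \<forall>j < 3 - 2. F j (hcoord q) = 0} - Z \<and>
        (\<forall>a :: nat \<Rightarrow> complex. (\<forall>w\<in>hvec 3. (\<Sum>j < 3 - 2. a j * dirderiv (F j) (hcoord p) w) = 0)
             \<longrightarrow> (\<forall>j < 3 - 2. a j = 0))" if p: "p \<in> double_plane" for p
  proof (intro exI[of _ "\<lambda>_. ?F"] exI[of _ ?W] conjI allI impI)
    show "\<exists>d. hpoly 3 d ?F" using hpoly_double_plane(1) by blast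
    show "zariski_closed 3 ?W" by (rule zW)
    show "p \<notin> ?W" using p eq by blast
    show "double_plane - ?W = {q \<in> PS 3. \<forall>j::nat<3 - 2. ?F (hcoord q) = 0} - ?W"
      unfolding eq by auto
    fix a :: "nat \<Rightarrow> complex" and j :: nat
    assume a: "\<forall>w\<in>hvec 3. (\<Sum>j < 3 - 2. a j * dirderiv ?F (hcoord p) w) = 0" and j: "j < 3 - 2"
    define e where "e = (\<lambda>i::nat. if i = 3 then 1 else 0 :: complex)"
    have e: "e \<in> hvec 3" by (auto simp: hvec_def e_def nonzero_vec_def)
    have "dirderiv ?F (hcoord p) e = deriv (\<lambda>t. (hcoord p 3 + t) * (hcoord p 3 + t) - f2 (hcoord p)) 0"
    proof -
      have "f2 (\<lambda>i. hcoord p i + t * e i) = f2 (hcoord p)" for t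
        by (rule forms_truncate) (simp add: e_def)
      then show ?thesis unfolding dirderiv_def by (simp add: e_def)
    qed
    also have "\<dots> = 2 * hcoord p 3"
      by (rule DERIV_imp_deriv) (auto intro!: derivative_eq_intros)
    finally have "dirderiv ?F (hcoord p) e = 2 * hcoord p 3" .
    then show "a j = 0" using a e j double_plane_cases(4)[OF p] by fastforce
  qed
  ultimately show ?thesis unfolding quasi_projective_manifold_def by simp
qed


lemma truncate_hvec:
  assumes "\<exists>k\<le>2. v k \<noteq> 0" shows "(\<lambda>i. if i \<le> 2 then v i else 0) \<in> hvec 2"
  using assms by (auto simp: hvec_def nonzero_vec_def)

lemma plane_projection_pt:
  assumes "v \<in> hvec 3" "\<exists>k\<le>2. v k \<noteq> 0"
  shows "plane_projection (pt v) = pt (\<lambda>i. if i \<le> 2 then v i else 0)"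
proof -
  obtain c where c: "c \<noteq> 0" "hcoord (pt v) = (\<lambda>i. c * v i)" using hcoord_ptE[OF hvec_nonzero[OF assms(1)]] by blast
  have "(\<lambda>i. if i \<le> 2 then c * v i else 0) = (\<lambda>i. c * (if i \<le> 2 then v i else 0))" by auto
  then show ?thesis
    unfolding plane_projection_def c(2)
    using pt_scale[OF hvec_nonzero[OF truncate_hvec[OF assms(2)]] c(1)] by simp
qed

lemma negate_hvec: "v \<in> hvec 3 \<Longrightarrow> (\<lambda>i. if i = 3 then - v 3 else v i) \<in> hvec 3"
  unfolding hvec_def nonzero_vec_def by (auto split: if_splits) (metis neg_equal_0_iff_equal)

lemma plane_involution_pt:
  assumes "v \<in> hvec 3" shows "plane_involution (pt v) = pt (\<lambda>i. if i = 3 then - v 3 else v i)"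
proof -
  obtain c where c: "c \<noteq> 0" "hcoord (pt v) = (\<lambda>i. c * v i)" using hcoord_ptE[OF hvec_nonzero[OF assms(1)]] by blast
  have "(\<lambda>i. if i = 3 then - (c * v 3) else c * v i) = (\<lambda>i. c * (if i = 3 then - v 3 else v i))" by auto
  then show ?thesis
    unfolding plane_involution_def c(2) using pt_scale[OF hvec_nonzero[OF negate_hvec[OF assms]] c(1)] by simp
qed

lemma plane_involution_in:
  assumes "p \<in> double_plane"
  shows "plane_involution p \<in> double_plane" "plane_involution (plane_involution p) = p"
    "plane_projection (plane_involution p) = plane_projection p" "plane_involution p \<noteq> p"
proof -
  define v where "v = hcoord p"
  define v' where "v' = (\<lambda>i::nat. if i = 3 then - v 3 else v i)"
  have v: "v \<in> hvec 3" "v 3 ^ 2 = f2 v" "f6 v \<noteq> 0" "v 3 \<noteq> 0" "\<exists>k\<le>2. v k \<noteq> 0" "p = pt v"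
    using double_plane_cases[OF assms] by (simp_all add: v_def)
  have v': "v' \<in> hvec 3" unfolding v'_def by (rule negate_hvec[OF v(1)])
  have e: "v' i = v i" if "i \<le> 2" for i using that by (simp add: v'_def)
  have ip: "plane_involution p = pt v'" unfolding v(6) plane_involution_pt[OF v(1)] v'_def ..
  show "plane_involution p \<in> double_plane"
  proof -
    have "f2 v' = f2 v" "f6 v' = f6 v" by (rule forms_truncate, erule e)+
    moreover have "v' 3 = - v 3" by (simp add: v'_def)
    ultimately show ?thesis unfolding ip pt_in_double_plane[OF v'] using v(2,3) by simp
  qed
  have "(\<lambda>i. if i = 3 then - v' 3 else v' i) = v" by (auto simp: v'_def)
  then show "plane_involution (plane_involution p) = p" unfolding ip plane_involution_pt[OF v'] by (simp add: v(6))
  have "(\<lambda>i. if i \<le> 2 then v' i else 0) = (\<lambda>i. if i \<le> 2 then v i else 0)" by (auto simp: v'_def)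
  moreover have "\<exists>k\<le>2. v' k \<noteq> 0" using v(5) e by metis
  ultimately show "plane_projection (plane_involution p) = plane_projection p"
    unfolding ip unfolding v(6) plane_projection_pt[OF v(1,5)] by (simp add: plane_projection_pt[OF v'])
  show "plane_involution p \<noteq> p"
  proof
    assume "plane_involution p = p"
    then have "pt v = pt v'" using ip v(6) by metis
    then obtain c where c: "v' = (\<lambda>i. c * v i)" using pt_eq_iff hvec_nonzero v(1) v' by metis
    obtain k where k: "k \<le> 2" "v k \<noteq> 0" using v(5) by blast
    have "c * v k = v k" using e[OF k(1)] unfolding c by simp
    then have "c = 1" using k(2) by simp
    then have "v' 3 = v 3" unfolding c by simp
    then show False using v(4) by (simp add: v'_def)
  qed
qed

text \<open>If the first three coordinates of w are c times those of v, then the last ones satisfy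
  w_3^2 = c^2 f2(v) = (c v_3)^2. The sign of the root decides between p and its image.\<close>

lemma plane_projection_eqD:
  assumes "p \<in> double_plane" "q \<in> double_plane" "plane_projection p = plane_projection q"
  shows "q = p \<or> q = plane_involution p"
proof -
  define v w where "v = hcoord p" and "w = hcoord q"
  have v: "v \<in> hvec 3" "v 3 ^ 2 = f2 v" "\<exists>k\<le>2. v k \<noteq> 0" "p = pt v"
    and w: "w \<in> hvec 3" "w 3 ^ 2 = f2 w" "\<exists>k\<le>2. w k \<noteq> 0" "q = pt w"
    using double_plane_cases[OF assms(1)] double_plane_cases[OF assms(2)] by (simp_all add: v_def w_def)
  have "pt (\<lambda>i. if i \<le> 2 then v i else 0) = pt (\<lambda>i. if i \<le> 2 then w i else 0)"
    using assms(3) unfolding v(4) w(4) plane_projection_pt[OF v(1,3)] plane_projection_pt[OF w(1,3)] .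
  then obtain c where c: "(\<lambda>i. if i \<le> 2 then w i else 0) = (\<lambda>i. c * (if i \<le> 2 then v i else 0))"
    using pt_eq_iff[OF hvec_nonzero[OF truncate_hvec[OF v(3)]] hvec_nonzero[OF truncate_hvec[OF w(3)]]] by blast
  have wv: "w i = c * v i" if "i \<le> 2" for i using fun_cong[OF c, of i] that by simp
  have "c \<noteq> 0" using wv w(3) by auto
  have "w 3 ^ 2 = f2 (\<lambda>i. c * v i)" unfolding w(2) by (rule forms_truncate(1)[OF wv])
  also have "\<dots> = (c * v 3) ^ 2" unfolding hpoly_scale[OF hpoly_f2] v(2)[symmetric] by (simp add: power_mult_distrib)
  finally have "w 3 = c * v 3 \<or> w 3 = - (c * v 3)" by (simp add: power2_eq_iff)
  then show ?thesis
  proof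
    assume w3: "w 3 = c * v 3"
    have "w i = c * v i" for i
    proof -
      consider "i \<le> 2" | "i = 3" | "i > 3" by linarith
      then show ?thesis by cases (use wv w3 v(1) w(1) in \<open>auto simp: hvec_def\<close>)
    qed
    then have "w = (\<lambda>i. c * v i)" by (rule ext)
    then show ?thesis unfolding v(4) w(4) using pt_scale[OF hvec_nonzero[OF v(1)] \<open>c \<noteq> 0\<close>] by simp
  next
    assume w3: "w 3 = - (c * v 3)"
    have "w i = c * (if i = 3 then - v 3 else v i)" for i
    proof -
      consider "i \<le> 2" | "i = 3" | "i > 3" by linarith
      then show ?thesis by cases (use wv w3 v(1) w(1) in \<open>auto simp: hvec_def\<close>)
    qed
    then have "w = (\<lambda>i. c * (if i = 3 then - v 3 else v i))" by (rule ext)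
    then show ?thesis unfolding v(4) w(4) plane_involution_pt[OF v(1)]
      using pt_scale[OF hvec_nonzero[OF negate_hvec[OF v(1)]] \<open>c \<noteq> 0\<close>] by simp
  qed
qed

lemma plane_projection_in:
  assumes "p \<in> double_plane"
  shows "plane_projection p \<in> PS 2 - C6"
    "plane_projection p = pt (\<lambda>i. if i \<le> 2 then hcoord p i else 0)"
    "(\<lambda>i. if i \<le> 2 then hcoord p i else 0) \<in> hvec 2"
proof -
  note d = double_plane_cases[OF assms]
  show h: "(\<lambda>i. if i \<le> 2 then hcoord p i else 0) \<in> hvec 2" by (rule truncate_hvec[OF d(5)])
  show p: "plane_projection p = pt (\<lambda>i. if i \<le> 2 then hcoord p i else 0)" by (simp add: plane_projection_def)
  have "f2 (\<lambda>i. if i \<le> 2 then hcoord p i else 0) = f2 (hcoord p)" "f4 (\<lambda>i. if i \<le> 2 then hcoord p i else 0) = f4 (hcoord p)"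
    by (rule forms_truncate, simp)+
  then show "plane_projection p \<in> PS 2 - C6"
    unfolding p pt_notin_C6[OF h] using d(3) by (simp add: f6_def)
qed

lemma plane_quotient:
  "orbifold_quotient 3 double_plane (integer_mod_group 2) (involution_action double_plane plane_involution)
     2 (PS 2 - C6) (\<lambda>_. 1) plane_projection"
proof (rule involution_quotient)
  show "double_plane \<subseteq> PS 3" by (auto simp: double_plane_def)
  show "plane_involution p \<in> double_plane \<and> plane_involution (plane_involution p) = p" if "p \<in> double_plane" for p
    using plane_involution_in[OF that] by blast
  show "regular_map 3 3 double_plane double_plane plane_involution"
  proof (rule regular_mapI[where d = 1 and F = "\<lambda>i v. if i = 3 then - 1 * v 3 else if i \<le> 2 then v i else 0"])
    fix i :: nat
    consider "i \<le> 2" | "i = 3" | "i > 3" by linarith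
    then show "hpoly 3 1 (\<lambda>v. if i = 3 then - 1 * v 3 else if i \<le> 2 then v i else 0)"
      by cases (use hpoly_var[of i 3] hpoly_zero[of 3 1] hpoly_cmult[OF hpoly_var[of 3 3], of "- 1"] in simp_all)
  next
    fix p assume p: "p \<in> double_plane"
    have h: "hcoord p \<in> hvec 3" by (rule double_plane_cases[OF p])
    have "(\<lambda>i. if i = 3 then - 1 * hcoord p 3 else if i \<le> 2 then hcoord p i else 0)
        = (\<lambda>i. if i = 3 then - hcoord p 3 else hcoord p i)"
    proof
      fix i :: nat
      consider "i \<le> 2" | "i = 3" | "i > 3" by linarith
      then show "(if i = 3 then - 1 * hcoord p 3 else if i \<le> 2 then hcoord p i else 0)
        = (if i = 3 then - hcoord p 3 else hcoord p i)" by cases (use h in \<open>auto simp: hvec_def\<close>)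
    qed
    then show "nonzero_vec (\<lambda>i. if i = 3 then - 1 * hcoord p 3 else if i \<le> 2 then hcoord p i else 0) \<and>
        plane_involution p = pt (\<lambda>i. if i = 3 then - 1 * hcoord p 3 else if i \<le> 2 then hcoord p i else 0) \<and>
        plane_involution p \<in> double_plane"
      using hvec_nonzero[OF negate_hvec[OF h]] plane_involution_in(1)[OF p] by (simp add: plane_involution_def)
  qed auto
  show "regular_map 3 2 double_plane (PS 2 - C6) plane_projection"
  proof (rule regular_mapI[where d = 1 and F = "\<lambda>i v. if i \<le> 2 then v i else 0"])
    show "hpoly 3 1 (\<lambda>v. if i \<le> 2 then v i else 0)" for i
      using hpoly_var[of i 3] hpoly_zero[of 3 1] by (cases "i \<le> 2") simp_all
    show "nonzero_vec (\<lambda>i. if i \<le> 2 then hcoord p i else 0) \<and>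
        plane_projection p = pt (\<lambda>i. if i \<le> 2 then hcoord p i else 0) \<and> plane_projection p \<in> PS 2 - C6"
      if "p \<in> double_plane" for p
      using plane_projection_in[OF that] hvec_nonzero by blast
  qed auto
  show "plane_projection p = plane_projection q \<longleftrightarrow> q = p \<or> q = plane_involution p"
    if "p \<in> double_plane" "q \<in> double_plane" for p q
    using plane_projection_eqD[OF that] plane_involution_in(3)[OF that(1)] by auto
  show "1 = (if plane_involution p = p then 2 else 1)" if "p \<in> double_plane" for p
    using plane_involution_in(4)[OF that] by simp
  fix y assume y: "y \<in> PS 2 - C6"
  define u where "u = hcoord y"
  have u: "u \<in> hvec 2" "y = pt u" using y hcoord_in_hvec by (auto simp: u_def)
  then have f: "f2 u \<noteq> 0" "f4 u \<noteq> 0" using y pt_notin_C6[OF u(1)] by auto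
  define v where "v = (\<lambda>i. if i = 3 then csqrt (f2 u) else u i)"
  have vu: "v i = u i" if "i \<le> 2" for i using that by (simp add: v_def)
  obtain k where k: "u k \<noteq> 0" using u(1) by (auto simp: hvec_def nonzero_vec_def)
  then have "\<not> k > 2" using u(1) by (auto simp: hvec_def)
  then have k2: "k \<le> 2" "v k \<noteq> 0" using k vu by auto
  have "nonzero_vec v" using k2(2) unfolding nonzero_vec_def by blast
  moreover have "v i = 0" if "i > 3" for i using u(1) that by (simp add: hvec_def v_def)
  ultimately have v: "v \<in> hvec 3" by (simp add: hvec_def)
  have "f2 v = f2 u" "f6 v = f6 u" by (rule forms_truncate, erule vu)+
  moreover have "v 3 = csqrt (f2 u)" by (simp add: v_def)
  ultimately have "pt v \<in> double_plane"
    unfolding pt_in_double_plane[OF v] using f by (simp add: f6_def)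
  moreover have "(\<lambda>i. if i \<le> 2 then v i else 0) = u" using u(1) by (auto simp: v_def hvec_def)
  then have "plane_projection (pt v) = y" using plane_projection_pt[OF v] k2 u(2) by auto
  ultimately show "\<exists>p\<in>double_plane. plane_projection p = y" by blast
qed

section \<open>The pencil map and its lift to the covering curve\<close>

lemma pencil_vector:
  assumes "v \<in> hvec 2" "f4 v \<noteq> 0"
  shows "f2 v * tangent_form v ^ 2 \<noteq> 0 \<or> contact_conic v ^ 2 \<noteq> 0" "f2 v * tangent_form v ^ 2 \<noteq> contact_conic v ^ 2"
  using assms(2) f4_eq[of v] by auto

lemma pencil_map_regular: "regular_map 2 1 (PS 2 - C6) (underlying_curve orb_labels) (pencil_map tangent_form contact_conic)"
proof (rule regular_map_vec_of[OF hpoly_pencil_members])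
  fix p assume p: "p \<in> PS 2 - C6"
  then have h: "hcoord p \<in> hvec 2" using hcoord_in_hvec by blast
  then have "f4 (hcoord p) \<noteq> 0" using p pt_notin_C6[OF h] by simp
  note n = pencil_vector[OF h this]
  have v: "vec_of [f2 (hcoord p) * tangent_form (hcoord p) ^ 2, contact_conic (hcoord p) ^ 2] \<in> hvec 1"
    using n(1) vec_of_2_hvec by blast
  show "(f2 (hcoord p) * tangent_form (hcoord p) ^ 2 \<noteq> 0 \<or> contact_conic (hcoord p) ^ 2 \<noteq> 0) \<and>
      pencil_map tangent_form contact_conic p = pt (vec_of [f2 (hcoord p) * tangent_form (hcoord p) ^ 2, contact_conic (hcoord p) ^ 2]) \<and>
      pencil_map tangent_form contact_conic p \<in> underlying_curve orb_labels"
    using n unfolding pencil_map_def pt_in_underlying_curve[OF v] by simp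
qed

text \<open>On the double plane q^2 - (w l)^2 = f4 is non-zero. Hence [w l : q] is defined and
  misses [1:1] and [1:-1], and squaring its coordinates gives [f2 l^2 : q^2].\<close>

lemma lifted_pencil_vector:
  assumes "p \<in> double_plane"
  shows "vec_of [hcoord p 3 * tangent_form (hcoord p), contact_conic (hcoord p)] \<in> hvec 1"
    "lifted_pencil p \<in> cover_curve" "cover_map (lifted_pencil p) = pencil_map tangent_form contact_conic (plane_projection p)"
proof -
  define v where "v = hcoord p"
  have v: "v 3 ^ 2 = f2 v" "f4 v \<noteq> 0" using double_plane_cases[OF assms] by (auto simp: v_def f6_def)
  then have eq: "contact_conic v ^ 2 - (v 3 * tangent_form v) ^ 2 = f4 v" using f4_eq[of v] by (simp add: power_mult_distrib)
  have "v 3 * tangent_form v \<noteq> 0 \<or> contact_conic v \<noteq> 0" using eq v(2) by auto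
  then show h: "vec_of [hcoord p 3 * tangent_form (hcoord p), contact_conic (hcoord p)] \<in> hvec 1"
    unfolding v_def[symmetric] using vec_of_2_hvec by blast
  have "v 3 * tangent_form v \<noteq> contact_conic v" "v 3 * tangent_form v \<noteq> - contact_conic v" using eq v(2) by auto
  then show "lifted_pencil p \<in> cover_curve"
    unfolding lifted_pencil_def pt_in_cover_curve[OF h] by (simp add: v_def)
  define u where "u = (\<lambda>i. if i \<le> 2 then v i else 0)"
  have u: "u \<in> hvec 2" "plane_projection p = pt u" using plane_projection_in(2,3)[OF assms] unfolding u_def v_def by blast+
  have "u i = v i" if "i \<le> 2" for i using that by (simp add: u_def)
  note t = forms_truncate[OF this]
  have "pencil_map tangent_form contact_conic (plane_projection p) = pt (vec_of [f2 v * tangent_form v ^ 2, contact_conic v ^ 2])"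
    unfolding u(2) by (subst pencil_map_pt[OF u(1)]) (use t v(2) in simp_all)
  moreover have "cover_map (lifted_pencil p) = pt (vec_of [(v 3 * tangent_form v) ^ 2, contact_conic v ^ 2])"
    unfolding lifted_pencil_def line_involution_pt(2)[OF h] by (simp add: v_def)
  ultimately show "cover_map (lifted_pencil p) = pencil_map tangent_form contact_conic (plane_projection p)"
    using v(1) by (simp add: power_mult_distrib)
qed

lemma lifted_pencil_regular: "regular_map 3 1 double_plane cover_curve lifted_pencil"
proof (rule regular_map_vec_of)
  show "hpoly 3 2 (\<lambda>v. v 3 * tangent_form v)"
    using hpoly_mult[OF hpoly_var[of 3 3] hpoly_mono[OF hpoly_tangent_form, of 3]] by (simp add: numeral_2_eq_2)
  show "hpoly 3 2 contact_conic" by (rule hpoly_mono[OF hpoly_conic]) simp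
  fix p assume p: "p \<in> double_plane"
  show "(hcoord p 3 * tangent_form (hcoord p) \<noteq> 0 \<or> contact_conic (hcoord p) \<noteq> 0) \<and>
      lifted_pencil p = pt (vec_of [hcoord p 3 * tangent_form (hcoord p), contact_conic (hcoord p)]) \<and> lifted_pencil p \<in> cover_curve"
    using lifted_pencil_vector(1,2)[OF p] vec_of_2_hvec by (auto simp: lifted_pencil_def)
qed

lemma pencil_global_quotient:
  "global_quotient_orbifold_pencil (integer_mod_group 2) 1 cover_curve cover_action cover_map orb_labels
     2 (PS 2 - C6) (pencil_map tangent_form contact_conic)"
  unfolding global_quotient_orbifold_pencil_def
proof (intro conjI)
  show "\<exists>N n XG act \<pi> \<Phi>.
        quasi_projective_manifold 2 n (PS 2 - C6) \<and>
        quasi_projective_manifold N n XG \<and>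
        orbifold_quotient N XG (integer_mod_group 2) act 2 (PS 2 - C6) (\<lambda>_. 1) \<pi> \<and>
        regular_map N 1 XG cover_curve \<Phi> \<and>
        (\<forall>p\<in>XG. pencil_map tangent_form contact_conic (\<pi> p) = cover_map (\<Phi> p))"
  proof (intro exI conjI ballI)
    show "quasi_projective_manifold 2 2 (PS 2 - C6)" unfolding complement_C6_eq by (rule open_manifold[OF hpoly_f6])
    show "quasi_projective_manifold 3 2 double_plane" by (rule double_plane_manifold)
    show "orbifold_quotient 3 double_plane (integer_mod_group 2) (involution_action double_plane plane_involution)
     2 (PS 2 - C6) (\<lambda>_. 1) plane_projection" by (rule plane_quotient)
    show "regular_map 3 1 double_plane cover_curve lifted_pencil" by (rule lifted_pencil_regular)
    show "pencil_map tangent_form contact_conic (plane_projection p) = cover_map (lifted_pencil p)" if "p \<in> double_plane" for p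
      using lifted_pencil_vector(3)[OF that] by simp
  qed
qed (rule cover_curve_manifold cover_quotient pencil_map_regular)+


section \<open>The marked pencil\<close>

lemma path_connected_complement_C6: "path_connected (PS 2 - C6)"
  unfolding C6_zeros by (rule path_connected_complement_zeros[OF hpoly_f6]) simp

lemma path_connected_regular_part: "path_connected (regular_part orb_labels)"
proof -
  \<comment> \<open>The cubic u v (u - v) vanishes exactly at the three special points of the
    orbicurve.\<close>
  have hp: "hpoly 1 3 (\<lambda>v. toric v * (v 0 - v 1))"
    using hpoly_mult[OF hpoly_toric hpoly_diff[OF hpoly_var[of 0 1] hpoly_var[of 1 1]]] by simp
  have "regular_part orb_labels = PS 1 - zeros 1 (\<lambda>v. toric v * (v 0 - v 1))"
  proof (rule Set.set_eqI)
    fix p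
    have "p \<in> regular_part orb_labels \<longleftrightarrow> hcoord p 0 \<noteq> 0 \<and> hcoord p 1 \<noteq> 0 \<and> hcoord p 0 \<noteq> hcoord p 1" if "p \<in> PS 1"
      using pt_in_regular_part[OF hcoord_in_hvec[OF that]] by simp
    then show "p \<in> regular_part orb_labels \<longleftrightarrow> p \<in> PS 1 - zeros 1 (\<lambda>v. toric v * (v 0 - v 1))"
      unfolding zeros_eq[OF hp] by (auto simp: regular_part_def toric_def)
  qed
  then show ?thesis using path_connected_complement_zeros[OF hp] by simp
qed

lemma unit_quadric_f2D:
  assumes "v \<in> unit_quadric 2 f2 (PS 2 - C6)"
  shows "v \<in> hvec 2" "f2 v = 1" "f4 v \<noteq> 0" "tangent_form v + contact_conic v \<noteq> 0" "tangent_form v - contact_conic v \<noteq> 0"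
proof -
  show v: "v \<in> hvec 2" "f2 v = 1" using assms by (auto simp: unit_quadric_def)
  show f4: "f4 v \<noteq> 0" using assms pt_notin_C6[OF v(1)] by (auto simp: unit_quadric_def)
  have "contact_conic v ^ 2 \<noteq> tangent_form v ^ 2" using f4 f4_eq[of v] v(2) by auto
  then have n: "contact_conic v \<noteq> tangent_form v" "contact_conic v \<noteq> - tangent_form v" by auto
  show "tangent_form v - contact_conic v \<noteq> 0" using n(1) by auto
  show "tangent_form v + contact_conic v \<noteq> 0" using n(2) by (metis add.commute add_eq_0_iff2)
qed

lemma conic_tangent_uminus: "contact_conic (\<lambda>i. - v i) = contact_conic v" "tangent_form (\<lambda>i. - v i) = - tangent_form v"
  by (simp_all add: contact_conic_def tangent_form_def)

text \<open>Under v -> -v the form l changes sign and q does not, so numerator and denominator of h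
  are interchanged up to a common sign. Neither vanishes, because with f2 = 1 their product is
  -f4.\<close>

interpretation plane: double_cover 2 f2 "PS 2 - C6" "\<lambda>v. (tangent_form v - contact_conic v) / (tangent_form v + contact_conic v)"
proof
  show "(2::nat) \<le> 2" "hpoly 2 2 f2" "PS 2 - C6 \<subseteq> PS 2" using hpoly_f2 by auto
  show "f2 (hcoord p) \<noteq> 0" if "p \<in> PS 2 - C6" for p
    using that pt_notin_C6[of "hcoord p"] hcoord_in_hvec[of p 2] by simp
  show "continuous_on (unit_quadric 2 f2 (PS 2 - C6)) (\<lambda>v. (tangent_form v - contact_conic v) / (tangent_form v + contact_conic v))"
    by (intro continuous_on_divide continuous_on_diff continuous_on_add hpoly_continuous[OF hpoly_conic]
        hpoly_continuous[OF hpoly_tangent_form]) (use unit_quadric_f2D(4) in blast)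
  fix v assume v: "v \<in> unit_quadric 2 f2 (PS 2 - C6)"
  show "(tangent_form v - contact_conic v) / (tangent_form v + contact_conic v) \<noteq> 0" using unit_quadric_f2D[OF v] by simp
  have "- tangent_form v - contact_conic v = - (tangent_form v + contact_conic v)" "- tangent_form v + contact_conic v = - (tangent_form v - contact_conic v)"
    by simp_all
  then show "(tangent_form (\<lambda>i. - v i) - contact_conic (\<lambda>i. - v i)) / (tangent_form (\<lambda>i. - v i) + contact_conic (\<lambda>i. - v i))
      = inverse ((tangent_form v - contact_conic v) / (tangent_form v + contact_conic v))"
    unfolding conic_tangent_uminus by (simp only: minus_divide_divide inverse_divide)
qed

lemma deriv_f6_disk:
  assumes "disk_at 2 (zeros 2 f6) \<Delta>"
  shows "\<Delta> 0 \<in> hvec 2"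
    "deriv (\<lambda>w. f6 (\<Delta> w)) 0 = deriv (\<lambda>w. f2 (\<Delta> w)) 0 * f4 (\<Delta> 0) + deriv (\<lambda>w. f4 (\<Delta> w)) 0 * f2 (\<Delta> 0)"
proof -
  obtain U where U: "open U" "cball 0 1 \<subseteq> U" "\<And>i. (\<lambda>w. \<Delta> w i) holomorphic_on U" "\<And>w. w \<in> U \<Longrightarrow> \<Delta> w \<in> hvec 2"
    using assms unfolding disk_at_def by blast
  have 0: "0 \<in> U" using subsetD[OF U(2), of 0] by simp
  show "\<Delta> 0 \<in> hvec 2" by (rule U(4)[OF 0])
  have d2: "((\<lambda>w. f2 (\<Delta> w)) has_field_derivative deriv (\<lambda>w. f2 (\<Delta> w)) 0) (at 0)"
    by (rule holomorphic_derivI[OF hpoly_holomorphic[OF hpoly_f2 U(3)] U(1) 0])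
  have d4: "((\<lambda>w. f4 (\<Delta> w)) has_field_derivative deriv (\<lambda>w. f4 (\<Delta> w)) 0) (at 0)"
    by (rule holomorphic_derivI[OF hpoly_holomorphic[OF hpoly_f4 U(3)] U(1) 0])
  show "deriv (\<lambda>w. f6 (\<Delta> w)) 0 = deriv (\<lambda>w. f2 (\<Delta> w)) 0 * f4 (\<Delta> 0) + deriv (\<lambda>w. f4 (\<Delta> w)) 0 * f2 (\<Delta> 0)"
    unfolding f6_def by (rule DERIV_imp_deriv[OF DERIV_mult[OF d2 d4]])
qed

text \<open>By the product rule a simple zero of f6 = f2 f4 along the disk comes from one factor
  only. On C2 it is a simple zero of f2; on C4 the factor f2 is non-zero at the centre.\<close>

lemma curve_meridian_mon:
  shows "\<gamma> \<in> curve_meridians f6 f2 b \<Longrightarrow> \<gamma> \<in> loops (PS 2 - C6) b \<and> plane.mon \<gamma> = - 1"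
    and "\<gamma> \<in> curve_meridians f6 f4 b \<Longrightarrow> \<gamma> \<in> loops (PS 2 - C6) b \<and> plane.mon \<gamma> = 1"
proof -
  note XD = arg_cong[OF C6_zeros, of "\<lambda>Z. PS 2 - Z"]
  show "\<gamma> \<in> loops (PS 2 - C6) b \<and> plane.mon \<gamma> = - 1" if m: "\<gamma> \<in> curve_meridians f6 f2 b"
  proof -
    obtain \<Delta> where \<Delta>: "disk_at 2 (zeros 2 f6) \<Delta>" "pt (\<Delta> 0) \<in> zeros 2 f2" "deriv (\<lambda>w. f6 (\<Delta> w)) 0 \<noteq> 0"
      "\<gamma> \<in> disk_loops 2 (zeros 2 f6) b \<Delta>"
      using m unfolding curve_meridians_def by blast
    have f2: "f2 (\<Delta> 0) = 0" using \<Delta>(2) pt_in_zeros[OF hpoly_f2 deriv_f6_disk(1)[OF \<Delta>(1)]] by simp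
    then have "deriv (\<lambda>w. f2 (\<Delta> w)) 0 \<noteq> 0" using \<Delta>(3) deriv_f6_disk(2)[OF \<Delta>(1)] by auto
    then have "if f2 (\<Delta> 0) \<noteq> 0 then - 1 = (1::complex) else deriv (\<lambda>w. f2 (\<Delta> w)) 0 \<noteq> 0 \<and> - 1 = (- 1::complex)"
      using f2 by simp
    then show ?thesis using plane.disk_loop[OF XD \<Delta>(1,4)] by blast
  qed
  show "\<gamma> \<in> loops (PS 2 - C6) b \<and> plane.mon \<gamma> = 1" if m: "\<gamma> \<in> curve_meridians f6 f4 b"
  proof -
    obtain \<Delta> where \<Delta>: "disk_at 2 (zeros 2 f6) \<Delta>" "pt (\<Delta> 0) \<in> zeros 2 f4" "deriv (\<lambda>w. f6 (\<Delta> w)) 0 \<noteq> 0"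
      "\<gamma> \<in> disk_loops 2 (zeros 2 f6) b \<Delta>"
      using m unfolding curve_meridians_def by blast
    have "f4 (\<Delta> 0) = 0" using \<Delta>(2) pt_in_zeros[OF hpoly_f4 deriv_f6_disk(1)[OF \<Delta>(1)]] by simp
    then have "f2 (\<Delta> 0) \<noteq> 0" using \<Delta>(3) deriv_f6_disk(2)[OF \<Delta>(1)] by auto
    then have "if f2 (\<Delta> 0) \<noteq> 0 then 1 = (1::complex) else deriv (\<lambda>w. f2 (\<Delta> w)) 0 \<noteq> 0 \<and> 1 = (- 1::complex)"
      by simp
    then show ?thesis using plane.disk_loop[OF XD \<Delta>(1,4)] by blast
  qed
qed

subsection \<open>Loops with non-trivial monodromy or variation\<close>

context double_cover
begin

text \<open>A logarithm of h along the loop is -ln 2 + 2 pi i t, which increases by 2 pi i. The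
  radius 1/2 keeps h away from 1 and -1, where solving for the vector from h would
  degenerate.\<close>

lemma var_of_winding:
  assumes v: "continuous_on {0..1} v" "\<And>t. t \<in> {0..1} \<Longrightarrow> v t \<in> Y" "v 1 = v 0"
    and h: "\<And>t. t \<in> {0..1} \<Longrightarrow> h (v t) = unit_circle t / 2"
  shows "lift {0..1} (\<lambda>t. pt (v t)) v" "mon (\<lambda>t. pt (v t)) = 1" "var (\<lambda>t. pt (v t)) \<noteq> 0"
proof -
  show l: "lift {0..1} (\<lambda>t. pt (v t)) v" using v(1,2) by (simp add: lift_on_def)
  show "mon (\<lambda>t. pt (v t)) = 1" by (rule mon_loop[OF l]) (use v(3) in auto)
  define L where "L = (\<lambda>t. - of_real (ln 2) + \<i> * of_real (2 * pi * t))"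
  have "exp (- of_real (ln 2) :: complex) = 1 / 2" by (simp add: exp_minus exp_of_real inverse_eq_divide)
  then have e: "exp (L t) = unit_circle t / 2" for t
    unfolding L_def exp_add unit_circle_def cis_conv_exp by simp
  have "continuous_on {0..1} L" unfolding L_def by (intro continuous_intros)
  then have "log_lift {0..1} (\<lambda>t. pt (v t)) v L"
    unfolding log_lift_def e using l h by blast
  from var_eq[OF this] show "var (\<lambda>t. pt (v t)) \<noteq> 0" by (simp add: L_def)
qed

end

lemma half_circle_nz: "1 + unit_circle t / 2 \<noteq> 0" "1 - unit_circle t / 2 \<noteq> 0"
proof -
  have n: "norm (unit_circle t / 2) = 1 / 2" by (simp add: norm_divide unit_circle(4))
  show "1 - unit_circle t / 2 \<noteq> 0"
  proof
    assume "1 - unit_circle t / 2 = 0"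
    then have "unit_circle t / 2 = 1" by simp
    then show False using n by simp
  qed
  show "1 + unit_circle t / 2 \<noteq> 0"
  proof
    assume "1 + unit_circle t / 2 = 0"
    then have "unit_circle t / 2 = - 1" by (simp add: add_eq_0_iff)
    then show False using n by simp
  qed
qed

lemma line_winding_loop:
  obtains g \<gamma> where "line.lift {0..1} \<gamma> g" "line.mon \<gamma> = 1" "line.var \<gamma> \<noteq> 0" "pathfinish \<gamma> = pathstart \<gamma>"
proof -
  \<comment> \<open>The solution of (u - 1)/(u + 1) = \<open>unit_circle t / 2\<close>.\<close>
  define u where "u = (\<lambda>t. (1 + unit_circle t / 2) / (1 - unit_circle t / 2))"
  define v where "v = (\<lambda>t. vec_of [u t, inverse (u t)])"
  have u0: "u t \<noteq> 0" for t using half_circle_nz[of t] by (simp add: u_def)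
  have up: "u t + 1 = 2 / (1 - unit_circle t / 2)" and um: "u t - 1 = unit_circle t / (1 - unit_circle t / 2)" for t
    using half_circle_nz(2)[of t] by (simp_all add: u_def field_simps)
  have cu: "continuous_on {0..1} u" unfolding u_def
    by (intro continuous_intros unit_circle(1)) (use half_circle_nz in auto)
  have cv: "continuous_on {0..1} v"
  proof (rule continuous_on_coordinatewise_then_product)
    fix i :: nat
    consider "i = 0" | "i = 1" | "i > 1" by linarith
    then show "continuous_on {0..1} (\<lambda>t. v t i)"
      by cases (use cu u0 in \<open>auto simp: v_def intro!: continuous_intros\<close>)
  qed
  have vY: "v t \<in> unit_quadric 1 toric (regular_part orb_labels)" for t
  proof -
    have h: "v t \<in> hvec 1" unfolding v_def using u0 vec_of_2_hvec by blast
    have "u t - 1 \<noteq> 0" "u t + 1 \<noteq> 0"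
      unfolding up um using half_circle_nz(2)[of t] unit_circle(3)[of t] by simp_all
    then have "(u t - 1) * (u t + 1) \<noteq> 0" by simp
    then have "u t * u t \<noteq> 1" by (simp add: algebra_simps)
    then have "u t \<noteq> inverse (u t)" using u0[of t] by (metis right_inverse)
    then show ?thesis
      using h u0[of t] pt_in_regular_part[OF h] by (simp add: unit_quadric_def toric_def v_def)
  qed
  have hv: "(v t 0 - 1) / (v t 0 + 1) = unit_circle t / 2" for t
    using half_circle_nz(2)[of t] by (simp add: v_def up um)
  have v01: "v 1 = v 0" by (simp add: v_def u_def unit_circle(5,6))
  note w = line.var_of_winding[OF cv vY v01 hv]
  show thesis by (rule that[OF w]) (simp add: pathfinish_def pathstart_def v01)
qed

lemma line_sign_loop:
  obtains g \<gamma> where "line.lift {0..1} \<gamma> g" "line.mon \<gamma> = - 1" "pathfinish \<gamma> = pathstart \<gamma>"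
proof -
  \<comment> \<open>In the coordinate v_0 / v_1 this is the circle of radius 4, which misses 0 and
    1. There \<open>toric\<close> is 4 times \<open>unit_circle t\<close>, and its root s below
    changes sign.\<close>
  define v where "v = (\<lambda>t. vec_of [4 * unit_circle t, 1])"
  define s where "s = (\<lambda>t::real. 2 * cis (pi * t))"
  have cv: "continuous_on {0..1} v"
  proof (rule continuous_on_coordinatewise_then_product)
    fix i :: nat
    consider "i = 0" | "i = 1" | "i > 1" by linarith
    then show "continuous_on {0..1} (\<lambda>t. v t i)"
      by cases (auto simp: v_def intro!: continuous_intros unit_circle(1))
  qed
  have cs: "continuous_on {0..1} s" unfolding s_def by (intro continuous_intros)
  have vs: "v t \<in> hvec 1 \<and> pt (v t) \<in> regular_part orb_labels \<and> (s t)\<^sup>2 = toric (v t)" for t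
  proof -
    have h: "v t \<in> hvec 1" unfolding v_def vec_of_2_hvec by simp
    have "norm (4 * unit_circle t) = 4" by (simp add: norm_mult unit_circle(4))
    then have "4 * unit_circle t \<noteq> 1" by (metis norm_one numeral_eq_one_iff semiring_norm(83))
    moreover have "(s t)\<^sup>2 = 4 * unit_circle t"
      by (simp add: s_def power_mult_distrib unit_circle_def power2_eq_square cis_mult mult_2[symmetric] mult.assoc)
    ultimately show ?thesis
      using h unit_circle(3)[of t] pt_in_regular_part[OF h] by (simp add: toric_def v_def)
  qed
  have v01: "v 1 = v 0" "s 1 = - 1 * s 0" by (simp_all add: v_def s_def unit_circle(5,6))
  have "line.mon (\<lambda>t. pt (v t)) = - 1"
    by (rule line.mon_of_vectors[OF cv cs vs v01]) simp
  then show thesis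
    by (rule that[OF line.lift_of_vectors[OF cv cs vs]]) (simp add: pathfinish_def pathstart_def v01)
qed

definition vec3_of :: "complex \<Rightarrow> complex \<Rightarrow> complex \<Rightarrow> nat \<Rightarrow> complex" where
  "vec3_of x y z = (\<lambda>i. if i = 0 then x else if i = 1 then y else if i = 2 then z else 0)"

lemma vec3_of [simp]: "vec3_of x y z 0 = x" "vec3_of x y z 1 = y" "vec3_of x y z (Suc 0) = y" "vec3_of x y z 2 = z"
  "i > 2 \<Longrightarrow> vec3_of x y z i = 0"
  by (simp_all add: vec3_of_def)

lemma vec3_of_hvec: "x \<noteq> 0 \<or> y \<noteq> 0 \<or> z \<noteq> 0 \<Longrightarrow> vec3_of x y z \<in> hvec 2"
proof -
  assume "x \<noteq> 0 \<or> y \<noteq> 0 \<or> z \<noteq> 0"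
  then have "vec3_of x y z 0 \<noteq> 0 \<or> vec3_of x y z 1 \<noteq> 0 \<or> vec3_of x y z 2 \<noteq> 0" by simp
  then have "nonzero_vec (vec3_of x y z)" unfolding nonzero_vec_def by blast
  then show ?thesis by (simp add: hvec_def)
qed

lemma continuous_on_vec3_of:
  assumes "continuous_on A x" "continuous_on A y" "continuous_on A z"
  shows "continuous_on A (\<lambda>t. vec3_of (x t) (y t) (z t))"
proof (rule continuous_on_coordinatewise_then_product)
  fix i :: nat
  consider "i = 0" | "i = 1" | "i = 2" | "i > 2" by linarith
  then show "continuous_on A (\<lambda>t. vec3_of (x t) (y t) (z t) i)" by cases (use assms in auto)
qed

text \<open>On the line \<open>x + 3 y = 0\<close> the form \<open>f2\<close> does not depend on \<open>z\<close>, so that \<open>z\<close> can be solved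
  for from the prescribed value of \<open>h\<close>.\<close>
lemma plane_winding_loop:
  obtains g \<gamma> where "plane.lift {0..1} \<gamma> g" "plane.mon \<gamma> = 1" "plane.var \<gamma> \<noteq> 0" "pathfinish \<gamma> = pathstart \<gamma>"
proof -
  \<comment> \<open>With x = -3 y the form f2 becomes -y^2/6, so y^2 = -6 gives the value 1.\<close>
  define y where "y = csqrt (- 6)"
  have y2: "y ^ 2 = - 6" unfolding y_def by (rule power2_csqrt)
  then have y0: "y \<noteq> 0" by auto
  define l where "l = complex_of_real (3 / sqrt 2) * (- 3 * y)"
  have l0: "l \<noteq> 0" using y0 by (simp add: l_def)
  \<comment> \<open>The solution of (l - q)/(l + q) = \<open>unit_circle t / 2\<close>.\<close>
  define q where "q = (\<lambda>t. l * (1 - unit_circle t / 2) / (1 + unit_circle t / 2))"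
  \<comment> \<open>With x = -3 y and y^2 = -6 the conic has the value -3 y z + 3; the last
    coordinate makes it \<open>q t\<close>.\<close>
  define v where "v = (\<lambda>t. vec3_of (- 3 * y) y ((3 - q t) / (3 * y)))"
  have cq: "continuous_on {0..1} q" unfolding q_def
    by (intro continuous_intros unit_circle(1)) (use half_circle_nz in auto)
  have cv: "continuous_on {0..1} v" unfolding v_def
    by (intro continuous_on_vec3_of continuous_intros cq) (use y0 in auto)
  have tv: "tangent_form (v t) = l" for t by (simp add: tangent_form_def v_def l_def)
  have qv: "contact_conic (v t) = q t" for t
    using y0 y2 by (simp add: contact_conic_def v_def)
  have f2v: "f2 (v t) = 1" for t using y2 by (simp add: f2_def Let_def v_def)
  have s: "l + q t = 2 * l / (1 + unit_circle t / 2)" and d: "l - q t = l * unit_circle t / (1 + unit_circle t / 2)" for t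
  proof -
    define e where "e = unit_circle t / 2"
    have e: "1 + e \<noteq> 0" unfolding e_def by (rule half_circle_nz)
    then have l: "l = l * (1 + e) / (1 + e)" by simp
    have "l + q t = (l * (1 + e) + l * (1 - e)) / (1 + e)" "l - q t = (l * (1 + e) - l * (1 - e)) / (1 + e)"
      unfolding add_divide_distrib diff_divide_distrib l[symmetric] by (simp_all add: q_def e_def)
    moreover have "l * (1 + e) + l * (1 - e) = 2 * l" "l * (1 + e) - l * (1 - e) = l * unit_circle t"
      by (simp_all add: algebra_simps e_def)
    ultimately show "l + q t = 2 * l / (1 + unit_circle t / 2)" "l - q t = l * unit_circle t / (1 + unit_circle t / 2)"
      by (simp_all add: e_def)
  qed
  have hv: "(tangent_form (v t) - contact_conic (v t)) / (tangent_form (v t) + contact_conic (v t)) = unit_circle t / 2" for t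
    using half_circle_nz(1)[of t] l0 unfolding tv qv s d by simp
  have vY: "v t \<in> unit_quadric 2 f2 (PS 2 - C6)" for t
  proof -
    have h: "v t \<in> hvec 2" unfolding v_def using y0 by (intro vec3_of_hvec) simp
    have "f4 (v t) = - ((l - q t) * (l + q t))"
      unfolding f4_eq tv qv f2v by (simp add: algebra_simps power2_eq_square)
    also have "\<dots> \<noteq> 0" unfolding s d using half_circle_nz(1)[of t] l0 unit_circle(3)[of t] by simp
    finally show ?thesis using h f2v pt_notin_C6[OF h] by (simp add: unit_quadric_def)
  qed
  have v01: "v 1 = v 0" by (simp add: v_def q_def unit_circle(5,6))
  note w = plane.var_of_winding[OF cv vY v01 hv]
  show thesis by (rule that[OF w]) (simp add: pathfinish_def pathstart_def v01)
qed

text \<open>On the line \<open>[1:2:z]\<close>, \<open>f4\<close> vanishes at \<open>z = 14\<close> and \<open>z = 1/2\<close>, \<open>f2\<close> at \<open>z = 2/7\<close>; the loop is a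
  circle around the latter.\<close>
lemma plane_sign_loop:
  obtains g \<gamma> where "plane.lift {0..1} \<gamma> g" "plane.mon \<gamma> = - 1" "pathfinish \<gamma> = pathstart \<gamma>"
proof -
  \<comment> \<open>The circle has centre 8/28 = 2/7 and radius 3/28, half the distance to the zero
    1/2 of f4; on it f2 is \<open>unit_circle t / 4\<close>.\<close>
  define z where "z = (\<lambda>t. (8 + 3 * unit_circle t) / 28)"
  define v where "v = (\<lambda>t. vec3_of 1 2 (z t))"
  define s where "s = (\<lambda>t::real. cis (pi * t) / 2)"
  have cv: "continuous_on {0..1} v" unfolding v_def z_def
    by (intro continuous_on_vec3_of continuous_intros unit_circle(1)) simp
  have cs: "continuous_on {0..1} s" unfolding s_def by (intro continuous_intros) simp
  have vs: "v t \<in> hvec 2 \<and> pt (v t) \<in> PS 2 - C6 \<and> (s t)\<^sup>2 = f2 (v t)" for t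
  proof -
    have h: "v t \<in> hvec 2" unfolding v_def by (intro vec3_of_hvec) simp
    have f2v: "f2 (v t) = unit_circle t / 4"
      by (simp add: f2_def Let_def v_def z_def field_simps)
    have "(s t)\<^sup>2 = f2 (v t)"
      unfolding f2v by (simp add: s_def power_divide unit_circle_def power2_eq_square cis_mult mult_2[symmetric] mult.assoc)
    moreover have "f4 (v t) = (z t - 14) * (z t - 1 / 2)"
      by (simp add: f4_def Let_def v_def algebra_simps power2_eq_square)
    moreover have "z t \<noteq> 14"
    proof
      assume "z t = 14"
      then have "unit_circle t = 128" by (simp add: z_def field_simps)
      then show False using unit_circle(4)[of t] by simp
    qed
    moreover have "z t \<noteq> 1 / 2"
    proof
      assume "z t = 1 / 2"
      then have "unit_circle t = 2" by (simp add: z_def field_simps)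
      then show False using unit_circle(4)[of t] by simp
    qed
    moreover have "f2 (v t) \<noteq> 0" unfolding f2v using unit_circle(3)[of t] by simp
    ultimately show ?thesis using h pt_notin_C6[OF h] by simp
  qed
  have v01: "v 1 = v 0" "s 1 = - 1 * s 0" by (simp_all add: v_def z_def s_def unit_circle(5,6))
  have "plane.mon (\<lambda>t. pt (v t)) = - 1"
    by (rule plane.mon_of_vectors[OF cv cs vs v01]) simp
  then show thesis
    by (rule that[OF plane.lift_of_vectors[OF cv cs vs]]) (simp add: pathfinish_def pathstart_def v01)
qed

section \<open>Both characters are markings\<close>

lemma plane_marking:
  assumes "b \<in> PS 2 - C6" shows "marking (PS 2 - C6) b plane.character"
proof -
  obtain g \<gamma> where g: "plane.lift {0..1} \<gamma> g" "plane.mon \<gamma> = 1" "plane.var \<gamma> \<noteq> 0" "pathfinish \<gamma> = pathstart \<gamma>"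
    by (rule plane_winding_loop)
  obtain k \<delta> where k: "plane.lift {0..1} \<delta> k" "plane.mon \<delta> = - 1" "pathfinish \<delta> = pathstart \<delta>"
    by (rule plane_sign_loop)
  obtain \<gamma>' where g': "\<gamma>' \<in> loops (PS 2 - C6) b" "plane.mon \<gamma>' = plane.mon \<gamma>"
    "plane.mon \<gamma> = 1 \<longrightarrow> plane.var \<gamma>' = plane.var \<gamma> \<or> plane.var \<gamma>' = - plane.var \<gamma>"
    by (rule plane.based_loop_exists[OF path_connected_complement_C6 assms g(1,4)])
  obtain \<delta>' where d': "\<delta>' \<in> loops (PS 2 - C6) b" "plane.mon \<delta>' = plane.mon \<delta>"
    by (rule plane.based_loop_exists[OF path_connected_complement_C6 assms k(1,3)])
  show ?thesis
  proof (rule plane.marking_character[OF path_connected_complement_C6 assms g'(1) _ _ d'(1)])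
    show "plane.mon \<gamma>' = 1" "plane.mon \<delta>' = - 1" using g'(2) g(2) d'(2) k(2) by simp_all
    show "plane.var \<gamma>' \<noteq> 0" using g'(3) g(2,3) by auto
  qed
qed

lemma line_orbifold_cover:
  assumes "b \<in> regular_part orb_labels"
  shows "orbifold_cover 1 toric (regular_part orb_labels) (\<lambda>v. (v 0 - 1) / (v 0 + 1)) orb_labels b"
proof (intro orbifold_cover.intro orbifold_cover_axioms.intro line.double_cover_axioms refl assms)
  fix p m \<mu>
  assume a: "orb_labels p = enat m" "1 < m" "\<mu> \<in> point_meridians (PS 1 - regular_part orb_labels) p b"
  have "p = pt (vec_of [0, 1]) \<or> p = pt (vec_of [1, 0])"
    using a(1,2) unfolding orb_labels_def by (auto simp: one_enat_def split: if_splits)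
  moreover have "pt (vec_of [0, 1]) \<noteq> pt (vec_of [1, 1])" "pt (vec_of [1, 0]) \<noteq> pt (vec_of [1, 1])"
    using pt_eq_vec_of[of "vec_of [0, 1]" 1 1] pt_eq_vec_of[of "vec_of [1, 0]" 1 1] vec_of_2_hvec by auto
  ultimately have p: "p \<in> {pt (vec_of [0, 1]), pt (vec_of [1, 0]), pt (vec_of [1, 1])}" "p \<noteq> pt (vec_of [1, 1])"
    and l: "orb_labels p = 2"
    by (auto simp: orb_labels_def)
  have "m = 2" using l a(1) by (simp add: numeral_eq_enat)
  then show "m = 2 \<and> \<mu> \<in> loops (regular_part orb_labels) b \<and> line.mon \<mu> = - 1"
    using point_meridian_mon[OF p(1) a(3)] p(2) by simp
qed

lemma line_orb_marking:
  assumes b: "b \<in> regular_part orb_labels"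
  obtains rho where "orb_marking orb_labels b rho"
    "\<And>\<gamma>. \<gamma> \<in> loops (regular_part orb_labels) b \<Longrightarrow> rho (orb_class orb_labels b \<gamma>) = line.mon \<gamma>"
proof -
  interpret orb: orbifold_cover 1 toric "regular_part orb_labels" "\<lambda>v. (v 0 - 1) / (v 0 + 1)" orb_labels b
    by (rule line_orbifold_cover[OF b])
  obtain g \<gamma> where g: "line.lift {0..1} \<gamma> g" "line.mon \<gamma> = 1" "line.var \<gamma> \<noteq> 0" "pathfinish \<gamma> = pathstart \<gamma>"
    by (rule line_winding_loop)
  obtain k \<delta> where k: "line.lift {0..1} \<delta> k" "line.mon \<delta> = - 1" "pathfinish \<delta> = pathstart \<delta>"
    by (rule line_sign_loop)
  obtain \<gamma>' where g': "\<gamma>' \<in> loops (regular_part orb_labels) b" "line.mon \<gamma>' = line.mon \<gamma>"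
    "line.mon \<gamma> = 1 \<longrightarrow> line.var \<gamma>' = line.var \<gamma> \<or> line.var \<gamma>' = - line.var \<gamma>"
    by (rule line.based_loop_exists[OF path_connected_regular_part b g(1,4)])
  obtain \<delta>' where d': "\<delta>' \<in> loops (regular_part orb_labels) b" "line.mon \<delta>' = line.mon \<delta>"
    by (rule line.based_loop_exists[OF path_connected_regular_part b k(1,3)])
  have "orb_marking orb_labels b (orb.orb_lift line.character)"
  proof (rule orb.orb_marking_character[OF g'(1) _ _ d'(1)])
    show "line.mon \<gamma>' = 1" "line.mon \<delta>' = - 1" using g'(2) g(2) d'(2) k(2) by simp_all
    show "line.var \<gamma>' \<noteq> 0" using g'(3) g(2,3) by auto
  qed
  then show thesis by (rule that) (rule orb.orb_lift_class(1))
qed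

text \<open>The image loop avoids the orbifold points, so l and q are non-zero along the lift g with
  f2 = 1. With a = l/q the image is [l^2 : q^2] = [a : 1/a], which lifts the image loop to (a, 1/a).
  As a is odd in g, both lifts close up with the same sign.\<close>

lemma pencil_monodromy:
  assumes \<gamma>: "\<gamma> \<in> loops {p \<in> PS 2 - C6. pencil_map tangent_form contact_conic p \<in> regular_part orb_labels} b"
  shows "pencil_map tangent_form contact_conic \<circ> \<gamma> \<in> loops (regular_part orb_labels) (pencil_map tangent_form contact_conic b)"
    "line.mon (pencil_map tangent_form contact_conic \<circ> \<gamma>) = plane.mon \<gamma>"
    "\<gamma> \<in> loops (PS 2 - C6) b"
proof -
  let ?\<phi> = "pencil_map tangent_form contact_conic"
  note l = loopsD[OF \<gamma>]
  show lp: "\<gamma> \<in> loops (PS 2 - C6) b" using \<gamma> by (auto simp: loops_def)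
  obtain g L where "plane.log_lift {0..1} \<gamma> g L" using plane.log_lift_path[OF loopsD(1,2)[OF lp]] .
  then have g: "plane.lift {0..1} \<gamma> g" by (simp add: plane.log_lift_def)
  have gY: "g t \<in> unit_quadric 2 f2 (PS 2 - C6)" "pt (g t) = \<gamma> t" if "t \<in> {0..1}" for t
    using g that by (simp_all add: lift_on_def)
  define a where "a = (\<lambda>v. tangent_form v / contact_conic v)"
  define G where "G = (\<lambda>t. vec_of [a (g t), inverse (a (g t))])"
  have nz: "tangent_form (g t) \<noteq> 0 \<and> contact_conic (g t) \<noteq> 0 \<and> ?\<phi> (\<gamma> t) = pt (G t) \<and> G t \<in> hvec 1
      \<and> ?\<phi> (\<gamma> t) \<in> regular_part orb_labels" if t: "t \<in> {0..1}" for t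
  proof -
    note d = unit_quadric_f2D[OF gY(1)[OF t]]
    have ph: "?\<phi> (\<gamma> t) = pt (vec_of [tangent_form (g t) ^ 2, contact_conic (g t) ^ 2])"
      unfolding gY(2)[OF t, symmetric] pencil_map_pt[OF d(1,3)] d(2) by simp
    have h: "vec_of [tangent_form (g t) ^ 2, contact_conic (g t) ^ 2] \<in> hvec 1"
      using pencil_vector(1)[OF d(1,3)] vec_of_2_hvec unfolding d(2) by simp
    have "\<gamma> t \<in> path_image \<gamma>" using t by (simp add: path_image_def)
    then have reg: "?\<phi> (\<gamma> t) \<in> regular_part orb_labels" using l(2) by blast
    then have n: "tangent_form (g t) \<noteq> 0" "contact_conic (g t) \<noteq> 0"
      unfolding ph pt_in_regular_part[OF h] by simp_all
    have hG: "G t \<in> hvec 1" unfolding G_def vec_of_2_hvec using n by (simp add: a_def)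
    have "?\<phi> (\<gamma> t) = pt (G t)"
      unfolding ph hvec_1_line_eq[OF h hG] using n by (simp add: G_def a_def field_simps power2_eq_square)
    then show ?thesis using n hG reg by blast
  qed
  have cg: "continuous_on {0..1} g" using g by (simp add: lift_on_def)
  have cF: "continuous_on {0..1} (\<lambda>t. F (g t))" if "hpoly 2 d F" for d F
    by (rule continuous_on_compose2[OF hpoly_continuous[OF that, of UNIV] cg]) simp
  have ca: "continuous_on {0..1} (\<lambda>t. a (g t))"
    unfolding a_def by (intro continuous_on_divide cF[OF hpoly_tangent_form] cF[OF hpoly_conic]) (use nz in blast)
  have a0: "a (g t) \<noteq> 0" if "t \<in> {0..1}" for t using nz[OF that] by (simp add: a_def)
  have cG: "continuous_on {0..1} G"
  proof (rule continuous_on_coordinatewise_then_product)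
    fix i :: nat
    consider "i = 0" | "i = 1" | "i > 1" by linarith
    then show "continuous_on {0..1} (\<lambda>t. G t i)"
      by cases (use ca a0 in \<open>auto simp: G_def intro!: continuous_on_inverse\<close>)
  qed
  have lG: "line.lift {0..1} (?\<phi> \<circ> \<gamma>) G"
    unfolding lift_on_def
  proof (intro conjI ballI cG)
    fix t :: real assume t: "t \<in> {0..1}"
    show "pt (G t) = (?\<phi> \<circ> \<gamma>) t" using nz[OF t] by simp
    have "toric (G t) = 1" using a0[OF t] by (simp add: toric_def G_def)
    moreover have "pt (G t) \<in> regular_part orb_labels" using nz[OF t] by metis
    ultimately show "G t \<in> unit_quadric 1 toric (regular_part orb_labels)" using nz[OF t] by (simp add: unit_quadric_def)
  qed
  have 01: "(0::real) \<in> {0..1}" "(1::real) \<in> {0..1}" by simp_all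
  have "pt (g 0) = pt (g 1)" using gY(2)[OF 01(1)] gY(2)[OF 01(2)] l(3,4) by (simp add: pathstart_def pathfinish_def)
  then obtain e where e: "e = 1 \<or> e = - 1" "g 1 = (\<lambda>i. e * g 0 i)"
    using unit_quadric_proportional[OF hpoly_f2 gY(1)[OF 01(1)] gY(1)[OF 01(2)]] by blast
  have ee: "inverse e = e" "e * e = 1" using e(1) by auto
  have "tangent_form (g 1) = e * tangent_form (g 0)" "contact_conic (g 1) = contact_conic (g 0)"
    using hpoly_scale[OF hpoly_tangent_form, of e "g 0"] hpoly_scale[OF hpoly_conic, of e "g 0"] ee
    unfolding e(2) by (simp_all add: power2_eq_square)
  then have a1: "a (g 1) = e * a (g 0)" by (simp add: a_def)
  have "G 1 i = e * G 0 i" for i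
  proof -
    consider "i = 0" | "i = 1" | "i > 1" by linarith
    then show ?thesis by cases (simp_all add: G_def a1 ee)
  qed
  then have "G 1 = (\<lambda>i. e * G 0 i)" by (rule ext)
  then show "line.mon (?\<phi> \<circ> \<gamma>) = plane.mon \<gamma>"
    using line.mon_loop[OF lG e(1)] plane.mon_loop[OF g e] by simp
  have "continuous_on {0..1} (\<lambda>t. pt (G t))"
    by (rule continuous_on_pt_compose[OF cG]) (use nz hvec_nonzero in blast)
  then have "path (?\<phi> \<circ> \<gamma>)" unfolding path_def
    by (rule continuous_on_eq) (use nz in simp)
  moreover have "path_image (?\<phi> \<circ> \<gamma>) \<subseteq> regular_part orb_labels"
    unfolding path_image_def o_def using nz by (intro image_subsetI) blast
  ultimately show "?\<phi> \<circ> \<gamma> \<in> loops (regular_part orb_labels) (?\<phi> b)"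
    using l(3,4) by (simp add: loops_def pathstart_def pathfinish_def)
qed

lemma pencil_marked:
  assumes b: "b \<in> PS 2 - C6" "pencil_map tangent_form contact_conic b \<in> regular_part orb_labels"
  shows "\<exists>chi rho.
            (\<forall>\<gamma>\<in>curve_meridians f6 f2 b. chi (path_class (PS 2 - C6) \<gamma>) = - 1) \<and>
            (\<forall>\<gamma>\<in>curve_meridians f6 f4 b. chi (path_class (PS 2 - C6) \<gamma>) = 1) \<and>
            (\<forall>p \<in> {pt (vec_of [0, 1]), pt (vec_of [1, 0])}.
               \<forall>\<gamma>\<in>point_meridians (PS 1 - regular_part orb_labels) p (pencil_map tangent_form contact_conic b).
                 rho (orb_class orb_labels (pencil_map tangent_form contact_conic b) \<gamma>) = - 1) \<and>
            (\<forall>\<gamma>\<in>point_meridians (PS 1 - regular_part orb_labels) (pt (vec_of [1, 1]))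
                   (pencil_map tangent_form contact_conic b).
               rho (orb_class orb_labels (pencil_map tangent_form contact_conic b) \<gamma>) = 1) \<and>
            marked_pencil (PS 2 - C6) orb_labels (pencil_map tangent_form contact_conic) b chi rho"
proof -
  let ?\<phi> = "pencil_map tangent_form contact_conic"
  obtain rho where rho: "orb_marking orb_labels (?\<phi> b) rho"
    "\<And>\<gamma>. \<gamma> \<in> loops (regular_part orb_labels) (?\<phi> b) \<Longrightarrow> rho (orb_class orb_labels (?\<phi> b) \<gamma>) = line.mon \<gamma>"
    by (rule line_orb_marking[OF b(2)]) blast
  have ne: "pt (vec_of [0, 1]) \<noteq> pt (vec_of [1, 1])" "pt (vec_of [1, 0]) \<noteq> pt (vec_of [1, 1])"
    using pt_eq_vec_of[of "vec_of [0, 1]" 1 1] pt_eq_vec_of[of "vec_of [1, 0]" 1 1] vec_of_2_hvec by auto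
  have chi: "plane.character (path_class (PS 2 - C6) \<gamma>) = - 1" if "\<gamma> \<in> curve_meridians f6 f2 b" for \<gamma>
    using plane.character_class[OF conjunct1[OF curve_meridian_mon(1)[OF that]]] conjunct2[OF curve_meridian_mon(1)[OF that]] by (rule trans)
  have chi': "plane.character (path_class (PS 2 - C6) \<gamma>) = 1" if "\<gamma> \<in> curve_meridians f6 f4 b" for \<gamma>
    using plane.character_class[OF conjunct1[OF curve_meridian_mon(2)[OF that]]] conjunct2[OF curve_meridian_mon(2)[OF that]] by (rule trans)
  have r: "rho (orb_class orb_labels (?\<phi> b) \<gamma>) = (if p = pt (vec_of [1, 1]) then 1 else - 1)"
    if "p \<in> {pt (vec_of [0, 1]), pt (vec_of [1, 0]), pt (vec_of [1, 1])}"
      "\<gamma> \<in> point_meridians (PS 1 - regular_part orb_labels) p (?\<phi> b)" for p \<gamma>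
    using rho(2)[OF point_meridian_mon(1)[OF that]] point_meridian_mon(2)[OF that] by (rule trans)
  have pull: "is_pullback (PS 2 - C6) orb_labels ?\<phi> b plane.character rho"
    unfolding is_pullback_def
  proof
    fix \<gamma> assume \<gamma>: "\<gamma> \<in> loops {p \<in> PS 2 - C6. ?\<phi> p \<in> regular_part orb_labels} b"
    note m = pencil_monodromy[OF \<gamma>]
    show "plane.character (path_class (PS 2 - C6) \<gamma>) = rho (orb_class orb_labels (?\<phi> b) (?\<phi> \<circ> \<gamma>))"
      unfolding rho(2)[OF m(1)] m(2) by (rule plane.character_class[OF m(3)])
  qed
  show ?thesis
  proof (intro exI[of _ plane.character] exI[of _ rho] conjI ballI)
    show "plane.character (path_class (PS 2 - C6) \<gamma>) = - 1" if "\<gamma> \<in> curve_meridians f6 f2 b" for \<gamma>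
      by (rule chi[OF that])
    show "plane.character (path_class (PS 2 - C6) \<gamma>) = 1" if "\<gamma> \<in> curve_meridians f6 f4 b" for \<gamma>
      by (rule chi'[OF that])
    show "rho (orb_class orb_labels (?\<phi> b) \<gamma>) = - 1"
      if "p \<in> {pt (vec_of [0, 1]), pt (vec_of [1, 0])}"
        "\<gamma> \<in> point_meridians (PS 1 - regular_part orb_labels) p (?\<phi> b)" for p \<gamma>
    proof -
      have "p \<in> {pt (vec_of [0, 1]), pt (vec_of [1, 0]), pt (vec_of [1, 1])}" "p \<noteq> pt (vec_of [1, 1])"
        using that(1) ne by auto
      then show ?thesis using r[OF _ that(2)] by simp
    qed
    show "rho (orb_class orb_labels (?\<phi> b) \<gamma>) = 1"
      if "\<gamma> \<in> point_meridians (PS 1 - regular_part orb_labels) (pt (vec_of [1, 1])) (?\<phi> b)" for \<gamma>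
      using r[OF _ that] by simp
    show "marked_pencil (PS 2 - C6) orb_labels ?\<phi> b plane.character rho"
      unfolding marked_pencil_def using plane_marking[OF b(1)] rho(1) pull by blast
  qed
qed


section \<open>The points \<open>S\<close> and \<open>R\<close>\<close>

text \<open>Where f2 = f4 = 0 the conic vanishes too, that is, x z = y^2/2. Substituted into f2 this
  leaves y z = 0, whence y = 0, and then x z = 0.\<close>

lemma intersection_points:
  assumes "p \<in> C2 \<inter> C4" shows "p = pt (vec3_of 0 0 1) \<or> p = pt (vec3_of 1 0 0)"
proof -
  define v where "v = hcoord p"
  have v: "v \<in> hvec 2" "f2 v = 0" "f4 v = 0" "p = pt v"
    using assms hcoord_in_hvec unfolding C2_def C4_def zeros_eq[OF hpoly_f2] zeros_eq[OF hpoly_f4] v_def by auto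
  have "contact_conic v = 0" using f4_eq[of v] v(2,3) by simp
  then have q: "v 0 * v 2 = v 1 ^ 2 / 2" by (simp add: contact_conic_def)
  have "f2 v = v 1 * v 2 + (v 0 * v 2) / 3 - v 1 ^ 2 / 6" by (simp add: f2_def Let_def algebra_simps)
  then have "v 1 * v 2 = 0" using v(2) unfolding q by simp
  then have v1: "v 1 = 0" using q by auto
  then have v02: "v 0 = 0 \<or> v 2 = 0" using q by simp
  have z: "v i = 0" if "i > 2" for i using v(1) that by (simp add: hvec_def)
  from v02 show ?thesis
  proof
    assume v0: "v 0 = 0"
    have "v i = v 2 * vec3_of 0 0 1 i" for i
    proof -
      consider "i = 0" | "i = 1" | "i = 2" | "i > 2" by linarith
      then show ?thesis by cases (use v0 v1 z[of i] in simp_all)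
    qed
    then have e: "v = (\<lambda>i. v 2 * vec3_of 0 0 1 i)" by (rule ext)
    have "v 2 \<noteq> 0"
    proof
      assume "v 2 = 0"
      then have "v i = 0" for i using fun_cong[OF e, of i] by simp
      then show False using hvec_nonzero[OF v(1)] by (simp add: nonzero_vec_def)
    qed
    then have "pt (\<lambda>i. v 2 * vec3_of 0 0 1 i) = pt (vec3_of 0 0 1)"
      by (intro pt_scale hvec_nonzero[OF vec3_of_hvec]) simp
    then show ?thesis unfolding v(4) e[symmetric] by simp
  next
    assume v2: "v 2 = 0"
    have "v i = v 0 * vec3_of 1 0 0 i" for i
    proof -
      consider "i = 0" | "i = 1" | "i = 2" | "i > 2" by linarith
      then show ?thesis by cases (use v2 v1 z[of i] in simp_all)
    qed
    then have e: "v = (\<lambda>i. v 0 * vec3_of 1 0 0 i)" by (rule ext)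
    have "v 0 \<noteq> 0"
    proof
      assume "v 0 = 0"
      then have "v i = 0" for i using fun_cong[OF e, of i] by simp
      then show False using hvec_nonzero[OF v(1)] by (simp add: nonzero_vec_def)
    qed
    then have "pt (\<lambda>i. v 0 * vec3_of 1 0 0 i) = pt (vec3_of 1 0 0)"
      by (intro pt_scale hvec_nonzero[OF vec3_of_hvec]) simp
    then show ?thesis unfolding v(4) e[symmetric] by simp
  qed
qed

text \<open>At a vector (x, 0, 0) the only monomial of f4 with a first order contribution is -(3/2)
  x^3 z.\<close>

lemma f4_has_derivative:
  fixes \<Psi> :: "'a::real_normed_vector \<Rightarrow> nat \<Rightarrow> complex"
  assumes d: "\<And>i. ((\<lambda>z. \<Psi> z i) has_derivative D i) (at p)" and p: "\<Psi> p 1 = 0" "\<Psi> p 2 = 0"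
  shows "((\<lambda>z. f4 (\<Psi> z)) has_derivative (\<lambda>h. - (3 / 2) * \<Psi> p 0 ^ 3 * D 2 h)) (at p)"
proof -
  have "((\<lambda>z. \<Psi> z 0 * \<Psi> z 0 * (\<Psi> z 2 * \<Psi> z 2)
      - (\<Psi> z 0 * (\<Psi> z 1 * \<Psi> z 1) + 9 / 2 * (\<Psi> z 0 * \<Psi> z 0 * \<Psi> z 1) + 3 / 2 * (\<Psi> z 0 * \<Psi> z 0 * \<Psi> z 0)) * \<Psi> z 2
      + 1 / 4 * (\<Psi> z 1 * \<Psi> z 1 * (\<Psi> z 1 * \<Psi> z 1)) + 3 / 4 * (\<Psi> z 0 * \<Psi> z 0 * (\<Psi> z 1 * \<Psi> z 1)))
    has_derivative (\<lambda>h. - (3 / 2) * \<Psi> p 0 ^ 3 * D 2 h)) (at p)"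
    by (rule derivative_eq_intros d refl)+ (simp add: p p[unfolded One_nat_def] power3_eq_cube fun_eq_iff)
  moreover have "f4 v = v 0 * v 0 * (v 2 * v 2)
      - (v 0 * (v 1 * v 1) + 9 / 2 * (v 0 * v 0 * v 1) + 3 / 2 * (v 0 * v 0 * v 0)) * v 2
      + 1 / 4 * (v 1 * v 1 * (v 1 * v 1)) + 3 / 4 * (v 0 * v 0 * (v 1 * v 1))" for v
    by (simp add: f4_def Let_def power2_eq_square power3_eq_cube power4_eq_xxxx algebra_simps)
  ultimately show ?thesis by presburger
qed

text \<open>In a singular chart the gradient of the equation vanishes, but \<open>f4\<close> has a linear term at
  \<open>[1:0:0]\<close>.\<close>
lemma not_A_singularity:
  "\<not> A_singularity 4 f4 (pt (vec3_of 1 0 0))"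
proof
  assume "A_singularity 4 f4 (pt (vec3_of 1 0 0))"
  then obtain U and \<Psi> :: "complex \<times> complex \<Rightarrow> nat \<Rightarrow> complex" and A B where
    U: "open U" "(0, 0) \<in> U" and hv: "\<forall>z\<in>U. \<Psi> z \<in> hvec 2" and
    d: "\<forall>i. ((\<lambda>z. \<Psi> z i) has_derivative (\<lambda>(h, h'). A i * h + B i * h')) (at (0, 0))" and
    ind: "\<forall>\<alpha> \<beta> \<gamma>. (\<forall>i. \<alpha> * \<Psi> (0, 0) i + \<beta> * A i + \<gamma> * B i = 0) \<longrightarrow> \<alpha> = 0 \<and> \<beta> = 0 \<and> \<gamma> = 0" and
    p: "pt (\<Psi> (0, 0)) = pt (vec3_of 1 0 0)" and
    eq: "\<forall>(s, t)\<in>U. f4 (\<Psi> (s, t)) = s ^ 2 + t ^ (4 + 1)"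
    unfolding A_singularity_def by blast
  have "\<Psi> (0, 0) \<in> hvec 2" "vec3_of 1 0 0 \<in> hvec 2" using hv U(2) vec3_of_hvec[of 1 0 0] by auto
  then obtain c where c: "\<Psi> (0, 0) = (\<lambda>i. c * vec3_of 1 0 0 i)" and nz: "nonzero_vec (\<Psi> (0, 0))"
    using pt_eq_iff[of "vec3_of 1 0 0" "\<Psi> (0, 0)"] p hvec_nonzero by metis
  then have c0: "c \<noteq> 0" by (auto simp: nonzero_vec_def)
  define D where "D = (\<lambda>i (h, h'). A i * h + B i * h')"
  have dD: "((\<lambda>z. \<Psi> z i) has_derivative D i) (at (0, 0))" for i using d by (simp add: D_def)
  have 1: "((\<lambda>z. f4 (\<Psi> z)) has_derivative (\<lambda>h. - (3 / 2) * \<Psi> (0, 0) 0 ^ 3 * D 2 h)) (at (0, 0))"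
    by (rule f4_has_derivative[OF dD]) (simp_all add: c)
  have 2: "((\<lambda>z::complex \<times> complex. fst z ^ 2 + snd z ^ (4 + 1)) has_derivative (\<lambda>_. 0)) (at (0, 0))"
    by (rule derivative_eq_intros refl)+ simp
  have "((\<lambda>z. f4 (\<Psi> z)) has_derivative (\<lambda>_. 0)) (at (0, 0))"
    by (rule has_derivative_transform_within_open[OF 2 U]) (use eq in auto)
  then have "(\<lambda>h. - (3 / 2) * \<Psi> (0, 0) 0 ^ 3 * D 2 h) = (\<lambda>_. 0)"
    by (rule has_derivative_unique[OF 1])
  then have "- (3 / 2) * \<Psi> (0, 0) 0 ^ 3 * D 2 h = 0" for h by (rule fun_cong)
  then have D2: "D 2 h = 0" for h using c0 by (simp add: c)
  have Di: "D i h = 0" if "i > 2" for i h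
  proof -
    have "((\<lambda>z. \<Psi> z i) has_derivative (\<lambda>_. 0)) (at (0, 0))"
      by (rule has_derivative_transform_within_open[OF has_derivative_const[of 0] U])
        (use hv that in \<open>auto simp: hvec_def\<close>)
    from has_derivative_unique[OF dD this] show ?thesis by (rule fun_cong)
  qed
  \<comment> \<open>The point and both tangent vectors now lie in the plane of the coordinates 0 and
    1, so the three cannot be independent.\<close>
  have AB: "A i = 0 \<and> B i = 0" if "i \<ge> 2" for i
    using D2[of "(1, 0)"] D2[of "(0, 1)"] Di[of i "(1, 0)"] Di[of i "(0, 1)"] that
    by (cases "i = 2") (simp_all add: D_def)
  have dep: "\<alpha> = 0 \<and> \<beta> = 0 \<and> \<gamma> = 0"
    if "\<alpha> * c + \<beta> * A 0 + \<gamma> * B 0 = 0" "\<beta> * A 1 + \<gamma> * B 1 = 0" for \<alpha> \<beta> \<gamma>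
  proof -
    have "\<alpha> * \<Psi> (0, 0) i + \<beta> * A i + \<gamma> * B i = 0" for i
    proof -
      consider "i = 0" | "i = 1" | "i \<ge> 2" by linarith
      then show ?thesis
      proof cases
        case 3
        then have "vec3_of 1 0 0 i = 0" by (cases "i = 2") simp_all
        then show ?thesis using AB[OF 3] by (simp add: c)
      qed (use that in \<open>simp_all add: c\<close>)
    qed
    then show ?thesis using ind by blast
  qed
  show False
  proof (cases "A 1 = 0 \<and> B 1 = 0")
    case True
    then show False using dep[of "- A 0 / c" 1 0] c0 by simp
  next
    case False
    \<comment> \<open>The coefficients \<open>B 1\<close> of A and \<open>- A 1\<close> of B cancel
      coordinate 1, and a multiple of \<open>\<Psi> (0, 0)\<close> then cancels coordinate
      0.\<close>
    have "(A 1 * B 0 - B 1 * A 0) / c * c + B 1 * A 0 + - A 1 * B 0 = 0" "B 1 * A 1 + - A 1 * B 1 = 0"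
      using c0 by simp_all
    from dep[OF this] False show False by simp
  qed
qed

section \<open>The conic at S\<close>

lemma dirderiv_conic:
  "dirderiv contact_conic (\<lambda>i. c * vec3_of 0 0 1 i) w = c * w 0"
proof -
  have "((\<lambda>t. t * w 0 * (c + t * w 2) - (t * w 1) ^ 2 / 2) has_field_derivative c * w 0) (at 0)"
    by (auto intro!: derivative_eq_intros)
  then show ?thesis unfolding dirderiv_def contact_conic_def by (simp add: DERIV_imp_deriv)
qed

text \<open>The gradient of x z - y^2/2 at (0, 0, c) is (c, 0, 0), so the conic is smooth at S with
  tangent x = 0.\<close>

lemma conic_at_S:
  assumes "S = pt (vec3_of 0 0 1)"
  shows "S \<in> zeros 2 contact_conic" "smooth_at 2 contact_conic S" "zeros 2 tangent_form = tangent_hyperplane 2 contact_conic S"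
proof -
  have h: "vec3_of 0 0 1 \<in> hvec 2" by (rule vec3_of_hvec) simp
  show z: "S \<in> zeros 2 contact_conic"
    unfolding assms pt_in_zeros[OF hpoly_conic h] by (simp add: contact_conic_def)
  obtain c where c: "c \<noteq> 0" "hcoord S = (\<lambda>i. c * vec3_of 0 0 1 i)"
    unfolding assms by (rule hcoord_ptE[OF hvec_nonzero[OF h]])
  have d: "dirderiv contact_conic (hcoord S) w = c * w 0" for w unfolding c(2) by (rule dirderiv_conic)
  have "vec3_of 1 0 0 \<in> hvec 2" by (rule vec3_of_hvec) simp
  then show "smooth_at 2 contact_conic S"
    unfolding smooth_at_def d using z c(1) by (intro conjI bexI[of _ "vec3_of 1 0 0"]) simp_all
  have "tangent_form w = 0 \<longleftrightarrow> c * w 0 = 0" for w using c(1) by (simp add: tangent_form_def)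
  then show "zeros 2 tangent_form = tangent_hyperplane 2 contact_conic S"
    unfolding zeros_def tangent_hyperplane_def d by simp
qed

section \<open>The pencil of quartics\<close>

lemma quartic_pencil:
  "\<exists>V. pencil 4 V \<and> {\<lambda>v. f2 v * tangent_form v ^ 2, f4, \<lambda>v. contact_conic v ^ 2} \<subseteq> V"
proof -
  define F where "F = (\<lambda>v. f2 v * tangent_form v ^ 2)"
  define G where "G = (\<lambda>v. contact_conic v ^ 2)"
  define V where "V = {\<lambda>v. a * F v + b * G v | a b. (a, b) \<noteq> (0, 0)}"
  have "a = 0 \<and> b = 0" if "\<forall>v. a * F v + b * G v = 0" for a b
  proof
    \<comment> \<open>At [0:1:0] the tangent form vanishes and the conic does not.\<close>
    show "b = 0" using spec[OF that, of "vec3_of 0 1 0"] by (simp add: F_def G_def tangent_form_def contact_conic_def)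
    \<comment> \<open>At [1:1:1/2] it is the conic that vanishes, while f2 and the tangent form are
      non-zero.\<close>
    have "f2 (vec3_of 1 1 (1 / 2)) \<noteq> 0" by (simp add: f2_def Let_def)
    then show "a = 0" using spec[OF that, of "vec3_of 1 1 (1 / 2)"]
      by (simp add: F_def G_def tangent_form_def contact_conic_def)
  qed
  then have "pencil 4 V"
    unfolding pencil_def V_def using hpoly_pencil_members[folded F_def G_def]
    by (intro exI[of _ F] exI[of _ G]) blast
  moreover have mem: "(\<lambda>v. a * F v + b * G v) \<in> V" if "(a, b) \<noteq> (0, 0)" for a b
    using that unfolding V_def by blast
  have "F \<in> V" using mem[of 1 0] by simp
  moreover have "G \<in> V" using mem[of 0 1] by simp
  moreover have "f4 = (\<lambda>v. - 1 * F v + 1 * G v)" by (simp add: f4_eq F_def G_def fun_eq_iff)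
  then have "f4 \<in> V" using mem[of "- 1" 1] by (metis prod.inject zero_neq_one)
  ultimately have "pencil 4 V \<and> {F, f4, G} \<subseteq> V" by blast
  then show ?thesis unfolding F_def G_def by blast
qed

theorem mainTheorem3:
  fixes S R :: proj
  assumes "C2 \<inter> C4 = {S, R}" and "S \<noteq> R" and "A_singularity 4 f4 S"
  shows "\<exists>q l :: form.
      plane_curve_eq 2 q \<and> plane_curve_eq 1 l \<and>
      S \<in> zeros 2 q \<and> R \<in> zeros 2 q \<and>
      smooth_at 2 q S \<and> zeros 2 l = tangent_hyperplane 2 q S \<and>
      (\<exists>V. pencil 4 V \<and> {\<lambda>v. f2 v * l v ^ 2, f4, \<lambda>v. q v ^ 2} \<subseteq> V) \<and>
      global_quotient_orbifold_pencil
        (integer_mod_group 2) 1 cover_curve cover_action cover_map orb_labels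
        2 (PS 2 - C6) (pencil_map l q) \<and>
      (\<forall>b \<in> PS 2 - C6. pencil_map l q b \<in> regular_part orb_labels \<longrightarrow>
         (\<exists>chi rho.
            (\<forall>\<gamma>\<in>curve_meridians f6 f2 b. chi (path_class (PS 2 - C6) \<gamma>) = - 1) \<and>
            (\<forall>\<gamma>\<in>curve_meridians f6 f4 b. chi (path_class (PS 2 - C6) \<gamma>) = 1) \<and>
            (\<forall>p \<in> {pt (vec_of [0, 1]), pt (vec_of [1, 0])}.
               \<forall>\<gamma>\<in>point_meridians (PS 1 - regular_part orb_labels) p (pencil_map l q b).
                 rho (orb_class orb_labels (pencil_map l q b) \<gamma>) = - 1) \<and>
            (\<forall>\<gamma>\<in>point_meridians (PS 1 - regular_part orb_labels) (pt (vec_of [1, 1]))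
                   (pencil_map l q b).
               rho (orb_class orb_labels (pencil_map l q b) \<gamma>) = 1) \<and>
            marked_pencil (PS 2 - C6) orb_labels (pencil_map l q) b chi rho))"
proof -
  \<comment> \<open>The singularity decides which of the two common points is S: at [1:0:0] the
    quartic has a linear term.\<close>
  have "S \<noteq> pt (vec3_of 1 0 0)" using assms(3) not_A_singularity by blast
  then have S: "S = pt (vec3_of 0 0 1)" using intersection_points[of S] assms(1) by blast
  have R: "R = pt (vec3_of 1 0 0)" using intersection_points[of R] assms(1,2) S by blast
  have h: "vec3_of 1 0 0 \<in> hvec 2" by (rule vec3_of_hvec) simp
  have "contact_conic (vec3_of 0 1 0) \<noteq> 0" "tangent_form (vec3_of 1 0 0) \<noteq> 0"
    by (simp_all add: contact_conic_def tangent_form_def)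
  then have c: "plane_curve_eq 2 contact_conic" "plane_curve_eq 1 tangent_form"
    unfolding plane_curve_eq_def using hpoly_conic hpoly_tangent_form by blast+
  have Rz: "R \<in> zeros 2 contact_conic" unfolding R pt_in_zeros[OF hpoly_conic h] by (simp add: contact_conic_def)
  show ?thesis
    by (rule exI[of _ contact_conic], rule exI[of _ tangent_form], intro conjI c conic_at_S[OF S] Rz quartic_pencil
        pencil_global_quotient ballI impI pencil_marked)
qed

end
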